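(* There exists a constant $C>0$ such that the number $S(n)$ of multiplicative Sidon subsets of $[n]=\{1,\ldots,n\}$ satisfies $$T(n)\cdot 2^{(\sqrt{2}+o(1))\frac{n^{3/4}}{(\log n)^{3/2}}}\le S(n)\le T(n)\cdot 2^{C\frac{n^{3/4}}{(\log n)^{3/2}}},$$ where $$T(n):=\prod_{p \text{ prime: } n^{2/3}< p\le n}\left(\lfloor n/p\rfloor+1\right),$$ and $o(1)$ denotes a quantity tending to $0$ as $n\to\infty$.
   Context: A set $S\subseteq\mathbb{N}$ is a multiplicative Sidon set if there are no distinct elements $a_1,a_2,b_1,b_2\in S$ with $a_1a_2=b_1b_2$ (i.e. the products of pairs of elements of $S$ are distinct). $S(n)$ denotes the number of subsets of $[n]$ (including the empty set) that are multiplicative Sidon sets. *)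

theory Defs
  imports "HOL-Computational_Algebra.Primes" Complex_Main
begin

definition mult_sidon :: "nat set \<Rightarrow> bool" where
  "mult_sidon S \<longleftrightarrow>
     \<not> (\<exists>a1\<in>S. \<exists>a2\<in>S. \<exists>b1\<in>S. \<exists>b2\<in>S.
          distinct [a1, a2, b1, b2] \<and> a1 * a2 = b1 * b2)"

definition S_count :: "nat \<Rightarrow> nat" where
  "S_count n = card {A. A \<subseteq> {1..n} \<and> mult_sidon A}"

definition T_prod :: "nat \<Rightarrow> nat" where
  "T_prod n = (\<Prod>p\<in>{p. prime p \<and> real n powr (2/3) < real p \<and> p \<le> n}. n div p + 1)"

definition sidon_scale :: "nat \<Rightarrow> real" where
  "sidon_scale n = real n powr (3/4) / (ln (real n)) powr (3/2)"

end

theory Submission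
  imports Defs "HOL-Number_Theory.Cong" "HOL-Analysis.Analysis" "HOL-Real_Asymp.Real_Asymp" "HOL-Library.Infinite_Set"
begin

text \<open>Choosing at most one multiple of each prime \<open>p > n\<^sup>2\<^sup>/\<^sup>3\<close> gives \<open>T(n)\<close> Sidon sets, and each of them can be
  enlarged by any subset of a fixed Sidon set of numbers without such prime factors. Such a Sidon set is obtained
  from a \<open>C\<^sub>4\<close>-free bipartite graph between primes as the set of the products along its edges. The
  graph used here joins the small primes (points of an affine plane over a prime field) to larger primes (lines),
  where a line keeps only those points for which the product is at most \<open>n\<close>. This has so many
  edges that Chebyshev-type estimates suffice to beat the constant \<open>sqrt 2\<close>, so the error term can be taken to be \<open>0\<close>.

  For the upper bound, a Sidon set contains few multiples of large primes beyond one for each of them. Every other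
  number either is a product \<open>u * v\<close> with \<open>u\<close> below \<open>sqrt n / (ln n)\<^sup>8\<close> and \<open>v \<le> n\<^sup>2\<^sup>/\<^sup>3\<close>, and there
  the extremal bound for \<open>C\<^sub>4\<close>-free graphs already suffices, or it has the form \<open>u * (w * r)\<close>, where
  \<open>u \<le> w\<close> have no prime factor below \<open>n\<^sup>1\<^sup>/\<^sup>7\<close> and \<open>r\<close> is small. The latter numbers are split
  according to the dyadic size of \<open>sqrt n / u\<close>, and the Sidon sets in each class are counted by the
  Kleitman-Winston method; the increasing imbalance of the two sides makes the contributions summable.\<close>

section \<open>Chebyshev estimates\<close>

text \<open>Write l = ln n. The target n^(3/4) / l^(3/2) is the extremal number of edges of a
  C4-free graph whose two sides have about sqrt n / l vertices. Two obstacles shape the upper bound.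
  Counting Sidon sets by their size alone costs a factor l per element, so it is affordable only
  where the extremal bound beats the target by a power of l; the exponent 8 in sqrt n / l^8 ensures
  this. Near sqrt n, both sides must have density about 1 / l, which is why rough factors are
  extracted, and no factor l may be lost, which is why whole graphs are counted.

  In the lower bound the margin is less than half a percent, and this fixes most of the odd
  decimals. From ln 5 / 2 \<ge> 0.8 the j-th prime is at most 1.26 * j * ln j, as 1.26 > 1 / 0.8.
  The graph then has at least about 120/169 * (2 / 1.26)^(3/2) > 1.419 times n^(3/4) / l^(3/2)
  edges, while sqrt 2 < 1.4143.\<close>

definition primes_le :: "real \<Rightarrow> nat set" where
  "primes_le x = {p. prime p \<and> real p \<le> x}"

definition prime_pi :: "real \<Rightarrow> nat" where
  "prime_pi x = card (primes_le x)"

lemma finite_nat_le_real [simp]: "finite {k::nat. real k \<le> x}"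
proof (rule finite_subset)
  show "{k::nat. real k \<le> x} \<subseteq> {..nat \<lfloor>x\<rfloor>}"
    by (auto simp: le_nat_floor)
qed simp

lemma finite_primes_le [simp]: "finite (primes_le x)"
  unfolding primes_le_def by (rule finite_subset[OF _ finite_nat_le_real[of x]]) auto

lemma primes_le_nat: "primes_le (real n) = {p. prime p \<and> p \<le> n}"
  by (auto simp: primes_le_def)

lemma prime_pi_mono: "x \<le> y \<Longrightarrow> prime_pi x \<le> prime_pi y"
  unfolding prime_pi_def by (rule card_mono) (auto simp: primes_le_def)

lemma card_pos_nat_le_real:
  assumes "0 \<le> x" "\<And>k. k \<in> A \<Longrightarrow> 0 < k \<and> real k \<le> x"
  shows "real (card A) \<le> x"
proof -
  have "A \<subseteq> {1..nat \<lfloor>x\<rfloor>}"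
    using assms(2) by (force simp: le_nat_floor)
  then have "card A \<le> nat \<lfloor>x\<rfloor>"
    using card_mono[of "{1..nat \<lfloor>x\<rfloor>}" A] by simp
  then show ?thesis
    using assms(1) by (meson le_nat_floor of_nat_floor of_nat_le_iff order_trans)
qed

section \<open>Upper bounds for the prime counting function from the primorial\<close>

lemma prod_primes_dvd:
  assumes "finite P" "\<And>p. p \<in> P \<Longrightarrow> prime p \<and> p dvd (N::nat)"
  shows "\<Prod>P dvd N"
  using assms
proof (induction P rule: finite_induct)
  case (insert q P)
  have "coprime q (\<Prod>P)"
    using insert by (intro prod_coprime_right) (metis insertCI primes_coprime)
  then show ?case
    using insert by (simp add: divides_mult)
qed simp

text \<open>The two central coefficients of an odd row are equal and together at most the row
  sum.\<close>

lemma choose_middle_le: "(2 * m + 1) choose m \<le> 4 ^ m"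
proof -
  have "(\<Sum>k\<in>{m, m + 1}. (2 * m + 1) choose k) \<le> (\<Sum>k\<le>2 * m + 1. (2 * m + 1) choose k)"
    by (rule sum_mono2) auto
  moreover have "(2 * m + 1) choose (m + 1) = (2 * m + 1) choose m"
    using binomial_symmetric[of "m + 1" "2 * m + 1"] by simp
  ultimately have "2 * ((2 * m + 1) choose m) \<le> 2 ^ (2 * m + 1)"
    by (simp only: choose_row_sum) simp
  then show ?thesis
    by (simp add: power_mult)
qed

text \<open>Erdos' induction: the primes in (m + 1, 2 * m + 1] all divide the central coefficient,
  which is at most 4^m, and the smaller primes are covered by the case m + 1. An even n > 2 adds no
  prime.\<close>

lemma primorial_le: "\<Prod>{p. prime p \<and> p \<le> n} \<le> (4::nat) ^ n"
proof (induction n rule: less_induct)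
  case (less n)
  consider "n < 2" | "n = 2" | "n > 2" "even n" | "n > 2" "odd n"
    by linarith
  then show ?case
  proof cases
    case 1
    then have "{p::nat. prime p \<and> p \<le> n} = {}"
      by (auto dest: prime_ge_2_nat)
    then show ?thesis by (metis prod.empty one_le_numeral one_le_power)
  next
    case 2
    then have "{p::nat. prime p \<and> p \<le> n} = {2}"
      by (auto dest: prime_ge_2_nat)
    then have "\<Prod>{p. prime p \<and> p \<le> n} = \<Prod>{2::nat}" by (rule arg_cong)
    then show ?thesis using 2 by (simp only:) simp
  next
    case 3
    then have "\<not> prime n"
      using primes_dvd_imp_eq two_is_prime_nat by blast
    then have "{p. prime p \<and> p \<le> n} = {p. prime p \<and> p \<le> n - 1}"
      using 3 by (auto simp: le_less Suc_le_eq)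
    then have "\<Prod>{p. prime p \<and> p \<le> n} \<le> 4 ^ (n - 1)"
      using less[of "n - 1"] 3 by simp
    also have "\<dots> \<le> 4 ^ n" by (intro power_increasing) auto
    finally show ?thesis .
  next
    case 4
    then obtain m where m: "n = 2 * m + 1" by (auto elim: oddE)
    have m1: "m \<ge> 1" using 4 m by simp
    let ?A = "{p. prime p \<and> p \<le> m + 1}" and ?B = "{p. prime p \<and> m + 1 < p \<and> p \<le> n}"
    have split: "{p. prime p \<and> p \<le> n} = ?A \<union> ?B"
      using m by auto
    have "\<Prod>?B dvd (2 * m + 1) choose m"
    proof (rule prod_primes_dvd)
      fix p assume p: "p \<in> ?B"
      have "fact m * fact (m + 1) * ((2 * m + 1) choose m) = (fact (2 * m + 1) :: nat)"
        using binomial_fact_lemma[of m "2 * m + 1"] by (simp add: mult_ac)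
      moreover have "p dvd (fact (2 * m + 1) :: nat)"
        using p m prime_dvd_fact_iff[of p "2 * m + 1"] by auto
      moreover have "\<not> p dvd (fact m :: nat)" "\<not> p dvd (fact (m + 1) :: nat)"
        using p prime_dvd_fact_iff[of p "m"] prime_dvd_fact_iff[of p "m + 1"] by auto
      ultimately show "prime p \<and> p dvd (2 * m + 1) choose m"
        using p by (metis (no_types, lifting) mem_Collect_eq prime_dvd_mult_iff)
    qed auto
    then have "\<Prod>?B \<le> (2 * m + 1) choose m"
      by (rule dvd_imp_le) (simp add: zero_less_binomial)
    also have "\<dots> \<le> 4 ^ m" by (rule choose_middle_le)
    finally have B: "\<Prod>?B \<le> 4 ^ m" .
    have A: "\<Prod>?A \<le> 4 ^ (m + 1)"
      using less[of "m + 1"] m m1 by simp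
    have "\<Prod>{p. prime p \<and> p \<le> n} = \<Prod>?A * \<Prod>?B"
      unfolding split by (rule prod.union_disjoint) auto
    also have "\<dots> \<le> 4 ^ (m + 1) * 4 ^ m"
      using A B by (rule mult_mono) auto
    also have "\<dots> = 4 ^ n" by (simp add: m power_add[symmetric])
    finally show ?thesis .
  qed
qed

text \<open>Each prime above x^a adds at least a * ln x to the logarithm of the primorial, and the
  primes below x^a are counted trivially. The free exponent trades the error x^a against the
  constant ln 4 / a.\<close>

lemma prime_pi_le_powr:
  fixes x a :: real
  assumes x: "x > 1" and a: "0 < a"
  shows "prime_pi x \<le> x powr a + x * ln 4 / (a * ln x)"
proof -
  let ?A = "{p. prime p \<and> real p \<le> x powr a}" and ?B = "{p. prime p \<and> x powr a < real p \<and> real p \<le> x}"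
  let ?n = "nat \<lfloor>x\<rfloor>"
  have fB: "finite ?B" by (rule finite_subset[OF _ finite_nat_le_real[of x]]) auto
  have fA: "finite ?A" by (rule finite_subset[OF _ finite_nat_le_real[of "x powr a"]]) auto
  have "real (card ?A) \<le> x powr a"
    by (rule card_pos_nat_le_real) (auto simp: prime_gt_0_nat)
  have lnx: "ln x > 0" using x by simp
  have "real (card ?B) * (a * ln x) = (\<Sum>p\<in>?B. ln (x powr a))"
    using x by (simp add: ln_powr)
  also have "\<dots> \<le> (\<Sum>p\<in>?B. ln (real p))"
    by (intro sum_mono ln_mono) (use x in auto)
  also have "\<dots> = ln (real (\<Prod>?B))"
    by (subst of_nat_prod, subst ln_prod) (auto simp: fB prime_gt_0_nat)
  also have "\<dots> \<le> ln (real (\<Prod>{p. prime p \<and> p \<le> ?n}))"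
  proof -
    have "\<Prod>?B \<le> \<Prod>{p. prime p \<and> p \<le> ?n}"
      by (intro dvd_imp_le prod_dvd_prod_subset prod_pos) (auto simp: le_nat_floor prime_gt_0_nat)
    moreover have "\<Prod>?B > 0" by (auto intro!: prod_pos simp: prime_gt_0_nat)
    ultimately show ?thesis by (intro ln_mono) (simp_all only: of_nat_0_less_iff of_nat_le_iff)
  qed
  also have "\<dots> \<le> ln (real (4 ^ ?n))"
    using primorial_le[of ?n] by (intro ln_mono) (auto simp only: of_nat_0_less_iff of_nat_le_iff intro!: prod_pos simp: prime_gt_0_nat)
  also have "\<dots> = ?n * ln 4" by (simp add: ln_realpow)
  also have "\<dots> \<le> x * ln 4"
    using x by (intro mult_right_mono) auto
  finally have "real (card ?B) \<le> x * ln 4 / (a * ln x)"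
    using lnx a by (simp add: field_simps)
  moreover have "prime_pi x \<le> card ?A + card ?B"
    unfolding prime_pi_def primes_le_def
    by (rule order_trans[OF card_mono card_Un_le]) (use fA fB in auto)
  ultimately show ?thesis using \<open>real (card ?A) \<le> x powr a\<close> by linarith
qed

definition chebyshev_const :: real where "chebyshev_const = 2 + 2 * ln 4"

lemma chebyshev_const_pos: "chebyshev_const > 0" by (simp add: chebyshev_const_def add_pos_pos)

text \<open>The choice a = 1/2 gives a bound for all x > 1. It serves the count of rough numbers,
  where any constant will do.\<close>

lemma prime_pi_upper:
  assumes "x > 1"
  shows "prime_pi x \<le> chebyshev_const * x / ln x"
proof -
  have "ln (sqrt x) \<le> sqrt x" using assms ln_bound[of "sqrt x"] by simp
  then have l: "ln x \<le> 2 * sqrt x" using assms by (simp add: ln_sqrt)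
  have lnx: "ln x > 0" using assms by simp
  have "sqrt x * ln x \<le> sqrt x * (2 * sqrt x)"
    using l assms by (intro mult_left_mono) auto
  also have "\<dots> = 2 * x" using assms by simp
  finally have "sqrt x \<le> 2 * x / ln x" using lnx by (simp add: field_simps)
  moreover have "x powr (1/2) = sqrt x" using assms by (simp add: powr_half_sqrt)
  moreover have "x * ln 4 / (1/2 * ln x) = 2 * ln 4 * x / ln x" by (simp add: field_simps)
  ultimately show ?thesis
    using prime_pi_le_powr[OF assms, of "1/2"]
    unfolding chebyshev_const_def by (simp add: add_divide_distrib ring_distribs mult_ac)
qed

text \<open>Here the constant matters: \<open>prime_in_interval\<close> compares it with 3 * 0.8 =
  2.4.\<close>

lemma prime_pi_upper_sharp: "\<forall>\<^sub>F x in at_top. prime_pi x \<le> 2.2 * x / ln x"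
proof -
  have "ln (4::real) = 2 * ln 2" using ln_realpow[of 2 2] by simp
  then have l4: "ln (4::real) \<le> 1.4" using ln2_le_25_over_36 by simp
  have "\<forall>\<^sub>F x::real in at_top. x powr (3/4) + x * 1.4 / (3/4 * ln x) \<le> 2.2 * x / ln x"
    by real_asymp
  moreover have "\<forall>\<^sub>F x::real in at_top. x > 1" by (rule eventually_gt_at_top)
  ultimately show ?thesis
  proof eventually_elim
    case (elim x)
    have "x * ln 4 / (3/4 * ln x) \<le> x * 1.4 / (3/4 * ln x)"
      using elim l4 by (intro divide_right_mono mult_left_mono) auto
    then show ?case using prime_pi_le_powr[of x "3/4"] elim by linarith
  qed
qed

section \<open>Lower bounds for the prime counting function from integrals of integer
  polynomials\<close>

definition int_coeffs :: "real poly \<Rightarrow> bool" where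
  "int_coeffs p \<longleftrightarrow> (\<forall>i. coeff p i \<in> \<int>)"

lemma int_coeffs_mult: "int_coeffs p \<Longrightarrow> int_coeffs q \<Longrightarrow> int_coeffs (p * q)"
  unfolding int_coeffs_def by (auto simp: coeff_mult intro!: Ints_sum)

lemma int_coeffs_power: "int_coeffs p \<Longrightarrow> int_coeffs (p ^ n)"
  by (induction n) (simp_all add: int_coeffs_mult, simp add: int_coeffs_def)

text \<open>The denominators are at most d + 1, so for integer coefficients the integral becomes an
  integer after multiplication by a common multiple of 1, ..., d + 1.\<close>

lemma has_integral_poly_01:
  assumes "degree p \<le> d"
  shows "((\<lambda>x. poly p x) has_integral (\<Sum>i\<le>d. coeff p i / real (i + 1))) {0..1::real}"
proof -
  have *: "((\<lambda>x. coeff p i * x ^ i) has_integral (coeff p i / real (i + 1))) {0..1}" for i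
  proof -
    have "((\<lambda>x. x ^ i) has_integral (1 ^ (i + 1) / real (i + 1) - 0 ^ (i + 1) / real (i + 1))) {0..1::real}"
    proof (rule fundamental_theorem_of_calculus)
      fix x :: real
      show "((\<lambda>x. x ^ (i + 1) / real (i + 1)) has_vector_derivative x ^ i) (at x within {0..1})"
        using DERIV_cdivide[OF DERIV_pow[of "Suc i" x "{0..1}"], of "real (Suc i)"]
        by (simp add: has_real_derivative_iff_has_vector_derivative del: of_nat_Suc)
    qed simp
    from has_integral_mult_right[OF this, of "coeff p i"] show ?thesis by simp
  qed
  have "poly p x = (\<Sum>i\<le>d. coeff p i * x ^ i)" for x
    unfolding poly_altdef using assms by (intro sum.mono_neutral_left) (auto simp: coeff_eq_0)
  then show ?thesis
    using has_integral_sum[of "{..d}", OF _ *] by (simp add: fun_eq_iff)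
qed

text \<open>The least common multiple of 1, ..., D, written through its prime powers so that the
  bound by a power of D can be read off factor by factor.\<close>

definition lcm_upto :: "nat \<Rightarrow> nat" where
  "lcm_upto D = (\<Prod>p | prime p \<and> p \<le> D. p ^ (GREATEST e. p ^ e \<le> D))"

lemma greatest_power:
  assumes "prime (p::nat)" "D \<ge> 1"
  shows "p ^ (GREATEST e. p ^ e \<le> D) \<le> D" "p ^ e \<le> D \<Longrightarrow> e \<le> (GREATEST e. p ^ e \<le> D)"
proof -
  have b: "\<forall>y. p ^ y \<le> D \<longrightarrow> y \<le> D"
    using assms by (meson less_exp less_imp_le order_trans power_mono prime_ge_2_nat zero_le)
  show "p ^ (GREATEST e. p ^ e \<le> D) \<le> D"
    by (rule GreatestI_nat[where P = "\<lambda>e. p ^ e \<le> D", of 0, OF _ b[rule_format]]) (use assms in auto)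
  show "p ^ e \<le> D \<Longrightarrow> e \<le> (GREATEST e. p ^ e \<le> D)"
    by (rule Greatest_le_nat[where P = "\<lambda>e. p ^ e \<le> D", OF _ b[rule_format]]) auto
qed

lemma dvd_lcm_upto:
  assumes "1 \<le> i" "i \<le> D"
  shows "i dvd lcm_upto D"
proof -
  have "i = (\<Prod>p\<in>prime_factors i. p ^ multiplicity p i)"
    using assms by (simp add: prime_factorization_nat)
  also have "\<dots> dvd (\<Prod>p\<in>prime_factors i. p ^ (GREATEST e. p ^ e \<le> D))"
  proof (rule prod_dvd_prod, rule le_imp_power_dvd)
    fix p assume p: "p \<in> prime_factors i"
    have "p ^ multiplicity p i \<le> i"
      using assms by (intro dvd_imp_le multiplicity_dvd) auto
    then show "multiplicity p i \<le> (GREATEST e. p ^ e \<le> D)"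
      using assms p by (intro greatest_power) auto
  qed
  also have "\<dots> dvd lcm_upto D"
    unfolding lcm_upto_def
    by (rule prod_dvd_prod_subset)
       (use assms in \<open>auto simp: in_prime_factors_iff dest!: dvd_imp_le\<close>)
  finally show ?thesis .
qed

lemma lcm_upto_le:
  assumes "D \<ge> 1"
  shows "lcm_upto D \<le> D ^ prime_pi (real D)"
  unfolding lcm_upto_def prime_pi_def primes_le_nat
  using prod_mono[of "{p. prime p \<and> p \<le> D}" "\<lambda>p. p ^ (GREATEST e. p ^ e \<le> D)" "\<lambda>_. D"] greatest_power(1) assms
  by simp

lemma lcm_upto_pos: "lcm_upto D > 0"
  unfolding lcm_upto_def by (auto intro!: prod_pos simp: prime_gt_0_nat)

text \<open>The integer polynomial \<open>x\<^sup>2 (1 - x)\<^sup>2 (2 x - 1)\<close> improves the constant \<open>ln 2\<close>, which \<open>x (1 - x)\<close> gives in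
  \<open>prime_pi_lower\<close>, to \<open>ln 5 / 2\<close>; with \<open>ln 2\<close> the graph \<open>line_graph\<close> would be too sparse to reach \<open>sqrt 2\<close>.\<close>

lemma nair_poly_bound:
  fixes x :: real
  assumes "0 \<le> x" "x \<le> 1"
  shows "(x\<^sup>2 * (1 - x)\<^sup>2 * (2 * x - 1))\<^sup>2 \<le> 1 / 5 ^ 5"
proof -
  define s where "s = (2 * x - 1)\<^sup>2"
  have s: "0 \<le> s" "s \<le> 1"
    using assms by (auto simp: s_def abs_square_le_1)
  have e: "(x\<^sup>2 * (1 - x)\<^sup>2 * (2 * x - 1))\<^sup>2 = s * (1 - s) ^ 4 / 256"
    unfolding s_def by algebra
  \<comment> \<open>The maximum of s * (1 - s)^4 is attained at s = 1/5, so the difference has 1/5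
    as a double root.\<close>
  have "256 / 3125 - s * (1 - s) ^ 4 = (s - 1/5)\<^sup>2 * (256/125 - 113/25 * s + 18/5 * s\<^sup>2 - s ^ 3)"
    by algebra
  moreover have "256/125 - 113/25 * s + 18/5 * s\<^sup>2 - s ^ 3 \<ge> 0"
  proof -
    have "256/125 - 113/25 * s + 18/5 * s\<^sup>2 - s ^ 3 = 16/125 + (1 - s) * ((s - 13/10)\<^sup>2 + 23/100)"
      by algebra
    then show ?thesis using s by simp
  qed
  ultimately have "s * (1 - s) ^ 4 \<le> 256 / 3125"
    by (smt (verit) mult_nonneg_nonneg zero_le_power2)
  then show ?thesis unfolding e by simp
qed

text \<open>The argument of Gelfond and Nair: the integral of \<open>P\<close> over [0, 1] is
  positive and at most 5^(-5k), but its product with the least common multiple is an integer and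
  hence at least 1.\<close>

lemma lcm_upto_ge: "(5::real) ^ (5 * k) \<le> lcm_upto (10 * k + 1)"
proof -
  \<comment> \<open>The coefficients of x^2 * (1 - x)^2 * (2x - 1), lowest first. The even exponent
    makes the integrand nonnegative.\<close>
  define P :: "real poly" where "P = [:0, 0, -1, 4, -5, 2:] ^ (2 * k)"
  have ic: "int_coeffs P"
    unfolding P_def
    by (rule int_coeffs_power) (auto simp: int_coeffs_def coeff_pCons split: nat.splits)
  have deg: "degree P \<le> 10 * k"
    unfolding P_def using degree_power_le[of "[:0, 0, -1, 4, -5, 2:] :: real poly" "2 * k"] by simp
  define I where "I = (\<Sum>i\<le>10 * k. coeff P i / real (i + 1))"
  have int: "((\<lambda>x. poly P x) has_integral I) {0..1}"
    unfolding I_def by (rule has_integral_poly_01[OF deg])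
  have ev: "poly P x = ((x\<^sup>2 * (1 - x)\<^sup>2 * (2 * x - 1))\<^sup>2) ^ k" for x
    unfolding P_def power_mult poly_power
    by (rule arg_cong[where f = "\<lambda>t. t ^ k"]) (simp, algebra)
  have nonneg: "poly P x \<ge> 0" for x unfolding ev by simp
  have "I \<noteq> 0"
  proof
    assume "I = 0"
    \<comment> \<open>The only possible roots of \<open>P\<close> are 0, 1/2 and 1, so 1/3 witnesses
      that \<open>P\<close> does not vanish on the interval.\<close>
    have "poly P (1/3) = 0"
      by (rule has_integral_0_cbox_imp_0[of 0 1 "poly P"])
         (use int \<open>I = 0\<close> nonneg in \<open>auto intro!: continuous_intros\<close>)
    then show False unfolding ev by (simp add: power2_eq_square)
  qed
  moreover have "I \<ge> 0"
    using has_integral_nonneg[OF int] nonneg by auto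
  ultimately have Ipos: "I > 0" by simp
  have "((\<lambda>x. (1 / 5 ^ 5) ^ k :: real) has_integral (1 / 5 ^ 5) ^ k) {0..1::real}"
    using has_integral_const_real[of "(1 / 5 ^ 5) ^ k :: real" 0 1] by simp
  from has_integral_le[OF int this] have Iup: "I \<le> (1 / 5 ^ 5) ^ k"
    using power_mono[OF nair_poly_bound, of _ k] unfolding ev by simp
  have "real (lcm_upto (10 * k + 1)) * I = (\<Sum>i\<le>10 * k. coeff P i * real (lcm_upto (10 * k + 1) div (i + 1)))"
    unfolding I_def sum_distrib_left
    by (rule sum.cong) (auto simp: real_of_nat_div dvd_lcm_upto simp del: of_nat_Suc)
  also have "\<dots> \<in> \<int>"
    using ic by (intro Ints_sum Ints_mult) (auto simp: int_coeffs_def)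
  finally have "real (lcm_upto (10 * k + 1)) * I \<in> \<int>" .
  moreover have "real (lcm_upto (10 * k + 1)) * I > 0"
    using Ipos lcm_upto_pos by simp
  ultimately have "1 \<le> real (lcm_upto (10 * k + 1)) * I"
    using Ints_nonzero_abs_ge1[of "real (lcm_upto (10 * k + 1)) * I"] by linarith
  also have "real (lcm_upto (10 * k + 1)) * I \<le> real (lcm_upto (10 * k + 1)) * (1 / 5 ^ 5) ^ k"
    using Iup by (intro mult_left_mono) auto
  finally show ?thesis
    by (simp only: power_mult power_one_over) (simp add: field_simps)
qed

lemma ln5_ge: "ln (5::real) \<ge> 1.6"
proof -
  have "exp 1 ^ 8 \<le> (2.72::real) ^ 8"
    using e_less_272 by (intro power_mono) auto
  also have "\<dots> \<le> 5 ^ 5" by (simp add: power_def numeral_eq_Suc)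
  finally have "exp (8::real) \<le> 5 ^ 5"
    by (simp flip: exp_of_nat_mult)
  then have "ln (exp (8::real)) \<le> ln (5 ^ 5)"
    by (intro ln_mono) auto
  then show ?thesis using ln_realpow[of 5 5] by simp
qed

text \<open>Apply the lcm bound to 10 * k + 1 with k the integer part of (x - 1) / 10. Then 10 * k >
  x - 11 explains the 11, and ln 5 / 2 \<ge> 0.8 the constant.\<close>

lemma prime_pi_lower:
  assumes "x > 1"
  shows "prime_pi x \<ge> 0.8 * (x - 11) / ln x"
proof -
  define k where "k = nat \<lfloor>(x - 1) / 10\<rfloor>"
  have k: "real k \<le> (x - 1) / 10" "real k > (x - 1) / 10 - 1"
    unfolding k_def using assms of_nat_floor[of "(x - 1) / 10"] real_of_int_floor_gt_diff_one[of "(x - 1) / 10"]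
    by (simp_all add: le_nat_floor)
  let ?D = "10 * k + 1"
  have lnx: "ln x > 0" using assms by simp
  have "(5::real) ^ (5 * k) \<le> real (?D ^ prime_pi ?D)"
    using lcm_upto_ge[of k] lcm_upto_le[of ?D] by (meson le_add2 of_nat_mono order_trans)
  then have "ln ((5::real) ^ (5 * k)) \<le> ln (real ?D ^ prime_pi ?D)"
    by (intro ln_mono) auto
  then have "5 * k * ln 5 \<le> prime_pi ?D * ln ?D"
    by (subst (asm) ln_realpow, simp, subst (asm) ln_realpow) auto
  also have "\<dots> \<le> prime_pi x * ln x"
    using k by (intro mult_mono ln_mono) (auto intro!: prime_pi_mono)
  finally have "5 * k * ln 5 \<le> prime_pi x * ln x" .
  moreover have "real k * 1.6 \<le> real k * ln 5"
    using ln5_ge by (intro mult_left_mono) auto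
  ultimately have "8 * real k \<le> prime_pi x * ln x" by simp
  then have "0.8 * (x - 11) \<le> prime_pi x * ln x"
    using k by (simp add: field_simps)
  then show ?thesis using lnx by (simp add: field_simps)
qed

section \<open>The size of the n-th prime and a weak Bertrand postulate\<close>

text \<open>The count starts at 0, so exactly j primes lie below \<open>nth_prime j\<close>.\<close>

definition nth_prime :: "nat \<Rightarrow> nat" where "nth_prime = enumerate {p. prime p}"

lemma prime_nth_prime: "prime (nth_prime j)"
  using enumerate_in_set[OF primes_infinite] by (simp add: nth_prime_def)

lemma strict_mono_nth_prime: "strict_mono nth_prime"
  unfolding nth_prime_def by (rule strict_mono_enumerate[OF primes_infinite])

lemma nth_prime_le:
  fixes x :: real
  assumes "j < prime_pi x"
  shows "nth_prime j \<le> x"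
proof (rule ccontr)
  assume "\<not> nth_prime j \<le> x"
  have "primes_le x \<subseteq> nth_prime ` {..<j}"
  proof
    fix p assume p: "p \<in> primes_le x"
    then obtain i where i: "p = nth_prime i"
      using range_enumerate[OF primes_infinite] by (auto simp: primes_le_def nth_prime_def)
    have "nth_prime i < nth_prime j" using p i \<open>\<not> nth_prime j \<le> x\<close> by (auto simp: primes_le_def)
    then show "p \<in> nth_prime ` {..<j}"
      using strict_mono_nth_prime i by (simp add: strict_mono_less)
  qed
  then have "prime_pi x \<le> card (nth_prime ` {..<j})"
    unfolding prime_pi_def by (intro card_mono) auto
  also have "\<dots> \<le> j" using card_image_le[of "{..<j}" nth_prime] by simp
  finally show False using assms by simp
qed

text \<open>\<open>prime_pi_lower\<close> is inverted; for large j any constant above 1 / 0.8 = 1.25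
  works.\<close>

lemma nth_prime_bound: "\<forall>\<^sub>F j in sequentially. nth_prime j \<le> 1.26 * j * ln j"
proof -
  have "\<forall>\<^sub>F j::nat in sequentially. real j < 0.8 * (1.26 * j * ln j - 11) / ln (1.26 * j * ln j)"
    by real_asymp
  moreover have "\<forall>\<^sub>F j::nat in sequentially. 1.26 * j * ln j > 1"
    by real_asymp
  ultimately show ?thesis
  proof eventually_elim
    case (elim j)
    show ?case
      by (rule nth_prime_le) (use elim prime_pi_lower[of "1.26 * j * ln j"] in linarith)
  qed
qed

text \<open>The ratio 3 suffices because 2.2 < 3 * 0.8. It reappears as the ratio of the ends of the
  range [1.19, 3.57] for q / sqrt m.\<close>

lemma prime_in_interval: "\<forall>\<^sub>F x::real in at_top. \<exists>q. prime q \<and> x < real q \<and> real q \<le> 3 * x"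
proof -
  have "\<forall>\<^sub>F x::real in at_top. 2.2 * x / ln x < 0.8 * (3 * x - 11) / ln (3 * x)"
    by real_asymp
  moreover have "\<forall>\<^sub>F x::real in at_top. x > 1" by (rule eventually_gt_at_top)
  ultimately show ?thesis using prime_pi_upper_sharp
  proof eventually_elim
    case (elim x)
    have "prime_pi x < prime_pi (3 * x)"
      using prime_pi_lower[of "3 * x"] elim by linarith
    then have "\<not> primes_le (3 * x) \<subseteq> primes_le x"
      unfolding prime_pi_def by (meson card_mono finite_primes_le not_le)
    then show ?case by (auto simp: primes_le_def)
  qed
qed

section \<open>Sums over primes in the manner of Mertens\<close>

text \<open>Double counting of the pairs (p, m) with p dividing m \<le> n: the primes dividing m
  have product at most m, so each m contributes at most ln n. The factor 2 comes from n / p \<le> 2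
  * (n div p).\<close>

lemma sum_ln_prime_div_le:
  assumes "n \<ge> 1"
  shows "(\<Sum>p | prime p \<and> p \<le> n. ln (real p) / real p) \<le> 2 * ln (real n)"
proof -
  let ?P = "{p. prime p \<and> p \<le> n}"
  have "(\<Sum>p\<in>?P. real (n div p) * ln p) = (\<Sum>p\<in>?P. \<Sum>m | m \<in> {1..n} \<and> p dvd m. ln (real p))"
  proof (rule sum.cong)
    fix p assume p: "p \<in> ?P"
    have "{m. m \<in> {1..n} \<and> p dvd m} = (\<lambda>k. p * k) ` {1..n div p}"
      using p by (auto simp: prime_gt_0_nat dvd_def less_eq_div_iff_mult_less_eq mult.commute Suc_le_eq)
    then have "card {m. m \<in> {1..n} \<and> p dvd m} = n div p"
      using p by (simp add: card_image inj_on_def prime_gt_0_nat)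
    then show "real (n div p) * ln p = (\<Sum>m | m \<in> {1..n} \<and> p dvd m. ln (real p))"
      by simp
  qed auto
  also have "\<dots> = (\<Sum>m\<in>{1..n}. \<Sum>p | p \<in> ?P \<and> p dvd m. ln (real p))"
    by (rule sum.swap_restrict) auto
  also have "\<dots> \<le> (\<Sum>m\<in>{1..n}. ln (real n))"
  proof (rule sum_mono)
    fix m assume m: "m \<in> {1..n}"
    have "(\<Sum>p | p \<in> ?P \<and> p dvd m. ln (real p)) = ln (real (\<Prod>{p. p \<in> ?P \<and> p dvd m}))"
      by (subst of_nat_prod, subst ln_prod) (auto simp: prime_gt_0_nat)
    also have "\<dots> \<le> ln (real n)"
    proof (rule ln_mono)
      have "\<Prod>{p. p \<in> ?P \<and> p dvd m} dvd m"
        by (rule prod_primes_dvd) auto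
      then have "\<Prod>{p. p \<in> ?P \<and> p dvd m} \<le> m"
        using m by (intro dvd_imp_le) auto
      then show "real (\<Prod>{p. p \<in> ?P \<and> p dvd m}) \<le> real n"
        using m by (simp only: of_nat_le_iff) auto
      show "0 < real (\<Prod>{p. p \<in> ?P \<and> p dvd m})"
        by (auto simp only: of_nat_0_less_iff intro!: prod_pos simp: prime_gt_0_nat)
    qed
    finally show "(\<Sum>p | p \<in> ?P \<and> p dvd m. ln (real p)) \<le> ln (real n)" .
  qed
  finally have *: "(\<Sum>p\<in>?P. real (n div p) * ln p) \<le> n * ln n" by simp
  have "real n * (\<Sum>p\<in>?P. ln (real p) / real p) \<le> (\<Sum>p\<in>?P. 2 * (real (n div p) * ln p))"
    unfolding sum_distrib_left
  proof (rule sum_mono)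
    fix p assume p: "p \<in> ?P"
    then have p0: "p > 0" "n div p \<ge> 1" by (auto simp: prime_gt_0_nat div_greater_zero_iff Suc_le_eq)
    have "n < p * (n div p + 1)" using p0(1) by (metis add.commute dividend_less_times_div mult_Suc_right plus_1_eq_Suc)
    also have "\<dots> \<le> p * (2 * (n div p))" using p0 by (intro mult_left_mono) auto
    finally have "real n \<le> real (p * (2 * (n div p)))"
      by (simp only: of_nat_le_iff less_imp_le)
    then have "real n / real p \<le> 2 * real (n div p)" using p0 by (simp add: field_simps)
    from mult_right_mono[OF this, of "ln (real p)"] p0
    show "real n * (ln (real p) / real p) \<le> 2 * (real (n div p) * ln p)" by simp
  qed
  also have "\<dots> \<le> 2 * (n * ln n)" using * by (simp flip: sum_distrib_left)
  finally show ?thesis using assms by (simp add: mult_ac)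
qed

text \<open>Here ln p > ln n / 7, so 1 / p is at most 7 / ln n times ln p / p, and 14 = 7 *
  2.\<close>

lemma sum_inverse_primes_le:
  assumes "n \<ge> 2"
  shows "(\<Sum>p | prime p \<and> real n powr (1/7) < real p \<and> p \<le> n. 1 / real p) \<le> 14"
proof -
  let ?P = "{p. prime p \<and> real n powr (1/7) < real p \<and> p \<le> n}"
  have ln: "ln (real n) > 0" using assms by simp
  have "(\<Sum>p\<in>?P. 1 / real p) * (ln n / 7) = (\<Sum>p\<in>?P. ln (real n powr (1/7)) / real p)"
    using assms by (simp add: sum_distrib_right ln_powr)
  also have "\<dots> \<le> (\<Sum>p\<in>?P. ln (real p) / real p)"
    using assms by (intro sum_mono divide_right_mono ln_mono) auto
  also have "\<dots> \<le> (\<Sum>p | prime p \<and> p \<le> n. ln (real p) / real p)"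
    by (rule sum_mono2) (auto intro!: divide_nonneg_nonneg ln_ge_zero simp: prime_gt_0_nat Suc_leI)
  also have "\<dots> \<le> 2 * ln n" using sum_ln_prime_div_le[of n] assms by simp
  finally show ?thesis using ln by (simp add: field_simps)
qed

section \<open>Counting bipartite graphs without four-cycles\<close>

definition c4_free :: "('a \<times> 'b) set \<Rightarrow> bool" where
  "c4_free G \<longleftrightarrow> (\<forall>x x' y y'. (x, y) \<in> G \<and> (x, y') \<in> G \<and> (x', y) \<in> G \<and> (x', y') \<in> G \<longrightarrow> x = x' \<or> y = y')"

lemma c4_freeD: "c4_free G \<Longrightarrow> (x, y) \<in> G \<Longrightarrow> (x, y') \<in> G \<Longrightarrow> (x', y) \<in> G \<Longrightarrow> (x', y') \<in> G \<Longrightarrow> x = x' \<or> y = y'"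
  unfolding c4_free_def by blast

lemma c4_free_subset: "c4_free G \<Longrightarrow> F \<subseteq> G \<Longrightarrow> c4_free F"
  unfolding c4_free_def by (meson subsetD)

lemma c4_free_converse: "c4_free (G\<inverse>) \<longleftrightarrow> c4_free G"
  unfolding c4_free_def by blast

definition c4_graphs :: "'a set \<Rightarrow> 'b set \<Rightarrow> ('a \<times> 'b) set set" where
  "c4_graphs A B = {G. G \<subseteq> A \<times> B \<and> c4_free G}"

lemma finite_c4_graphs: "finite A \<Longrightarrow> finite B \<Longrightarrow> finite (c4_graphs A B)"
  unfolding c4_graphs_def by (rule finite_subset[of _ "Pow (A \<times> B)"]) auto

section \<open>Kleitman-Winston counting of independent sets\<close>

text \<open>Give I the weight x^|I|: every counted set weighs at least x^m, and all subsets together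
  weigh (1 + x)^|S| \<le> exp (x * R). The free x is tuned to the expected size in each
  application.\<close>

lemma card_small_subsets_le:
  fixes x m :: real
  assumes S: "finite S" and R: "real (card S) \<le> R" and x: "0 < x" "x \<le> 1"
  shows "real (card {I. I \<subseteq> S \<and> real (card I) \<le> m}) \<le> x powr (- m) * exp (x * R)"
proof -
  have sum: "(\<Sum>I\<in>Pow S. x ^ card I) = (1 + x) ^ card S"
    using S
  proof (induction S rule: finite_induct)
    case (insert v S)
    have "(\<Sum>I\<in>Pow (insert v S). x ^ card I) = (\<Sum>I\<in>Pow S. x ^ card I) + (\<Sum>I\<in>insert v ` Pow S. x ^ card I)"
      unfolding Pow_insert using insert by (intro sum.union_disjoint) auto
    also have "(\<Sum>I\<in>insert v ` Pow S. x ^ card I) = (\<Sum>I\<in>Pow S. x ^ card (insert v I))"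
      using insert by (subst sum.reindex) (auto simp: inj_on_def insert_ident)
    also have "\<dots> = (\<Sum>I\<in>Pow S. x * x ^ card I)"
    proof (rule sum.cong)
      fix I assume "I \<in> Pow S"
      then have "finite I" "v \<notin> I" using insert finite_subset by auto
      then show "x ^ card (insert v I) = x * x ^ card I" by simp
    qed simp
    finally show ?case using insert by (simp add: algebra_simps flip: sum_distrib_left)
  qed simp
  let ?F = "{I. I \<subseteq> S \<and> real (card I) \<le> m}"
  have "real (card ?F) * x powr m = (\<Sum>I\<in>?F. x powr m)" by simp
  also have "\<dots> \<le> (\<Sum>I\<in>?F. x ^ card I)"
    by (rule sum_mono) (use x in \<open>auto simp: powr_mono' simp flip: powr_realpow\<close>)
  also have "\<dots> \<le> (\<Sum>I\<in>Pow S. x ^ card I)"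
    using S x by (intro sum_mono2) auto
  also have "\<dots> \<le> exp x ^ card S"
    unfolding sum using x by (intro power_mono exp_ge_add_one_self) auto
  also have "\<dots> \<le> exp (x * R)"
    using R x by (simp flip: exp_of_nat_mult add: mult.commute)
  finally show ?thesis
    using x by (simp add: powr_minus field_simps)
qed

definition indep :: "('b \<Rightarrow> 'b \<Rightarrow> bool) \<Rightarrow> 'b set \<Rightarrow> bool" where
  "indep H I \<longleftrightarrow> (\<forall>y\<in>I. \<forall>y'\<in>I. y \<noteq> y' \<longrightarrow> \<not> H y y')"

text \<open>The Kleitman-Winston recursion. As long as S is larger than R, some v in S conflicts
  with a fraction \<beta> of S. Sets avoiding v live in S without v; for sets containing v all
  conflicts of v drop out as well, which can happen only k times before the size falls to R, where
  \<open>small\<close> takes over.\<close>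

lemma card_indep_le:
  fixes \<beta> R K m :: real
  assumes V: "finite V" and \<beta>: "0 \<le> \<beta>" "\<beta> \<le> 1"
    and dense: "\<And>S. S \<subseteq> V \<Longrightarrow> real (card S) > R \<Longrightarrow>
       \<exists>v\<in>S. real (card {y \<in> S. y \<noteq> v \<and> H v y}) \<ge> \<beta> * card S"
    and small: "\<And>S. S \<subseteq> V \<Longrightarrow> real (card S) \<le> R \<Longrightarrow> real (card {I. I \<subseteq> S \<and> real (card I) \<le> m}) \<le> K"
    and K: "0 \<le> K" and S: "S \<subseteq> V" "(1 - \<beta>) ^ k * card S \<le> R"
  shows "real (card {I. I \<subseteq> S \<and> indep H I \<and> real (card I) \<le> m}) \<le> (real (card S) + 1) ^ k * K"
  using S
proof (induction "card S" arbitrary: S k rule: less_induct)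
  case less
  have fS: "finite S" using less.prems V finite_subset by blast
  show ?case
  proof (cases "real (card S) \<le> R")
    case True
    have "real (card {I. I \<subseteq> S \<and> indep H I \<and> real (card I) \<le> m}) \<le> real (card {I. I \<subseteq> S \<and> real (card I) \<le> m})"
      using fS by (intro of_nat_mono card_mono) auto
    also have "\<dots> \<le> K" using small less.prems True by blast
    also have "\<dots> \<le> (real (card S) + 1) ^ k * K"
      using K by (simp add: mult_le_cancel_right1)
    finally show ?thesis .
  next
    case False
    then obtain v where v: "v \<in> S" "real (card {y \<in> S. y \<noteq> v \<and> H v y}) \<ge> \<beta> * card S"
      using dense[of S] less.prems(1) by auto
    \<comment> \<open>For k = 0 the hypothesis would say |S| \<le> R.\<close>
    from False less.prems(2) obtain l where k: "k = Suc l" by (cases k) auto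
    define S1 where "S1 = S - {v}"
    define S2 where "S2 = S - {v} - {y \<in> S. y \<noteq> v \<and> H v y}"
    define F where "F = (\<lambda>S. {I. I \<subseteq> S \<and> indep H I \<and> real (card I) \<le> m})"
    have fF: "finite (F T)" if "T \<subseteq> S" for T
      unfolding F_def by (rule finite_subset[of _ "Pow T"]) (use that fS in \<open>auto intro: finite_subset\<close>)
    have c1': "card S = card S1 + 1"
      unfolding S1_def Suc_eq_plus1[symmetric] by (rule card.remove[OF fS v(1)])
    then have c1: "card S1 < card S" by simp
    have "S2 \<subseteq> S1" unfolding S1_def S2_def by auto
    then have c21: "card S2 \<le> card S1" using fS by (intro card_mono) (auto simp: S1_def)
    have "card S2 \<le> card (S - {y \<in> S. y \<noteq> v \<and> H v y})"
      unfolding S2_def using fS by (intro card_mono) auto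
    also have "\<dots> = card S - card {y \<in> S. y \<noteq> v \<and> H v y}"
      using fS by (intro card_Diff_subset) auto
    finally have c2: "real (card S2) \<le> (1 - \<beta>) * card S"
      using v(2) card_mono[OF fS, of "{y \<in> S. y \<noteq> v \<and> H v y}"] by (simp add: algebra_simps)
    have "F S \<subseteq> F S1 \<union> insert v ` F S2"
    proof
      fix I assume I: "I \<in> F S"
      show "I \<in> F S1 \<union> insert v ` F S2"
      proof (cases "v \<in> I")
        case True
        have "finite I" using I fS finite_subset by (auto simp: F_def)
        then have "card (I - {v}) \<le> card I" by (simp add: card_Diff1_le)
        moreover have "I - {v} \<subseteq> S2" using I True by (auto simp: F_def S2_def indep_def)
        ultimately have "I - {v} \<in> F S2" using I by (auto simp: F_def indep_def)
        then show ?thesis using True by (auto intro!: image_eqI[of _ _ "I - {v}"])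
      next
        case False
        then show ?thesis using I by (auto simp: F_def S1_def)
      qed
    qed
    moreover have "finite (F S1)" "finite (F S2)"
      using fF[of S1] fF[of S2] by (auto simp: S1_def S2_def)
    ultimately have "card (F S) \<le> card (F S1) + card (insert v ` F S2)"
      by (meson card_mono card_Un_le finite_UnI finite_imageI order_trans)
    then have "card (F S) \<le> card (F S1) + card (F S2)"
      using card_image_le[OF \<open>finite (F S2)\<close>, of "insert v"] by linarith
    moreover have "real (card (F S1)) \<le> (real (card S1) + 1) ^ k * K"
      unfolding F_def
    proof (rule less.hyps[OF c1])
      show "S1 \<subseteq> V" using less.prems by (auto simp: S1_def)
      have "(1 - \<beta>) ^ k * real (card S1) \<le> (1 - \<beta>) ^ k * real (card S)"
        using c1 \<beta> by (intro mult_left_mono) auto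
      then show "(1 - \<beta>) ^ k * real (card S1) \<le> R" using less.prems by linarith
    qed
    moreover have "real (card (F S2)) \<le> (real (card S2) + 1) ^ l * K"
      unfolding F_def
    proof (rule less.hyps)
      show "card S2 < card S" using c1 c21 by simp
      show "S2 \<subseteq> V" using less.prems by (auto simp: S2_def)
      have "(1 - \<beta>) ^ l * real (card S2) \<le> (1 - \<beta>) ^ l * ((1 - \<beta>) * real (card S))"
        using c2 \<beta> by (intro mult_left_mono) auto
      then show "(1 - \<beta>) ^ l * real (card S2) \<le> R" using less.prems by (simp add: k mult_ac)
    qed
    moreover have "(real (card S2) + 1) ^ l * K \<le> real (card S) ^ l * K"
      using c1' c21 K by (intro mult_right_mono power_mono) auto
    moreover have "(real (card S1) + 1) ^ k * K = real (card S) ^ k * K"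
      using c1' by (simp add: add.commute)
    ultimately have "real (card (F S)) \<le> (real (card S) ^ k + real (card S) ^ l) * K"
      by (simp add: ring_distribs)
    also have "real (card S) ^ k + real (card S) ^ l = (real (card S) + 1) * real (card S) ^ l"
      by (simp add: k algebra_simps)
    also have "\<dots> \<le> (real (card S) + 1) * (real (card S) + 1) ^ l"
      by (intro mult_left_mono power_mono) auto
    finally show ?thesis
      using K unfolding F_def k by (simp add: mult_right_mono)
  qed
qed

text \<open>Two vertices of S have at most one common neighbour, so the codegrees add up to the sum
  of d^2 - d over P. By Cauchy-Schwarz this is at least E^2 / a - E, where E \<ge> \<delta> * |S| >
  2 * a is the number of edges at S, so that the quadratic term dominates.\<close>

lemma c4_free_codegree:
  fixes \<delta> a :: real
  assumes G: "c4_free G" "G \<subseteq> P \<times> Q" and fin: "finite P" "finite Q" and a: "real (card P) \<le> a" "0 < a"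
    and \<delta>: "0 < \<delta>" "\<And>y. y \<in> Q \<Longrightarrow> real (card {x. (x, y) \<in> G}) \<ge> \<delta>"
    and S: "S \<subseteq> Q" "real (card S) > 2 * a / \<delta>"
  shows "\<exists>v\<in>S. real (card {y \<in> S. y \<noteq> v \<and> (\<exists>x. (x, v) \<in> G \<and> (x, y) \<in> G)}) \<ge> \<delta>\<^sup>2 / (2 * a) * card S"
proof (rule ccontr)
  assume neg: "\<not> ?thesis"
  define c where "c = (\<lambda>v. card {y \<in> S. y \<noteq> v \<and> (\<exists>x. (x, v) \<in> G \<and> (x, y) \<in> G)})"
  define d where "d = (\<lambda>x. card {y \<in> S. (x, y) \<in> G})"
  have fS: "finite S" using S fin finite_subset by blast
  have cS: "real (card S) > 0" using S(2) a \<delta> by (smt (verit) divide_pos_pos)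
  then have Sne: "S \<noteq> {}" by auto
  have "(\<Sum>v\<in>S. real (c v)) < (\<Sum>v\<in>S. \<delta>\<^sup>2 / (2 * a) * card S)"
    using neg fS Sne by (intro sum_strict_mono) (auto simp: c_def not_le)
  then have up: "(\<Sum>v\<in>S. real (c v)) < \<delta>\<^sup>2 / (2 * a) * card S * card S" by (simp add: mult_ac)
  have cv: "real (c v) = (\<Sum>x | x \<in> P \<and> (x, v) \<in> G. real (d x) - 1)" if v: "v \<in> S" for v
  proof -
    have "{y \<in> S. y \<noteq> v \<and> (\<exists>x. (x, v) \<in> G \<and> (x, y) \<in> G)} = (\<Union>x\<in>{x \<in> P. (x, v) \<in> G}. {y \<in> S. y \<noteq> v \<and> (x, y) \<in> G})"
      using G by auto
    then have "c v = (\<Sum>x | x \<in> P \<and> (x, v) \<in> G. card {y \<in> S. y \<noteq> v \<and> (x, y) \<in> G})"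
      unfolding c_def using fS fin G(1)
      by (simp only:, intro card_UN_disjoint) (auto dest: c4_freeD)
    moreover have "real (card {y \<in> S. y \<noteq> v \<and> (x, y) \<in> G}) = real (d x) - 1" if "(x, v) \<in> G" for x
    proof -
      have "{y \<in> S. (x, y) \<in> G} = insert v {y \<in> S. y \<noteq> v \<and> (x, y) \<in> G}" using v that by auto
      then show ?thesis unfolding d_def using fS by simp
    qed
    ultimately show ?thesis by simp
  qed
  have "(\<Sum>v\<in>S. real (c v)) = (\<Sum>v\<in>S. \<Sum>x | x \<in> P \<and> (x, v) \<in> G. real (d x) - 1)"
    using cv by simp
  also have "\<dots> = (\<Sum>x\<in>P. \<Sum>v | v \<in> S \<and> (x, v) \<in> G. real (d x) - 1)"
    by (rule sum.swap_restrict[OF fS fin(1)])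
  also have "\<dots> = (\<Sum>x\<in>P. (real (d x))\<^sup>2) - (\<Sum>x\<in>P. real (d x))"
    by (simp add: d_def power2_eq_square algebra_simps sum_subtractf)
  finally have low: "(\<Sum>v\<in>S. real (c v)) = (\<Sum>x\<in>P. (real (d x))\<^sup>2) - (\<Sum>x\<in>P. real (d x))" .
  define E where "E = (\<Sum>x\<in>P. real (d x))"
  have "E = (\<Sum>x\<in>P. \<Sum>v | v \<in> S \<and> (x, v) \<in> G. 1)" unfolding E_def d_def by simp
  also have "\<dots> = (\<Sum>v\<in>S. \<Sum>x | x \<in> P \<and> (x, v) \<in> G. 1)"
    by (rule sum.swap_restrict[OF fS fin(1), symmetric])
  also have "\<dots> = (\<Sum>v\<in>S. real (card {x. (x, v) \<in> G}))"
  proof (rule sum.cong)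
    fix v
    have "{x. x \<in> P \<and> (x, v) \<in> G} = {x. (x, v) \<in> G}" using G by auto
    then show "(\<Sum>x | x \<in> P \<and> (x, v) \<in> G. 1) = real (card {x. (x, v) \<in> G})" by simp
  qed simp
  also have "\<dots> \<ge> (\<Sum>v\<in>S. \<delta>)" using \<delta> S by (intro sum_mono) auto
  finally have E1: "E \<ge> card S * \<delta>" by simp
  have E2: "E > 2 * a" using E1 S(2) \<delta> by (simp add: field_simps)
  have "E\<^sup>2 \<le> (\<Sum>x\<in>P. (real (d x))\<^sup>2) * card P"
    unfolding E_def using sum_squared_le_sum_of_squares[of "\<lambda>x. real (d x)" P] by simp
  also have "\<dots> \<le> (\<Sum>x\<in>P. (real (d x))\<^sup>2) * a"
    using a by (intro mult_left_mono sum_nonneg) auto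
  finally have "(\<Sum>x\<in>P. (real (d x))\<^sup>2) \<ge> E\<^sup>2 / a" using a by (simp add: field_simps)
  then have "(\<Sum>v\<in>S. real (c v)) \<ge> E\<^sup>2 / a - E" using low E_def by simp
  moreover have "E\<^sup>2 / a - E \<ge> E\<^sup>2 / (2 * a)"
  proof -
    have "E * (2 * a) \<le> E * E" using E2 a by (intro mult_left_mono) auto
    then have "E \<le> E\<^sup>2 / (2 * a)" using a by (simp add: field_simps power2_eq_square)
    then show ?thesis by (simp add: field_simps)
  qed
  moreover have "E\<^sup>2 / (2 * a) \<ge> (card S * \<delta>)\<^sup>2 / (2 * a)"
    using E1 a \<delta> by (intro divide_right_mono power_mono) auto
  moreover have "(card S * \<delta>)\<^sup>2 / (2 * a) = \<delta>\<^sup>2 / (2 * a) * card S * card S"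
    by (simp add: power2_eq_square)
  ultimately show False using up by linarith
qed

text \<open>About L / \<beta> rounds shrink Q to size R = 2 * a / \<delta>, because (1 - \<beta>)^k
  \<le> exp (-L) \<le> 1 / (b + 1). The first exponential is the cost of the rounds, at most b + 1
  choices in each; the rest counts subsets of the remaining small set.\<close>

lemma card_c4_extensions_le:
  fixes a b \<delta> x m \<beta> L :: real
  assumes G: "c4_free G" "G \<subseteq> P \<times> Q" and fin: "finite P" "finite Q"
    and a: "real (card P) \<le> a" "0 < a" and b: "real (card Q) \<le> b" "1 \<le> b"
    and \<delta>: "0 < \<delta>" "\<delta> \<le> 2 * a" "\<And>y. y \<in> Q \<Longrightarrow> real (card {x. (x, y) \<in> G}) \<ge> \<delta>"
    and x: "0 < x" "x \<le> 1"
    and \<beta>: "\<beta> = \<delta>\<^sup>2 / (2 * a)" "\<beta> \<le> 1" and L: "ln (b + 1) \<le> L"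
  shows "real (card {I. I \<subseteq> Q \<and> indep (\<lambda>y y'. \<exists>x. (x, y) \<in> G \<and> (x, y') \<in> G) I \<and> real (card I) \<le> m})
    \<le> exp (L * (L / \<beta> + 1)) * (x powr (- m) * exp (x * (2 * a / \<delta>)))"
proof -
  let ?H = "\<lambda>y y'. \<exists>x. (x, y) \<in> G \<and> (x, y') \<in> G"
  define k where "k = nat \<lceil>L / \<beta>\<rceil>"
  have \<beta>0: "\<beta> > 0" using \<beta> \<delta> a by simp
  have L0: "L > 0" using L b ln_gt_zero[of "b + 1"] by linarith
  have bL: "b + 1 \<le> exp L" using L b by (metis add_nonneg_pos exp_le_cancel_iff exp_ln less_numeral_extra(1) order_trans zero_le_one)
  have k1: "real k \<ge> L / \<beta>" "real k \<le> L / \<beta> + 1"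
    unfolding k_def using L0 \<beta>0 divide_pos_pos[OF L0 \<beta>0] by (simp_all add: real_nat_ceiling_ge)
  have "(1 - \<beta>) ^ k * card Q \<le> exp (- \<beta>) ^ k * b"
    using \<beta> b exp_ge_add_one_self[of "- \<beta>"] by (intro mult_mono power_mono) auto
  also have "\<dots> = exp (- (k * \<beta>)) * b" by (simp flip: exp_of_nat_mult)
  also have "\<dots> \<le> exp (- L) * b"
    using k1(1) \<beta>0 b by (intro mult_right_mono) (auto simp: field_simps)
  also have "\<dots> \<le> 1" using bL by (simp add: exp_minus field_simps)
  also have "1 \<le> 2 * a / \<delta>" using \<delta> by simp
  finally have kR: "(1 - \<beta>) ^ k * card Q \<le> 2 * a / \<delta>" .
  have "real (card {I. I \<subseteq> Q \<and> indep ?H I \<and> real (card I) \<le> m})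
    \<le> (real (card Q) + 1) ^ k * (x powr (- m) * exp (x * (2 * a / \<delta>)))"
  proof (rule card_indep_le[OF fin(2)])
    show "0 \<le> \<beta>" "\<beta> \<le> 1" using \<beta> \<beta>0 by auto
    show "\<exists>v\<in>S. \<beta> * real (card S) \<le> real (card {y \<in> S. y \<noteq> v \<and> (\<exists>x. (x, v) \<in> G \<and> (x, y) \<in> G)})"
      if "S \<subseteq> Q" "2 * a / \<delta> < real (card S)" for S
      using c4_free_codegree[OF G fin a \<delta>(1) \<delta>(3) that] \<beta> by simp
    show "real (card {I. I \<subseteq> S \<and> real (card I) \<le> m}) \<le> x powr - m * exp (x * (2 * a / \<delta>))"
      if "S \<subseteq> Q" "real (card S) \<le> 2 * a / \<delta>" for S
      using that x finite_subset[OF that(1) fin(2)] by (intro card_small_subsets_le)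
    show "0 \<le> x powr - m * exp (x * (2 * a / \<delta>))" by simp
    show "(1 - \<beta>) ^ k * card Q \<le> 2 * a / \<delta>" by (rule kR)
  qed auto
  also have "(real (card Q) + 1) ^ k \<le> exp (L * (L / \<beta> + 1))"
  proof -
    have "(real (card Q) + 1) ^ k \<le> exp L ^ k"
      using bL b by (intro power_mono) auto
    also have "\<dots> = exp (L * k)" by (simp flip: exp_of_nat_mult add: mult.commute)
    also have "\<dots> \<le> exp (L * (L / \<beta> + 1))" using k1 L0 by simp
    finally show ?thesis .
  qed
  finally show ?thesis by (simp add: mult_right_mono)
qed

text \<open>Two neighbours of u with a common neighbour in G would close a four-cycle through u.
  This makes neighbourhoods accessible to \<open>card_indep_le\<close>.\<close>

lemma c4_free_insert_vertex:
  assumes "c4_free (G \<union> {u} \<times> I)" "\<And>y. (u, y) \<notin> G"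
  shows "indep (\<lambda>y y'. \<exists>x. (x, y) \<in> G \<and> (x, y') \<in> G) I"
  using assms unfolding indep_def c4_free_def by (metis SigmaI UnI1 UnI2 singletonI)


section \<open>Removing vertices of small relative degree\<close>

definition left_degree :: "('a \<times> 'b) set \<Rightarrow> 'a \<Rightarrow> nat" where "left_degree G x = card {y. (x, y) \<in> G}"

definition right_degree :: "('a \<times> 'b) set \<Rightarrow> 'b \<Rightarrow> nat" where "right_degree G y = card {x. (x, y) \<in> G}"

text \<open>A removed vertex has the smallest relative degree \<open>\<nu>\<close>, unless all relative degrees exceed 1. In that case a left
  vertex is removed: its neighbourhood is cheap to encode whatever its degree is, while for a right vertex this fails.\<close>

definition removable_left :: "real \<Rightarrow> real \<Rightarrow> ('a \<times> 'b) set \<Rightarrow> 'b set \<Rightarrow> 'a \<Rightarrow> bool" where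
  "removable_left \<alpha> \<gamma> G B x \<longleftrightarrow> (\<exists>\<nu>. 0 \<le> \<nu> \<and> \<nu> \<le> 1 \<and> (\<forall>y\<in>B. real (right_degree G y) \<ge> \<nu> * \<gamma>) \<and> (real (left_degree G x) \<le> \<nu> * \<alpha> \<or> \<nu> = 1))"

definition removable_right :: "real \<Rightarrow> real \<Rightarrow> ('a \<times> 'b) set \<Rightarrow> 'a set \<Rightarrow> 'b \<Rightarrow> bool" where
  "removable_right \<alpha> \<gamma> G A y \<longleftrightarrow> (\<exists>\<nu>. 0 \<le> \<nu> \<and> \<nu> \<le> 1 \<and> (\<forall>x\<in>A. real (left_degree G x) \<ge> \<nu> * \<alpha>) \<and> real (right_degree G y) \<le> \<nu> * \<gamma>)"

lemma exists_removable:
  assumes fin: "finite A" "finite B" and ne: "A \<noteq> {}" "B \<noteq> {}" and pos: "0 < \<alpha>" "0 < \<gamma>"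
  shows "(\<exists>x\<in>A. removable_left \<alpha> \<gamma> G B x) \<or> (\<exists>y\<in>B. removable_right \<alpha> \<gamma> G A y)"
proof -
  have "Min (left_degree G ` A) \<in> left_degree G ` A" using fin ne by (intro Min_in) auto
  then obtain x where x: "x \<in> A" "left_degree G x = Min (left_degree G ` A)" by auto
  have xm: "left_degree G x \<le> left_degree G x'" if "x' \<in> A" for x' using x that fin by simp
  have "Min (right_degree G ` B) \<in> right_degree G ` B" using fin ne by (intro Min_in) auto
  then obtain y where y: "y \<in> B" "right_degree G y = Min (right_degree G ` B)" by auto
  have ym: "right_degree G y \<le> right_degree G y'" if "y' \<in> B" for y' using y that fin by simp
  let ?s = "left_degree G x / \<alpha>" and ?t = "right_degree G y / \<gamma>"
  consider "?s \<le> ?t" "?s \<le> 1" | "?t \<le> ?s" "?t \<le> 1" | "?s > 1" "?t > 1" by linarith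
  then show ?thesis
  proof cases
    case 1
    have "?s * \<gamma> \<le> right_degree G y'" if "y' \<in> B" for y'
      using 1(1) pos ym[OF that] by (simp add: field_simps) (smt (verit) mult_left_mono of_nat_mono)
    then have "removable_left \<alpha> \<gamma> G B x"
      unfolding removable_left_def using 1 pos by (intro exI[of _ ?s]) auto
    then show ?thesis using x by blast
  next
    case 2
    have "?t * \<alpha> \<le> left_degree G x'" if "x' \<in> A" for x'
      using 2(1) pos xm[OF that] by (simp add: field_simps) (smt (verit) mult_left_mono of_nat_mono)
    then have "removable_right \<alpha> \<gamma> G A y"
      unfolding removable_right_def using 2 pos by (intro exI[of _ ?t]) auto
    then show ?thesis using y by blast
  next
    case 3
    have "\<gamma> \<le> right_degree G y'" if "y' \<in> B" for y'
      using 3(2) pos ym[OF that] by (simp add: field_simps)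
    then have "removable_left \<alpha> \<gamma> G B x"
      unfolding removable_left_def using 3 pos by (intro exI[of _ 1]) auto
    then show ?thesis using x by blast
  qed
qed

text \<open>Bounds the entropy term that arises when sets of relative size \<nu> are counted with
  the weight \<nu>^2.\<close>

lemma neg_mult_ln_le:
  fixes \<nu> :: real
  assumes "0 < \<nu>"
  shows "- (\<nu> * ln \<nu>) \<le> 1"
proof -
  have "ln (1 / \<nu>) \<le> 1 / \<nu> - 1" using assms by (intro ln_le_minus_one) auto
  then have "\<nu> * ln (1 / \<nu>) \<le> \<nu> * (1 / \<nu> - 1)" using assms by (intro mult_left_mono) auto
  then show ?thesis using assms by (simp add: ln_div algebra_simps)
qed

text \<open>\<open>\<alpha>\<close> and \<open>\<gamma>\<close> are the average degrees on the two sides of an extremal graph; degrees are measured relative to them.\<close>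

locale kw_params =
  fixes a b L \<alpha> \<gamma> :: real
  assumes ab: "1 \<le> a" "a \<le> b"
    and L_def: "L = ln (b + 1)" and L1: "1 \<le> L"
    and \<alpha>_def: "\<alpha> = sqrt b" and \<gamma>_def: "\<gamma> = a / sqrt b"
    and \<gamma>_ge: "8 * L ^ 4 + L \<le> \<gamma>"
begin

lemma kw_facts: "0 < \<alpha>" "0 < \<gamma>" "2 * L \<le> \<gamma>" "\<gamma> \<le> \<alpha>" "1 \<le> \<alpha>" "\<alpha> * \<alpha> = b" "\<gamma> * \<alpha> = a" "1 \<le> \<gamma>" "\<gamma> \<le> a" "\<alpha> \<le> b"
proof -
  show \<alpha>0: "0 < \<alpha>" "1 \<le> \<alpha>" "\<alpha> * \<alpha> = b" using ab by (auto simp: \<alpha>_def)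
  show \<gamma>a: "\<gamma> * \<alpha> = a" using \<alpha>0 by (simp add: \<gamma>_def \<alpha>_def)
  show "0 < \<gamma>" using ab \<alpha>0 by (simp add: \<gamma>_def \<alpha>_def)
  have "L \<le> L ^ 4" using L1 by (intro self_le_power) auto
  then show "2 * L \<le> \<gamma>" using \<gamma>_ge L1 by linarith
  then show "1 \<le> \<gamma>" using L1 by linarith
  show "\<gamma> \<le> \<alpha>" using ab \<alpha>0 by (simp add: \<gamma>_def \<alpha>_def divide_le_eq flip: real_sqrt_mult)
  show "\<gamma> \<le> a" using \<alpha>0 \<gamma>a \<open>0 < \<gamma>\<close> mult_left_mono[of 1 \<alpha> \<gamma>] by simp
  show "\<alpha> \<le> b" using \<alpha>0 mult_left_mono[of 1 \<alpha> \<alpha>] by simp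
qed

lemma card_small_le:
  assumes "finite S" "real (card S) \<le> b" "m * L \<le> t"
  shows "real (card {I. I \<subseteq> S \<and> real (card I) \<le> m}) \<le> exp (t + 1)"
proof -
  have "real (card {I. I \<subseteq> S \<and> real (card I) \<le> m}) \<le> (1 / (b + 1)) powr (- m) * exp (1 / (b + 1) * b)"
    using assms ab by (intro card_small_subsets_le) auto
  also have "(1 / (b + 1)) powr (- m) = exp (m * L)"
    using ab by (simp add: powr_def L_def ln_div)
  also have "exp (m * L) * exp (1 / (b + 1) * b) \<le> exp t * exp 1"
    using assms ab by (intro mult_mono) auto
  finally show ?thesis by (simp add: exp_add)
qed

text \<open>I is the neighbourhood of the vertex u that is put back. The exponent splits into
  \<alpha> for the Kleitman-Winston rounds, 2 * \<alpha> for the weight and 4 * \<alpha> for the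
  remaining set. If \<nu> * L < 1, the neighbourhood is so small that listing its elements is cheap
  enough.\<close>

lemma card_extensions_left:
  assumes fin: "finite A" "finite B" and ne: "B \<noteq> {}" and card: "real (card A) \<le> a" "real (card B) \<le> b"
    and u: "u \<in> A" and G: "G \<in> c4_graphs (A - {u}) B"
  shows "real (card {I. I \<subseteq> B \<and> c4_free (G \<union> {u} \<times> I) \<and> removable_left \<alpha> \<gamma> (G \<union> {u} \<times> I) B u}) \<le> exp (7 * \<alpha>)"
proof -
  have G1: "c4_free G" "G \<subseteq> (A - {u}) \<times> B" using G by (auto simp: c4_graphs_def)
  let ?H = "\<lambda>y y'. \<exists>x. (x, y) \<in> G \<and> (x, y') \<in> G"
  define D where "D = Min (right_degree G ` B)"
  have "D \<in> right_degree G ` B" unfolding D_def using fin ne by (intro Min_in) auto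
  then obtain y0 where y0: "y0 \<in> B" "right_degree G y0 = D" by auto
  have Dle: "D \<le> right_degree G y" if "y \<in> B" for y using that fin by (simp add: D_def)
  \<comment> \<open>Putting u back raises the degree of a vertex attaining the minimum
    \<open>D\<close> by at most 1. Hence every admissible relative degree is at most this \<nu>,
    which depends on G but not on I.\<close>
  define \<nu> where "\<nu> = min 1 ((real D + 1) / \<gamma>)"
  have \<nu>: "0 < \<nu>" "\<nu> \<le> 1" "\<nu> * \<gamma> \<le> D + 1"
    using kw_facts by (auto simp: \<nu>_def min_def field_simps)
  \<comment> \<open>For \<nu> = 1 the size of I is not limited. This costs nothing, since the weight
    \<nu>^2 is then 1.\<close>
  define m where "m = (if \<nu> = 1 then b else \<nu> * \<alpha>)"
  let ?I = "{I. I \<subseteq> B \<and> c4_free (G \<union> {u} \<times> I) \<and> removable_left \<alpha> \<gamma> (G \<union> {u} \<times> I) B u}"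
  have sub: "?I \<subseteq> {I. I \<subseteq> B \<and> indep ?H I \<and> real (card I) \<le> m}"
  proof
    fix I assume I: "I \<in> ?I"
    then obtain \<mu> where \<mu>: "0 \<le> \<mu>" "\<mu> \<le> 1" "\<forall>y\<in>B. real (right_degree (G \<union> {u} \<times> I) y) \<ge> \<mu> * \<gamma>"
      "real (left_degree (G \<union> {u} \<times> I) u) \<le> \<mu> * \<alpha> \<or> \<mu> = 1"
      unfolding removable_left_def by blast
    have "{y. (u, y) \<in> G \<union> {u} \<times> I} = I" using G1 by auto
    then have dI: "left_degree (G \<union> {u} \<times> I) u = card I" by (simp add: left_degree_def)
    have fx: "finite {x. (x, y0) \<in> G}"
      by (rule finite_subset[OF _ fin(1)]) (use G1 in auto)
    have "right_degree (G \<union> {u} \<times> I) y0 \<le> card (insert u {x. (x, y0) \<in> G})"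
      unfolding right_degree_def using fx by (intro card_mono) auto
    also have "\<dots> \<le> D + 1" using y0 fx by (simp add: right_degree_def card_insert_if)
    finally have "\<mu> * \<gamma> \<le> D + 1" using \<mu>(3) y0(1) by fastforce
    then have \<mu>\<nu>: "\<mu> \<le> \<nu>" using \<mu> kw_facts by (simp add: \<nu>_def field_simps)
    have "real (card I) \<le> m"
    proof (cases "\<nu> = 1")
      case True
      then show ?thesis using I card fin card_mono[of B I] by (auto simp: m_def)
    next
      case False
      then have "\<mu> \<noteq> 1" using \<mu>\<nu> \<nu> by auto
      then have "real (card I) \<le> \<mu> * \<alpha>" using \<mu> dI by simp
      also have "\<dots> \<le> \<nu> * \<alpha>" using \<mu>\<nu> kw_facts by (intro mult_right_mono) auto
      finally show ?thesis using False by (simp add: m_def)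
    qed
    moreover have "indep ?H I" using I G1 by (intro c4_free_insert_vertex[of _ u]) auto
    ultimately show "I \<in> {I. I \<subseteq> B \<and> indep ?H I \<and> real (card I) \<le> m}" using I by auto
  qed
  have fI: "finite {I. I \<subseteq> B \<and> real (card I) \<le> m}"
    by (rule finite_subset[of _ "Pow B"]) (use fin in auto)
  show ?thesis
  proof (cases "\<nu> * L < 1")
    case True
    then have "\<nu> \<noteq> 1" using L1 by auto
    then have "m * L \<le> \<alpha>"
      using True kw_facts mult_right_mono[of "\<nu> * L" 1 \<alpha>] by (simp add: m_def mult_ac)
    then have "real (card {I. I \<subseteq> B \<and> real (card I) \<le> m}) \<le> exp (\<alpha> + 1)"
      using fin card by (intro card_small_le) auto
    also have "\<dots> \<le> exp (7 * \<alpha>)" using kw_facts by simp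
    finally show ?thesis
      using card_mono[OF fI, of ?I] sub by (smt (verit) Collect_mono_iff of_nat_mono subset_iff mem_Collect_eq)
  next
    case False
    \<comment> \<open>Half of \<nu> * \<gamma>, because without u the minimum degree is only known
      to be at least \<nu> * \<gamma> - 1; here \<nu> * \<gamma> \<ge> 2.\<close>
    define \<delta> where "\<delta> = \<nu> * \<gamma> / 2"
    have "\<nu> * (2 * L) \<le> \<nu> * \<gamma>" using kw_facts(3) \<nu> by (intro mult_left_mono) auto
    then have "2 \<le> \<nu> * \<gamma>" using False by (simp add: mult.left_commute)
    then have \<delta>D: "\<delta> \<le> D" using \<nu> by (simp add: \<delta>_def)
    have \<delta>0: "0 < \<delta>" using \<nu> kw_facts by (simp add: \<delta>_def)
    have "\<nu> * \<gamma> \<le> 1 * a" using \<nu> kw_facts by (intro mult_mono) auto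
    then have \<delta>a: "\<delta> \<le> 2 * a" using ab by (simp add: \<delta>_def)
    define \<beta> where "\<beta> = \<delta>\<^sup>2 / (2 * a)"
    have \<beta>eq: "\<beta> = \<nu>\<^sup>2 * \<gamma> / (8 * \<alpha>)"
      using kw_facts unfolding \<beta>_def \<delta>_def kw_facts(7)[symmetric] by (simp add: power2_eq_square field_simps)
    have "\<nu>\<^sup>2 * \<gamma> \<le> 1 * \<alpha>" using \<nu> kw_facts by (intro mult_mono) (auto simp: power_le_one)
    then have \<beta>1: "\<beta> \<le> 1" using kw_facts by (simp add: \<beta>eq field_simps)
    have "real (card ?I) \<le> real (card {I. I \<subseteq> B \<and> indep ?H I \<and> real (card I) \<le> m})"
      using sub by (intro of_nat_mono card_mono finite_subset[OF _ fI]) auto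
    also have "\<dots> \<le> exp (L * (L / \<beta> + 1)) * ((\<nu>\<^sup>2) powr (- m) * exp (\<nu>\<^sup>2 * (2 * a / \<delta>)))"
    proof (rule card_c4_extensions_le[where P = "A - {u}" and b = b])
      show "real (card (A - {u})) \<le> a"
        using card card_Diff1_le[of A u] by linarith
      show "\<delta> \<le> real (card {x. (x, y) \<in> G})" if "y \<in> B" for y
        using Dle[OF that] \<delta>D by (simp add: right_degree_def)
    qed (use G1 fin card ab \<delta>0 \<delta>a \<nu> \<beta>1 \<beta>_def L_def in \<open>auto simp: power_le_one\<close>)
    also have "\<dots> \<le> exp \<alpha> * (exp (2 * \<alpha>) * exp (4 * \<alpha>))"
    proof (intro mult_mono)
      \<comment> \<open>The case assumption trades 1 / \<nu>^2 for L^2. The rounds then cost at most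
        (8 * L^4 + L) * \<alpha> / \<gamma>, which \<open>\<gamma>_ge\<close> bounds by
        \<alpha>.\<close>
      have "1 \<le> (\<nu> * L)\<^sup>2" using False by (simp add: one_le_power)
      then have "\<gamma> / \<alpha> * 1 \<le> \<gamma> / \<alpha> * (\<nu> * L)\<^sup>2" using kw_facts by (intro mult_left_mono) auto
      also have "\<dots> = 8 * \<beta> * L\<^sup>2" by (simp add: \<beta>eq power_mult_distrib)
      finally have "L / \<beta> \<le> 8 * L ^ 3 * (\<alpha> / \<gamma>)"
        using kw_facts \<nu> L1 by (simp add: \<beta>eq field_simps power2_eq_square power3_eq_cube)
      then have "L * (L / \<beta> + 1) \<le> L * (8 * L ^ 3 * (\<alpha> / \<gamma>) + 1 * (\<alpha> / \<gamma>))"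
        using L1 kw_facts by (intro mult_left_mono add_mono) auto
      also have "\<dots> = (8 * L ^ 4 + L) * (\<alpha> / \<gamma>)" by (simp add: algebra_simps power_def numeral_eq_Suc)
      also have "\<dots> \<le> \<gamma> * (\<alpha> / \<gamma>)" using \<gamma>_ge kw_facts by (intro mult_right_mono) auto
      also have "\<dots> = \<alpha>" using kw_facts(2) by (simp only: times_divide_eq_right nonzero_mult_div_cancel_left less_imp_neq[symmetric] not_False_eq_True)
      finally show "exp (L * (L / \<beta> + 1)) \<le> exp \<alpha>" by simp
      show "(\<nu>\<^sup>2) powr (- m) \<le> exp (2 * \<alpha>)"
      proof (cases "\<nu> = 1")
        case True
        then show ?thesis using kw_facts by simp
      next
        case False
        have "(\<nu>\<^sup>2) powr (- m) = exp (2 * (- (\<nu> * ln \<nu>)) * \<alpha>)"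
          using \<nu> False by (simp add: powr_def m_def ln_realpow)
        also have "\<dots> \<le> exp (2 * 1 * \<alpha>)"
          unfolding exp_le_cancel_iff using neg_mult_ln_le[OF \<nu>(1)] kw_facts(1)
          by (intro mult_right_mono mult_left_mono) auto
        finally show ?thesis by simp
      qed
      have "\<nu>\<^sup>2 * (2 * a / \<delta>) = 4 * \<nu> * \<alpha>"
        using kw_facts \<nu> unfolding \<delta>_def kw_facts(7)[symmetric] by (simp add: power2_eq_square field_simps)
      also have "\<dots> \<le> 4 * \<alpha>" using \<nu> kw_facts by simp
      finally show "exp (\<nu>\<^sup>2 * (2 * a / \<delta>)) \<le> exp (4 * \<alpha>)" by simp
    qed auto
    also have "\<dots> = exp (7 * \<alpha>)" by (simp flip: exp_add)
    finally show ?thesis .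
  qed
qed

text \<open>The mirror image, applied to the converse graph. The set left after the rounds may have
  4 * \<alpha> / \<nu> elements, far more than the at most \<gamma> neighbours sought when b is much
  larger than a. The weight is therefore scaled down by a / b, and each neighbour costs an extra ln
  (b / a).\<close>

lemma card_extensions_right:
  assumes fin: "finite A" "finite B" and ne: "A \<noteq> {}" and card: "real (card A) \<le> a" "real (card B) \<le> b"
    and u: "u \<in> B" and G: "G \<in> c4_graphs A (B - {u})"
  shows "real (card {I. I \<subseteq> A \<and> c4_free (G \<union> I \<times> {u}) \<and> removable_right \<alpha> \<gamma> (G \<union> I \<times> {u}) A u}) \<le> exp (\<gamma> * (7 + ln (b / a)))"
proof -
  have G1: "c4_free (G\<inverse>)" "G\<inverse> \<subseteq> (B - {u}) \<times> A" using G by (auto simp: c4_graphs_def c4_free_converse)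
  let ?H = "\<lambda>y y'. \<exists>x. (x, y) \<in> G\<inverse> \<and> (x, y') \<in> G\<inverse>"
  define D where "D = Min (left_degree G ` A)"
  have "D \<in> left_degree G ` A" unfolding D_def using fin ne by (intro Min_in) auto
  then obtain y0 where y0: "y0 \<in> A" "left_degree G y0 = D" by auto
  have Dle: "D \<le> left_degree G y" if "y \<in> A" for y using that fin by (simp add: D_def)
  define \<nu> where "\<nu> = min 1 ((real D + 1) / \<alpha>)"
  have \<nu>: "0 < \<nu>" "\<nu> \<le> 1" "\<nu> * \<alpha> \<le> D + 1"
    using kw_facts by (auto simp: \<nu>_def min_def field_simps)
  define m where "m = \<nu> * \<gamma>"
  have lab: "0 \<le> ln (b / a)" using ab by simp
  let ?I = "{I. I \<subseteq> A \<and> c4_free (G \<union> I \<times> {u}) \<and> removable_right \<alpha> \<gamma> (G \<union> I \<times> {u}) A u}"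
  have sub: "?I \<subseteq> {I. I \<subseteq> A \<and> indep ?H I \<and> real (card I) \<le> m}"
  proof
    fix I assume I: "I \<in> ?I"
    then obtain \<mu> where \<mu>: "0 \<le> \<mu>" "\<mu> \<le> 1" "\<forall>y\<in>A. real (left_degree (G \<union> I \<times> {u}) y) \<ge> \<mu> * \<alpha>"
      "real (right_degree (G \<union> I \<times> {u}) u) \<le> \<mu> * \<gamma>"
      unfolding removable_right_def by blast
    have "{y. (y, u) \<in> G \<union> I \<times> {u}} = I" using G1 by auto
    then have dI: "right_degree (G \<union> I \<times> {u}) u = card I" by (simp add: right_degree_def)
    have fx: "finite {x. (y0, x) \<in> G}"
      by (rule finite_subset[OF _ fin(2)]) (use G1 in auto)
    have "left_degree (G \<union> I \<times> {u}) y0 \<le> card (insert u {x. (y0, x) \<in> G})"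
      unfolding left_degree_def using fx by (intro card_mono) auto
    also have "\<dots> \<le> D + 1" using y0 fx by (simp add: left_degree_def card_insert_if)
    finally have "\<mu> * \<alpha> \<le> D + 1" using \<mu>(3) y0(1) by fastforce
    then have \<mu>\<nu>: "\<mu> \<le> \<nu>" using \<mu> kw_facts by (simp add: \<nu>_def field_simps)
    have "real (card I) \<le> \<mu> * \<gamma>" using \<mu> dI by simp
    also have "\<dots> \<le> m" unfolding m_def using \<mu>\<nu> kw_facts by (intro mult_right_mono) auto
    finally have "real (card I) \<le> m" .
    moreover have "(G \<union> I \<times> {u})\<inverse> = G\<inverse> \<union> {u} \<times> I" by auto
    then have "indep ?H I" using I G1 c4_free_converse[of "G \<union> I \<times> {u}"]
      by (intro c4_free_insert_vertex[of "G\<inverse>" u]) auto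
    ultimately show "I \<in> {I. I \<subseteq> A \<and> indep ?H I \<and> real (card I) \<le> m}" using I by auto
  qed
  have fI: "finite {I. I \<subseteq> A \<and> real (card I) \<le> m}"
    by (rule finite_subset[of _ "Pow A"]) (use fin in auto)
  show ?thesis
  proof (cases "\<nu> * L < 1")
    case True
    then have "m * L \<le> \<gamma>"
      using True kw_facts mult_right_mono[of "\<nu> * L" 1 \<gamma>] by (simp add: m_def mult_ac)
    then have "real (card {I. I \<subseteq> A \<and> real (card I) \<le> m}) \<le> exp (\<gamma> + 1)"
      using fin card ab by (intro card_small_le) auto
    also have "\<dots> \<le> exp (\<gamma> * (7 + ln (b / a)))"
    proof -
      have "0 \<le> \<gamma> * ln (b / a)" using kw_facts lab by (intro mult_nonneg_nonneg) auto
      then show ?thesis unfolding exp_le_cancel_iff ring_distribs using kw_facts by linarith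
    qed
    finally show ?thesis
      using card_mono[OF fI, of ?I] sub by (smt (verit) Collect_mono_iff of_nat_mono subset_iff mem_Collect_eq)
  next
    case False
    define \<delta> where "\<delta> = \<nu> * \<alpha> / 2"
    have "2 * L \<le> \<alpha>" using kw_facts by linarith
    then have "\<nu> * (2 * L) \<le> \<nu> * \<alpha>" using \<nu> by (intro mult_left_mono) auto
    then have "2 \<le> \<nu> * \<alpha>" using False by (simp add: mult.left_commute)
    then have \<delta>D: "\<delta> \<le> D" using \<nu> by (simp add: \<delta>_def)
    have \<delta>0: "0 < \<delta>" using \<nu> kw_facts by (simp add: \<delta>_def)
    have "\<nu> * \<alpha> \<le> 1 * b" using \<nu> kw_facts by (intro mult_mono) auto
    then have \<delta>a: "\<delta> \<le> 2 * b" using ab by (simp add: \<delta>_def)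
    define \<beta> where "\<beta> = \<delta>\<^sup>2 / (2 * b)"
    have \<beta>eq: "\<beta> = \<nu>\<^sup>2 / 8"
      using kw_facts unfolding \<beta>_def \<delta>_def kw_facts(6)[symmetric] by (simp add: power2_eq_square field_simps)
    have \<beta>1: "\<beta> \<le> 1" using \<nu> power_le_one[of \<nu> 2] by (simp add: \<beta>eq)
    define x where "x = \<nu>\<^sup>2 * (a / b)"
    have "\<nu>\<^sup>2 * (a / b) \<le> 1 * 1" using \<nu> ab by (intro mult_mono) (auto simp: power_le_one)
    then have x: "0 < x" "x \<le> 1" using \<nu> ab by (auto simp: x_def)
    have "real (card ?I) \<le> real (card {I. I \<subseteq> A \<and> indep ?H I \<and> real (card I) \<le> m})"
      using sub by (intro of_nat_mono card_mono finite_subset[OF _ fI]) auto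
    also have "\<dots> \<le> exp (L * (L / \<beta> + 1)) * (x powr (- m) * exp (x * (2 * b / \<delta>)))"
    proof (rule card_c4_extensions_le[where P = "B - {u}" and b = a])
      show "real (card (B - {u})) \<le> b"
        using card card_Diff1_le[of B u] by linarith
      show "\<delta> \<le> real (card {x. (x, y) \<in> G\<inverse>})" if "y \<in> A" for y
        using Dle[OF that] \<delta>D by (simp add: left_degree_def)
    qed (use G1 fin card ab \<delta>0 \<delta>a x \<beta>1 \<beta>_def L_def in \<open>auto simp: power_le_one\<close>)
    also have "\<dots> \<le> exp \<gamma> * (exp (\<gamma> * (2 + ln (b / a))) * exp (4 * \<gamma>))"
    proof (intro mult_mono)
      have "1 \<le> (\<nu> * L)\<^sup>2" using False by (simp add: one_le_power)
      also have "\<dots> = 8 * \<beta> * L\<^sup>2" by (simp add: \<beta>eq power_mult_distrib)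
      finally have "L / \<beta> \<le> 8 * L ^ 3"
        using kw_facts \<nu> L1 by (simp add: \<beta>eq field_simps power2_eq_square power3_eq_cube)
      then have "L * (L / \<beta> + 1) \<le> L * (8 * L ^ 3 + 1)"
        using L1 kw_facts by (intro mult_left_mono add_mono) auto
      also have "\<dots> = 8 * L ^ 4 + L" by (simp add: algebra_simps power_def numeral_eq_Suc)
      also have "\<dots> \<le> \<gamma>" by (rule \<gamma>_ge)
      finally show "exp (L * (L / \<beta> + 1)) \<le> exp \<gamma>" by simp
      have "x powr (- m) = exp (\<gamma> * (2 * (- (\<nu> * ln \<nu>)) + \<nu> * ln (b / a)))"
        using \<nu> ab x by (simp add: powr_def m_def x_def ln_mult ln_realpow ln_div algebra_simps)
      also have "\<dots> \<le> exp (\<gamma> * (2 * 1 + 1 * ln (b / a)))"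
        unfolding exp_le_cancel_iff using neg_mult_ln_le[OF \<nu>(1)] kw_facts(2) lab \<nu>(2)
        by (intro mult_left_mono add_mono mult_right_mono) linarith+
      finally show "x powr (- m) \<le> exp (\<gamma> * (2 + ln (b / a)))" by simp
      have "x * (2 * b / \<delta>) = 4 * \<nu> * \<gamma>"
        using kw_facts \<nu> ab unfolding \<delta>_def x_def kw_facts(7)[symmetric] by (simp add: power2_eq_square field_simps)
      also have "\<dots> \<le> 4 * \<gamma>" using \<nu> kw_facts by simp
      finally show "exp (x * (2 * b / \<delta>)) \<le> exp (4 * \<gamma>)" by simp
    qed auto
    also have "\<dots> = exp (\<gamma> * (7 + ln (b / a)))" by (simp add: algebra_simps flip: exp_add)
    finally show ?thesis .
  qed
qed

section \<open>The number of C4-free graphs with given sides\<close>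

text \<open>Every graph has a removable vertex; deleting it leaves a smaller C4-free graph and a
  neighbourhood counted by the extension lemmas. The sums are the union bound over the deleted
  vertex.\<close>

lemma c4_graphs_recursion:
  fixes A :: "'a set" and B :: "'b set"
  assumes fin: "finite A" "finite B" and ne: "A \<noteq> {}" "B \<noteq> {}" and card: "real (card A) \<le> a" "real (card B) \<le> b"
  shows "real (card (c4_graphs A B)) \<le> (\<Sum>x\<in>A. real (card (c4_graphs (A - {x}) B)) * exp (7 * \<alpha>))
    + (\<Sum>y\<in>B. real (card (c4_graphs A (B - {y}))) * exp (\<gamma> * (7 + ln (b / a))))"
proof -
  define IL where "IL = (\<lambda>(u::'a) G. {I. I \<subseteq> B \<and> c4_free (G \<union> {u} \<times> I) \<and> removable_left \<alpha> \<gamma> (G \<union> {u} \<times> I) B u})"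
  define IR where "IR = (\<lambda>(u::'b) G. {I. I \<subseteq> A \<and> c4_free (G \<union> I \<times> {u}) \<and> removable_right \<alpha> \<gamma> (G \<union> I \<times> {u}) A u})"
  define UL where "UL = (\<lambda>u::'a. \<Union>G\<in>c4_graphs (A - {u}) B. (\<lambda>I. G \<union> {u} \<times> I) ` IL u G)"
  define UR where "UR = (\<lambda>u::'b. \<Union>G\<in>c4_graphs A (B - {u}). (\<lambda>I. G \<union> I \<times> {u}) ` IR u G)"
  have fL: "finite (IL u G)" for u G unfolding IL_def by (rule finite_subset[of _ "Pow B"]) (use fin in auto)
  have fR: "finite (IR u G)" for u G unfolding IR_def by (rule finite_subset[of _ "Pow A"]) (use fin in auto)
  have fg: "finite (c4_graphs (A - {u}) B)" "finite (c4_graphs A (B - {v}))" for u v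
    using fin by (auto intro!: finite_c4_graphs)
  have cover: "c4_graphs A B \<subseteq> (\<Union>u\<in>A. UL u) \<union> (\<Union>u\<in>B. UR u)"
  proof
    fix G assume G: "G \<in> c4_graphs A B"
    then have G1: "G \<subseteq> A \<times> B" "c4_free G" by (auto simp: c4_graphs_def)
    consider u where "u \<in> A" "removable_left \<alpha> \<gamma> G B u" | u where "u \<in> B" "removable_right \<alpha> \<gamma> G A u"
      using exists_removable[OF fin ne kw_facts(1,2)] by blast
    then show "G \<in> (\<Union>u\<in>A. UL u) \<union> (\<Union>u\<in>B. UR u)"
    proof cases
      case 1
      define I where "I = {y. (u, y) \<in> G}"
      define F where "F = {e \<in> G. fst e \<noteq> u}"
      have eq: "G = F \<union> {u} \<times> I" by (auto simp: F_def I_def)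
      have "F \<in> c4_graphs (A - {u}) B"
        using G1 c4_free_subset[of G F] by (auto simp: c4_graphs_def F_def)
      moreover have "I \<in> IL u F"
        using 1 G1 unfolding IL_def by (simp flip: eq) (auto simp: I_def)
      ultimately have "G \<in> UL u" unfolding UL_def using eq by blast
      then show ?thesis using 1 by blast
    next
      case 2
      define I where "I = {x. (x, u) \<in> G}"
      define F where "F = {e \<in> G. snd e \<noteq> u}"
      have eq: "G = F \<union> I \<times> {u}" by (auto simp: F_def I_def)
      have "F \<in> c4_graphs A (B - {u})"
        using G1 c4_free_subset[of G F] by (auto simp: c4_graphs_def F_def)
      moreover have "I \<in> IR u F"
        using 2 G1 unfolding IR_def by (simp flip: eq) (auto simp: I_def)
      ultimately have "G \<in> UR u" unfolding UR_def using eq by blast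
      then show ?thesis using 2 by blast
    qed
  qed
  have "card (c4_graphs A B) \<le> card ((\<Union>u\<in>A. UL u) \<union> (\<Union>u\<in>B. UR u))"
    by (rule card_mono[OF _ cover]) (use fin fg fL fR in \<open>auto simp: UL_def UR_def\<close>)
  also have "\<dots> \<le> (\<Sum>u\<in>A. card (UL u)) + (\<Sum>u\<in>B. card (UR u))"
    by (rule order_trans[OF card_Un_le add_mono[OF card_UN_le card_UN_le]]) (use fin in auto)
  finally have "real (card (c4_graphs A B)) \<le> (\<Sum>u\<in>A. real (card (UL u))) + (\<Sum>u\<in>B. real (card (UR u)))"
    by (simp flip: of_nat_sum of_nat_add)
  moreover have "real (card (UL u)) \<le> real (card (c4_graphs (A - {u}) B)) * exp (7 * \<alpha>)" if "u \<in> A" for u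
  proof -
    have "card (UL u) \<le> (\<Sum>G\<in>c4_graphs (A - {u}) B. card ((\<lambda>I. G \<union> {u} \<times> I) ` IL u G))"
      unfolding UL_def by (rule card_UN_le[OF fg(1)])
    also have "\<dots> \<le> (\<Sum>G\<in>c4_graphs (A - {u}) B. card (IL u G))"
      by (intro sum_mono card_image_le fL)
    finally have "real (card (UL u)) \<le> (\<Sum>G\<in>c4_graphs (A - {u}) B. real (card (IL u G)))"
      by (simp flip: of_nat_sum)
    also have "\<dots> \<le> (\<Sum>G\<in>c4_graphs (A - {u}) B. exp (7 * \<alpha>))"
      unfolding IL_def using that assms by (intro sum_mono card_extensions_left) auto
    finally show ?thesis by simp
  qed
  moreover have "real (card (UR u)) \<le> real (card (c4_graphs A (B - {u}))) * exp (\<gamma> * (7 + ln (b / a)))" if "u \<in> B" for u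
  proof -
    have "card (UR u) \<le> (\<Sum>G\<in>c4_graphs A (B - {u}). card ((\<lambda>I. G \<union> I \<times> {u}) ` IR u G))"
      unfolding UR_def by (rule card_UN_le[OF fg(2)])
    also have "\<dots> \<le> (\<Sum>G\<in>c4_graphs A (B - {u}). card (IR u G))"
      by (intro sum_mono card_image_le fR)
    finally have "real (card (UR u)) \<le> (\<Sum>G\<in>c4_graphs A (B - {u}). real (card (IR u G)))"
      by (simp flip: of_nat_sum)
    also have "\<dots> \<le> (\<Sum>G\<in>c4_graphs A (B - {u}). exp (\<gamma> * (7 + ln (b / a))))"
      unfolding IR_def using that assms by (intro sum_mono card_extensions_right) auto
    finally show ?thesis by simp
  qed
  ultimately show ?thesis
    by (meson add_mono order_trans sum_mono)
qed

text \<open>A and B shrink in the induction while a, b, \<alpha> and \<gamma> remain those of the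
  full sides. The factors 2 * a and 2 * b pay for the choice of the deleted vertex: left and right
  deletions account for one half of the bound each.\<close>

lemma card_c4_graphs_power:
  assumes fin: "finite A" "finite B" and card: "real (card A) \<le> a" "real (card B) \<le> b"
  shows "real (card (c4_graphs A B)) \<le> (2 * a * exp (7 * \<alpha>)) ^ card A * (2 * b * exp (\<gamma> * (7 + ln (b / a)))) ^ card B"
  using assms
proof (induction "card A + card B" arbitrary: A B rule: less_induct)
  case less
  let ?KL = "exp (7 * \<alpha>)" and ?KR = "exp (\<gamma> * (7 + ln (b / a)))"
  let ?UL = "2 * a * ?KL" and ?UR = "2 * b * ?KR"
  have lab: "0 \<le> ln (b / a)" using ab by simp
  have "1 * 1 \<le> ?UL" "1 * 1 \<le> ?UR"
    using ab kw_facts lab by (intro mult_mono; simp)+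
  then have M1: "1 \<le> ?UL" "1 \<le> ?UR" by auto
  show ?case
  proof (cases "A = {} \<or> B = {}")
    case True
    then have "c4_graphs A B \<subseteq> {{}}" by (auto simp: c4_graphs_def)
    then have "real (card (c4_graphs A B)) \<le> 1"
      using card_mono[of "{{}}" "c4_graphs A B"] by simp
    also have "1 \<le> ?UL ^ card A * ?UR ^ card B"
      using mult_mono[OF one_le_power[OF M1(1), of "card A"] one_le_power[OF M1(2), of "card B"]] ab by simp
    finally show ?thesis .
  next
    case False
    have L: "real (card (c4_graphs (A - {x}) B)) * ?KL \<le> ?UL ^ card A * ?UR ^ card B / (2 * a)" if x: "x \<in> A" for x
    proof -
      have cA: "card A = Suc (card (A - {x}))" using card.remove[OF less.prems(1) x] .
      have "real (card (c4_graphs (A - {x}) B)) \<le> ?UL ^ card (A - {x}) * ?UR ^ card B"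
        using less.prems cA by (intro less.hyps) auto
      then have "real (card (c4_graphs (A - {x}) B)) * ?KL \<le> ?UL ^ card (A - {x}) * ?UR ^ card B * ?KL"
        by (rule mult_right_mono) simp
      also have "\<dots> = ?UL ^ card A * ?UR ^ card B / (2 * a)"
        unfolding cA using ab by simp
      finally show ?thesis .
    qed
    have R: "real (card (c4_graphs A (B - {x}))) * ?KR \<le> ?UL ^ card A * ?UR ^ card B / (2 * b)" if x: "x \<in> B" for x
    proof -
      have cB: "card B = Suc (card (B - {x}))" using card.remove[OF less.prems(2) x] .
      have "real (card (c4_graphs A (B - {x}))) \<le> ?UL ^ card A * ?UR ^ card (B - {x})"
        using less.prems cB by (intro less.hyps) auto
      then have "real (card (c4_graphs A (B - {x}))) * ?KR \<le> ?UL ^ card A * ?UR ^ card (B - {x}) * ?KR"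
        by (rule mult_right_mono) simp
      also have "\<dots> = ?UL ^ card A * ?UR ^ card B / (2 * b)"
        unfolding cB using ab by simp
      finally show ?thesis .
    qed
    let ?T = "?UL ^ card A * ?UR ^ card B"
    have T0: "0 \<le> ?T" using M1 by simp
    have "real (card (c4_graphs A B)) \<le> (\<Sum>x\<in>A. ?T / (2 * a)) + (\<Sum>y\<in>B. ?T / (2 * b))"
    proof (rule order_trans[OF c4_graphs_recursion])
      show "(\<Sum>x\<in>A. real (card (c4_graphs (A - {x}) B)) * ?KL) + (\<Sum>y\<in>B. real (card (c4_graphs A (B - {y}))) * ?KR)
        \<le> (\<Sum>x\<in>A. ?T / (2 * a)) + (\<Sum>y\<in>B. ?T / (2 * b))"
        by (intro add_mono sum_mono L R)
    qed (use less.prems False in auto)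
    also have "\<dots> = card A * (?T / (2 * a)) + card B * (?T / (2 * b))" by simp
    also have "\<dots> \<le> a * (?T / (2 * a)) + b * (?T / (2 * b))"
      using less.prems ab T0 by (intro add_mono mult_right_mono divide_nonneg_nonneg) auto
    also have "\<dots> = ?T" using ab by simp
    finally show ?thesis .
  qed
qed

theorem card_c4_graphs_le:
  assumes fin: "finite A" "finite B" and card: "real (card A) \<le> a" "real (card B) \<le> b"
  shows "real (card (c4_graphs A B)) \<le> exp (a * sqrt b * (18 + ln (b / a)))"
proof -
  have lab: "0 \<le> ln (b / a)" using ab by simp
  have "2 * b \<le> (b + 1)\<^sup>2" using ab by (simp add: power2_eq_square algebra_simps)
  then have b2: "2 * b \<le> exp \<gamma>"
  proof (rule order_trans)
    have "(b + 1)\<^sup>2 = exp (2 * L)" using ab by (simp add: L_def exp_double)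
    also have "\<dots> \<le> exp \<gamma>" using kw_facts by simp
    finally show "(b + 1)\<^sup>2 \<le> exp \<gamma>" .
  qed
  have a2: "2 * a \<le> exp \<alpha>" using b2 ab kw_facts exp_le_cancel_iff[of \<gamma> \<alpha>] by linarith
  have L: "(2 * a * exp (7 * \<alpha>)) ^ card A \<le> exp (a * (8 * \<alpha>))"
  proof -
    have "2 * a * exp (7 * \<alpha>) \<le> exp \<alpha> * exp (7 * \<alpha>)" using a2 by (intro mult_right_mono) auto
    also have "\<dots> = exp (8 * \<alpha>)" by (simp flip: exp_add)
    finally have "(2 * a * exp (7 * \<alpha>)) ^ card A \<le> exp (8 * \<alpha>) ^ card A"
      using ab by (intro power_mono) auto
    also have "\<dots> = exp (card A * (8 * \<alpha>))" by (simp add: exp_of_nat_mult)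
    also have "\<dots> \<le> exp (a * (8 * \<alpha>))" using card kw_facts by simp
    finally show ?thesis .
  qed
  have R: "(2 * b * exp (\<gamma> * (7 + ln (b / a)))) ^ card B \<le> exp (b * (\<gamma> * (8 + ln (b / a))))"
  proof -
    have "2 * b * exp (\<gamma> * (7 + ln (b / a))) \<le> exp \<gamma> * exp (\<gamma> * (7 + ln (b / a)))"
      using b2 by (intro mult_right_mono) auto
    also have "\<dots> = exp (\<gamma> * (8 + ln (b / a)))" by (simp add: algebra_simps flip: exp_add)
    finally have "(2 * b * exp (\<gamma> * (7 + ln (b / a)))) ^ card B \<le> exp (\<gamma> * (8 + ln (b / a))) ^ card B"
      using ab by (intro power_mono) auto
    also have "\<dots> = exp (card B * (\<gamma> * (8 + ln (b / a))))" by (simp add: exp_of_nat_mult)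
    also have "\<dots> \<le> exp (b * (\<gamma> * (8 + ln (b / a))))"
      unfolding exp_le_cancel_iff using card kw_facts lab by (intro mult_right_mono) auto
    finally show ?thesis .
  qed
  \<comment> \<open>Both sides see the same number of edges, so the two factors have the same main
    term in the exponent.\<close>
  have "b * \<gamma> = a * \<alpha>" using kw_facts(6,7) by (metis mult.assoc mult.commute)
  then have "exp (a * (8 * \<alpha>)) * exp (b * (\<gamma> * (8 + ln (b / a)))) = exp (a * \<alpha> * (16 + ln (b / a)))"
    by (simp add: algebra_simps flip: exp_add mult.assoc)
  also have "\<dots> \<le> exp (a * \<alpha> * (18 + ln (b / a)))"
    using ab kw_facts by simp
  finally show ?thesis
    using card_c4_graphs_power[OF assms] mult_mono[OF L R] ab by (simp add: \<alpha>_def)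
qed

end

section \<open>The lower bound\<close>

definition big_primes :: "nat \<Rightarrow> nat set" where
  "big_primes n = {p. prime p \<and> real n powr (2/3) < real p \<and> p \<le> n}"

lemma finite_big_primes [simp]: "finite (big_primes n)"
  unfolding big_primes_def by (rule finite_subset[of _ "{..n}"]) auto

lemma big_primes_dvd_unique:
  assumes p: "p \<in> big_primes n" and q: "q \<in> big_primes n" and x: "0 < x" "x \<le> n" "p dvd x" "q dvd x"
  shows "p = q"
proof (rule ccontr)
  assume "p \<noteq> q"
  then have "coprime p q"
    using p q by (intro primes_coprime) (auto simp: big_primes_def)
  then have "p * q dvd x" using x by (simp add: divides_mult)
  then have pq: "real (p * q) \<le> real n" using x dvd_imp_le[of "p * q" x] by linarith
  have n: "real n \<ge> 1" using x by simp
  have "real n powr 1 \<le> real n powr (2/3 + 2/3)" using n by (intro powr_mono) auto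
  then have "real n \<le> real n powr (2/3) * real n powr (2/3)" using n by (simp add: powr_add[symmetric])
  also have "\<dots> < real p * real q"
    using p q by (intro mult_strict_mono) (auto simp: big_primes_def prime_gt_0_nat)
  finally show False using pq by simp
qed

text \<open>Choosing at most one multiple of every large prime costs nothing: a large prime dividing one
  side of \<open>a1 * a2 = b1 * b2\<close> identifies an element occurring on both sides.\<close>

lemma mult_sidon_union_big:
  assumes E: "mult_sidon F" "F \<subseteq> {1..n}" "\<And>x p. x \<in> F \<Longrightarrow> p \<in> big_primes n \<Longrightarrow> \<not> p dvd x"
    and f: "\<And>p. p \<in> big_primes n \<Longrightarrow> f p \<le> n div p"
  defines "X \<equiv> {p * f p |p. p \<in> big_primes n \<and> 0 < f p} \<union> F"
  shows "mult_sidon X" "X \<subseteq> {1..n}"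
    and "\<And>x p. x \<in> X \<Longrightarrow> p \<in> big_primes n \<Longrightarrow> p dvd x \<longleftrightarrow> 0 < f p \<and> x = p * f p"
    and "F = {x \<in> X. \<forall>p\<in>big_primes n. \<not> p dvd x}"
proof -
  have le: "p * f p \<le> n" if "p \<in> big_primes n" for p
    using f[OF that] by (metis div_times_less_eq_dividend mult.commute mult_le_mono1 order_trans)
  show sub: "X \<subseteq> {1..n}"
    using E(2) le unfolding X_def by (auto simp: big_primes_def prime_gt_0_nat Suc_le_eq)
  show dvd: "p dvd x \<longleftrightarrow> 0 < f p \<and> x = p * f p" if x: "x \<in> X" and p: "p \<in> big_primes n" for x p
  proof
    assume px: "p dvd x"
    then have "x \<notin> F" using E(3) p by blast
    then obtain q where q: "q \<in> big_primes n" "0 < f q" "x = q * f q" using x X_def by auto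
    have "p = q"
      by (rule big_primes_dvd_unique[OF p q(1), of x]) (use sub x px q in auto)
    then show "0 < f p \<and> x = p * f p" using q by simp
  qed auto
  show F: "F = {x \<in> X. \<forall>p\<in>big_primes n. \<not> p dvd x}"
    using E(3) unfolding X_def by auto
  show "mult_sidon X"
    unfolding mult_sidon_def
  proof safe
    fix a1 a2 b1 b2
    assume X: "a1 \<in> X" "a2 \<in> X" "b1 \<in> X" "b2 \<in> X" and d: "distinct [a1, a2, b1, b2]" and e: "a1 * a2 = b1 * b2"
    have *: "\<not> p dvd c1 * c2" if "p \<in> big_primes n" "{c1, c2, d1, d2} \<subseteq> X" "distinct [c1, c2, d1, d2]" "c1 * c2 = d1 * d2" for p c1 c2 d1 d2
    proof
      assume "p dvd c1 * c2"
      moreover then have "p dvd d1 * d2" using that by simp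
      moreover have "prime p" using that by (simp add: big_primes_def)
      ultimately have "p dvd c1 \<or> p dvd c2" "p dvd d1 \<or> p dvd d2" by (auto simp: prime_dvd_mult_iff)
      then show False using that dvd by auto
    qed
    have "\<not> p dvd a1 * a2" "\<not> p dvd b1 * b2" if "p \<in> big_primes n" for p
      using *[of p a1 a2 b1 b2] e X d that by auto
    then have "\<not> p dvd a1 \<and> \<not> p dvd a2 \<and> \<not> p dvd b1 \<and> \<not> p dvd b2" if "p \<in> big_primes n" for p
      using that by (meson dvd_mult dvd_mult2)
    then have "a1 \<in> F" "a2 \<in> F" "b1 \<in> F" "b2 \<in> F"
      using X unfolding F by blast+
    then show False using E(1) d e unfolding mult_sidon_def by blast
  qed
qed

lemma S_count_ge:
  assumes E: "mult_sidon E" "E \<subseteq> {1..n}" "\<And>x p. x \<in> E \<Longrightarrow> p \<in> big_primes n \<Longrightarrow> \<not> p dvd x"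
  shows "T_prod n * 2 ^ card E \<le> S_count n"
proof -
  let ?P = "big_primes n"
  \<comment> \<open>The value \<open>f p = 0\<close> stands for taking no multiple of p, which
    accounts for the \<open>+ 1\<close> in \<open>T_prod\<close>.\<close>
  let ?D = "PiE ?P (\<lambda>p. {0..n div p}) \<times> Pow E"
  define X where "X = (\<lambda>(f, F). {p * f p |p. p \<in> ?P \<and> 0 < f p} \<union> F)"
  have fE: "finite E" using E finite_subset by blast
  have sid: "mult_sidon F" if "F \<subseteq> E" for F
    using E(1) that unfolding mult_sidon_def by (meson subsetD)
  have props: "mult_sidon (X (f, F))" "X (f, F) \<subseteq> {1..n}"
     "\<And>x p. x \<in> X (f, F) \<Longrightarrow> p \<in> ?P \<Longrightarrow> p dvd x \<longleftrightarrow> 0 < f p \<and> x = p * f p"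
     "F = {x \<in> X (f, F). \<forall>p\<in>?P. \<not> p dvd x}"
    if fF: "(f, F) \<in> ?D" for f F
  proof -
    have F: "mult_sidon F" "F \<subseteq> {1..n}" and nd: "\<And>x p. x \<in> F \<Longrightarrow> p \<in> ?P \<Longrightarrow> \<not> p dvd x"
      using fF sid E(2,3) by auto
    have f: "\<And>p. p \<in> ?P \<Longrightarrow> f p \<le> n div p" using fF by (auto simp: PiE_iff)
    note * = mult_sidon_union_big[OF F nd f]
    have X: "X (f, F) = {p * f p |p. p \<in> ?P \<and> 0 < f p} \<union> F" by (simp add: X_def)
    show "mult_sidon (X (f, F))" "X (f, F) \<subseteq> {1..n}"
      "\<And>x p. x \<in> X (f, F) \<Longrightarrow> p \<in> ?P \<Longrightarrow> p dvd x \<longleftrightarrow> 0 < f p \<and> x = p * f p"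
      "F = {x \<in> X (f, F). \<forall>p\<in>?P. \<not> p dvd x}"
      unfolding X using * by blast+
  qed
  have inj: "inj_on X ?D"
  proof (rule inj_onI, clarify)
    fix f F g G
    assume f: "f \<in> PiE ?P (\<lambda>p. {0..n div p})" "F \<subseteq> E" and g: "g \<in> PiE ?P (\<lambda>p. {0..n div p})" "G \<subseteq> E"
      and eq: "X (f, F) = X (g, G)"
    have fD: "(f, F) \<in> ?D" and gD: "(g, G) \<in> ?D" using f g by auto
    have "F = G" using props(4)[OF fD] props(4)[OF gD] eq by simp
    moreover have "f = g"
    proof (rule PiE_ext[OF f(1) g(1)])
      fix p assume p: "p \<in> ?P"
      then have p0: "p > 0" by (simp add: big_primes_def prime_gt_0_nat)
      have *: "p * h p \<in> X (h, H)" if "0 < h p" for h H using that p by (auto simp: X_def)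
      show "f p = g p"
      proof (cases "0 < f p \<or> 0 < g p")
        case True
        then show ?thesis
        proof
          assume "0 < f p"
          then have "p * f p \<in> X (g, G)" using *[of f F] eq by simp
          then show ?thesis using props(3)[OF gD _ p, of "p * f p"] p0 by simp
        next
          assume "0 < g p"
          then have "p * g p \<in> X (f, F)" using *[of g G] eq by simp
          then show ?thesis using props(3)[OF fD _ p, of "p * g p"] p0 by simp
        qed
      qed auto
    qed
    ultimately show "f = g \<and> F = G" by simp
  qed
  have "T_prod n * 2 ^ card E = card ?D"
    by (simp add: card_cartesian_product card_PiE card_Pow fE T_prod_def big_primes_def[symmetric])
  also have "\<dots> = card (X ` ?D)" using inj by (simp add: card_image)
  also have "\<dots> \<le> card {A. A \<subseteq> {1..n} \<and> mult_sidon A}"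
  proof (rule card_mono)
    show "X ` ?D \<subseteq> {A. A \<subseteq> {1..n} \<and> mult_sidon A}"
    proof
      fix A assume "A \<in> X ` ?D"
      then obtain f F where "(f, F) \<in> ?D" "A = X (f, F)" by auto
      then show "A \<in> {A. A \<subseteq> {1..n} \<and> mult_sidon A}" using props(1,2) by blast
    qed
  qed auto
  finally show ?thesis by (simp add: S_count_def)
qed

section \<open>Sidon sets from C4-free graphs on primes\<close>

text \<open>By unique factorization, an equation between products of two edges only rearranges
  endpoints, and since U and V are disjoint, left ends remain left ends. The four edges would form a
  four-cycle.\<close>

lemma mult_sidon_prime_products:
  assumes G: "c4_free G" "\<And>u v. (u, v) \<in> G \<Longrightarrow> prime u \<and> prime v \<and> u \<in> U \<and> v \<in> V" and disj: "U \<inter> V = {}"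
  shows "mult_sidon ((\<lambda>(u, v). u * v) ` G)" "inj_on (\<lambda>(u, v). u * v) G"
proof -
  have uv: "u \<noteq> v'" "v' \<noteq> u" if "(u, v) \<in> G" "(u', v') \<in> G" for u v u' v'
    using G(2)[OF that(1)] G(2)[OF that(2)] disj by auto
  have dv: "p = q" if "p dvd q" "prime p" "prime q" for p q :: nat
    using that primes_dvd_imp_eq by blast
  have dvm: "p = a \<or> p = b" if "p dvd a * b" "prime p" "prime a" "prime b" for p a b :: nat
    using that dv by (auto simp: prime_dvd_mult_iff)
  show "inj_on (\<lambda>(u, v). u * v) G"
  proof (rule inj_onI, clarify)
    fix u v u' v' assume *: "(u, v) \<in> G" "(u', v') \<in> G" "u * v = u' * v'"
    then have "u dvd u' * v'" by (metis dvd_triv_left)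
    then have "u = u'" using G(2)[OF *(1)] G(2)[OF *(2)] uv[OF *(1,2)] dv by (auto simp: prime_dvd_mult_iff)
    then show "u = u' \<and> v = v'" using * G(2)[OF *(1)] by (auto dest: prime_gt_0_nat)
  qed
  show "mult_sidon ((\<lambda>(u, v). u * v) ` G)"
    unfolding mult_sidon_def
  proof (safe, clarsimp simp del: mult_cancel1 mult_cancel2)
    fix u1 v1 u2 v2 u3 v3 u4 v4
    assume g: "(u1, v1) \<in> G" "(u2, v2) \<in> G" "(u3, v3) \<in> G" "(u4, v4) \<in> G"
      and e: "u1 * v1 * (u2 * v2) = u3 * v3 * (u4 * v4)"
      and d: "u1 * v1 \<noteq> u2 * v2" "u1 * v1 \<noteq> u3 * v3" "u1 * v1 \<noteq> u4 * v4" "u2 * v2 \<noteq> u3 * v3" "u2 * v2 \<noteq> u4 * v4" "u3 * v3 \<noteq> u4 * v4"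
    \<comment> \<open>The essential case: the ends of the first edge lie on different edges of the
      other side. Cancelling them leaves u2 = u4 and v2 = v3, which closes a four-cycle.\<close>
    have main: False
      if g: "(u1, v1) \<in> G" "(u2, v2) \<in> G" "(u1, v3) \<in> G" "(u4, v1) \<in> G"
        and e: "u1 * v1 * (u2 * v2) = u1 * v3 * (u4 * v1)"
        and d: "u1 * v1 \<noteq> u1 * v3" "u2 * v2 \<noteq> u1 * v3" for u1 v1 u2 v2 v3 u4
    proof -
      have "u1 > 0" "v1 > 0" using G(2)[OF g(1)] by (auto simp: prime_gt_0_nat)
      then have e': "u2 * v2 = u4 * v3" using e by simp
      have "u2 dvd u4 * v3" "v2 dvd u4 * v3"
        using e' by (metis dvd_triv_left, metis dvd_triv_right)
      then have "u2 = u4 \<or> u2 = v3" "v2 = u4 \<or> v2 = v3"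
        using G(2)[OF g(2)] G(2)[OF g(3)] G(2)[OF g(4)] dvm[of u2 u4 v3] dvm[of v2 u4 v3] \<open>u2 dvd u4 * v3\<close> \<open>v2 dvd u4 * v3\<close> by auto
      then have "u2 = u4" "v2 = v3"
        using uv[OF g(2) g(3)] uv[OF g(4) g(2)] by auto
      then have "u1 = u2 \<or> v1 = v3"
        using c4_freeD[OF G(1), of u1 v1 v3 u2] g by auto
      then show False using d \<open>v2 = v3\<close> by auto
    qed
    have "u1 dvd u3 * v3 * (u4 * v4)" "v1 dvd u3 * v3 * (u4 * v4)"
      using e by (metis dvd_triv_left dvd_mult2, metis dvd_triv_right dvd_mult2)
    then have "u1 dvd u3 * v3 \<or> u1 dvd u4 * v4" "v1 dvd u3 * v3 \<or> v1 dvd u4 * v4"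
      using G(2)[OF g(1)] by (auto simp: prime_dvd_mult_iff)
    then have "u1 = u3 \<or> u1 = v3 \<or> u1 = u4 \<or> u1 = v4" "v1 = u3 \<or> v1 = v3 \<or> v1 = u4 \<or> v1 = v4"
      using G(2)[OF g(1)] G(2)[OF g(3)] G(2)[OF g(4)] dvm by blast+
    then have "u1 = u3 \<or> u1 = u4" "v1 = v3 \<or> v1 = v4"
      using uv[OF g(1) g(3)] uv[OF g(1) g(4)] uv[OF g(3) g(1)] uv[OF g(4) g(1)] by auto
    then consider "u1 = u3" "v1 = v3" | "u1 = u4" "v1 = v4" | "u1 = u3" "v1 = v4" | "u1 = u4" "v1 = v3" by blast
    then show False
    proof cases
      case 3
      then show False using main[of u1 v1 u2 v2 v3 u4] g e d by auto
    next
      case 4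
      then show False using main[of u1 v1 u2 v2 v4 u3] g e d by (auto simp: mult_ac)
    qed (use d in auto)
  qed
qed

text \<open>The points are the pairs \<open>(x, y)\<close> with \<open>x < r\<close> and \<open>y < q\<close>, encoded as \<open>x * q + y\<close>; the lines
  \<open>y = s * x + b (mod q)\<close> are encoded as \<open>k = s * q + b\<close>. The line \<open>k\<close> keeps only its points with \<open>x < R k\<close>.\<close>

definition line_point :: "nat \<Rightarrow> nat \<Rightarrow> nat \<Rightarrow> nat" where
  "line_point q k x = x * q + ((k div q) * x + k mod q) mod q"

definition line_graph :: "nat \<Rightarrow> nat \<Rightarrow> (nat \<Rightarrow> nat) \<Rightarrow> (nat \<times> nat) set" where
  "line_graph q r R = (\<lambda>(k, x). (nth_prime (line_point q k x), nth_prime (r * q + k))) ` (SIGMA k:{..<q\<^sup>2}. {..<R k})"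

lemma int_dvd_diff_imp_eq:
  assumes "int q dvd int x - int y" "x < q" "y < q"
  shows "x = y"
  using assms cong_less_modulus_unique_nat[of x y q] by (simp add: cong_int_iff flip: cong_iff_dvd_diff)

text \<open>Lines with slopes s, s' that agree at x and x' satisfy q dvd (s - s') * (x - x'). As x
  and x' differ mod q, the slopes agree, and then the intercepts do.\<close>

lemma line_point_unique:
  assumes q: "prime q" and x: "x < q" "x' < q" "x \<noteq> x'" and k: "k < q\<^sup>2" "k' < q\<^sup>2"
    and e: "line_point q k x = line_point q k' x" "line_point q k x' = line_point q k' x'"
  shows "k = k'"
proof -
  define s b s' b' where "s = k div q" and "b = k mod q" and "s' = k' div q" and "b' = k' mod q"
  have q0: "q > 0" using q by (simp add: prime_gt_0_nat)
  have sl: "s < q" "s' < q" "b < q" "b' < q"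
    using k q0 by (auto simp: s_def s'_def b_def b'_def power2_eq_square less_mult_imp_div_less)
  have c1: "[int (s * x + b) = int (s' * x + b')] (mod int q)"
    and c2: "[int (s * x' + b) = int (s' * x' + b')] (mod int q)"
    using e unfolding line_point_def s_def b_def s'_def b'_def cong_int_iff
    by (simp_all add: Cong.cong_def)
  have "[int (s * x + b) - int (s * x' + b) = int (s' * x + b') - int (s' * x' + b')] (mod int q)"
    using c1 c2 by (rule cong_diff)
  then have "int q dvd (int s - int s') * (int x - int x')"
    by (simp add: cong_iff_dvd_diff algebra_simps)
  moreover have "prime (int q)" using q by simp
  ultimately have "int q dvd int s - int s' \<or> int q dvd int x - int x'"
    by (simp add: prime_dvd_mult_iff)
  moreover have "\<not> int q dvd int x - int x'"
    using x int_dvd_diff_imp_eq by blast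
  ultimately have "int q dvd int s - int s'" by blast
  then have ss: "s = s'"
    using sl int_dvd_diff_imp_eq by blast
  then have "int q dvd int b - int b'" using c1 by (simp add: cong_iff_dvd_diff)
  then have "b = b'"
    using sl int_dvd_diff_imp_eq by blast
  then show ?thesis using ss unfolding s_def s'_def b_def b'_def by (metis mult_div_mod_eq)
qed

lemma line_point_div: "q > 0 \<Longrightarrow> line_point q k x div q = x"
  by (simp add: line_point_def)

lemma line_point_less:
  assumes "q > 0"
  shows "line_point q k x < (x + 1) * q"
  using assms mod_less_divisor[OF assms, of "(k div q) * x + k mod q"] by (simp add: line_point_def)

text \<open>Points receive the primes with index below r * q and lines those from r * q on, which
  separates the two sides. The code of a point determines its abscissa, so different points of one
  line have different abscissas.\<close>

lemma line_graph_properties: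
  assumes q: "prime q" and r: "r \<le> q" and R: "\<And>k. k < q\<^sup>2 \<Longrightarrow> R k \<le> r"
  shows "c4_free (line_graph q r R)" and "card (line_graph q r R) = (\<Sum>k<q\<^sup>2. R k)"
    and "\<And>u v. (u, v) \<in> line_graph q r R \<Longrightarrow> prime u \<and> prime v \<and> u \<in> {..<nth_prime (r * q)} \<and> v \<in> {nth_prime (r * q)..}"
proof -
  have q0: "q > 0" using q by (simp add: prime_gt_0_nat)
  have inj: "nth_prime i = nth_prime j \<longleftrightarrow> i = j" for i j
    using strict_mono_nth_prime by (simp add: strict_mono_eq)
  show "c4_free (line_graph q r R)"
    unfolding c4_free_def
  proof (clarify, rule ccontr)
    fix u u' v v'
    assume g: "(u, v) \<in> line_graph q r R" "(u, v') \<in> line_graph q r R" "(u', v) \<in> line_graph q r R" "(u', v') \<in> line_graph q r R"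
      and n: "v \<noteq> v'"
    obtain k x where 1: "k < q\<^sup>2" "x < R k" "u = nth_prime (line_point q k x)" "v = nth_prime (r * q + k)"
      using g(1) by (auto simp: line_graph_def)
    obtain k' x2 where 2: "k' < q\<^sup>2" "x2 < R k'" "u = nth_prime (line_point q k' x2)" "v' = nth_prime (r * q + k')"
      using g(2) by (auto simp: line_graph_def)
    obtain k3 x' where 3: "k3 < q\<^sup>2" "x' < R k3" "u' = nth_prime (line_point q k3 x')" "v = nth_prime (r * q + k3)"
      using g(3) by (auto simp: line_graph_def)
    obtain k4 x4 where 4: "k4 < q\<^sup>2" "x4 < R k4" "u' = nth_prime (line_point q k4 x4)" "v' = nth_prime (r * q + k4)"
      using g(4) by (auto simp: line_graph_def)
    have k: "k3 = k" "k4 = k'" using 1 2 3 4 by (auto simp: inj)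
    have eq: "line_point q k x = line_point q k' x2" "line_point q k x' = line_point q k' x4"
      using 1 2 3 4 k by (auto simp: inj)
    then have xx: "x2 = x" "x4 = x'" using line_point_div[OF q0] by metis+
    assume "u \<noteq> u'"
    then have "x \<noteq> x'" using 1 3 k by auto
    then have "k = k'"
      using line_point_unique[OF q, of x x' k k'] 1 2 3 4 k xx eq R r by (metis order_less_le_trans)
    then show False using n 1 2 by simp
  qed
  have "inj_on (\<lambda>(k, x). (nth_prime (line_point q k x), nth_prime (r * q + k))) (SIGMA k:{..<q\<^sup>2}. {..<R k})"
  proof (rule inj_onI, clarify)
    fix k x k' x' assume "nth_prime (line_point q k x) = nth_prime (line_point q k' x')" "nth_prime (r * q + k) = nth_prime (r * q + k')"
    then have "k = k'" "line_point q k x = line_point q k' x'" by (auto simp: inj)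
    then show "k = k' \<and> x = x'" using line_point_div[OF q0] by metis
  qed
  then show "card (line_graph q r R) = (\<Sum>k<q\<^sup>2. R k)"
    unfolding line_graph_def by (simp add: card_image)
  show "prime u \<and> prime v \<and> u \<in> {..<nth_prime (r * q)} \<and> v \<in> {nth_prime (r * q)..}"
    if g: "(u, v) \<in> line_graph q r R" for u v
  proof -
    obtain k x where 1: "k < q\<^sup>2" "x < R k" "u = nth_prime (line_point q k x)" "v = nth_prime (r * q + k)"
      using g by (auto simp: line_graph_def)
    have "(x + 1) * q \<le> r * q" using 1 R[OF 1(1)] by (intro mult_right_mono) auto
    then have "line_point q k x < r * q" using line_point_less[OF q0, of k x] by linarith
    then show ?thesis
      using 1 by (auto simp: prime_nth_prime strict_mono_less[OF strict_mono_nth_prime] strict_mono_less_eq[OF strict_mono_nth_prime])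
  qed
qed

section \<open>Elementary inequalities and the edge count of the truncated plane\<close>

lemma sum_inverse_ge_ln:
  fixes c :: real
  assumes "0 < c"
  shows "(\<Sum>k<N. 1 / (c + real k)) \<ge> ln ((c + real N) / c)"
proof (induction N)
  case 0
  then show ?case using assms by simp
next
  case (Suc N)
  have c: "c + real N > 0" using assms by simp
  have "(c + real (Suc N)) / c = (1 + 1 / (c + real N)) * ((c + real N) / c)"
  proof -
    have "1 + 1 / (c + real N) = (c + real (Suc N)) / (c + real N)" using c by (simp add: field_simps)
    then show ?thesis using c by simp
  qed
  then have "ln ((c + real (Suc N)) / c) = ln (1 + 1 / (c + real N)) + ln ((c + real N) / c)"
    using c assms by (simp only: ln_mult_pos add_pos_pos divide_pos_pos zero_less_one)
  also have "\<dots> \<le> 1 / (c + real N) + (\<Sum>k<N. 1 / (c + real k))"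
    using Suc c by (intro add_mono ln_add_one_self_le_self) auto
  finally show ?case by simp
qed

text \<open>The slope is chosen such that the difference of the two sides is maximal at \<open>t = 12/5\<close>.\<close>

lemma ln_one_plus_square_ge:
  fixes t :: real
  assumes "1.19 \<le> t" "t \<le> 3.57"
  shows "ln (1 + t\<^sup>2) \<ge> 120 / 169 * t"
proof -
  define h where "h = (\<lambda>t::real. ln (1 + t\<^sup>2) - 120 / 169 * t)"
  \<comment> \<open>Reduces a numerical bound on \<open>exp\<close> to a comparison of rational
    powers by means of e < 2.72.\<close>
  have e: "exp (real N / real K) \<le> y" if "2.72 ^ N \<le> y ^ K" "0 < y" "0 < K" for N K y
  proof -
    have "exp (real N / real K) ^ K = exp 1 ^ N"
      using that by (simp flip: exp_of_nat_mult)
    also have "\<dots> \<le> 2.72 ^ N" using e_less_272 by (intro power_mono) auto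
    also note that(1)
    finally show ?thesis using that by (simp add: power_mono_iff)
  qed
  have d: "(h has_real_derivative (2 * x / (1 + x\<^sup>2) - 120 / 169)) (at x)" for x
  proof -
    have "1 + x\<^sup>2 > 0" by (simp add: add_pos_nonneg)
    then show ?thesis unfolding h_def
      by (auto intro!: derivative_eq_intros simp: power2_eq_square field_simps)
  qed
  \<comment> \<open>The critical points are 5/12 and 12/5. On the given range h increases up to 12/5
    and decreases afterwards, so only the end points 1.19 and 3.57 have to be checked.\<close>
  have key: "2 * x / (1 + x\<^sup>2) - 120 / 169 = 120 * (12/5 - x) * (x - 5/12) / (169 * (1 + x\<^sup>2))" for x :: real
  proof -
    have "1 + x\<^sup>2 \<noteq> 0" by (smt (verit) zero_le_power2)
    then show ?thesis by (simp add: field_simps power2_eq_square)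
  qed
  show ?thesis
  proof (cases "t \<le> 12/5")
    case True
    have "h 1.19 \<le> h t"
    proof (rule DERIV_nonneg_imp_nondecreasing[OF assms(1)])
      fix x assume "1.19 \<le> x" "x \<le> t"
      then have "2 * x / (1 + x\<^sup>2) - 120 / 169 \<ge> 0"
        unfolding key using True by (intro divide_nonneg_nonneg mult_nonneg_nonneg) auto
      then show "\<exists>y. (h has_real_derivative y) (at x) \<and> 0 \<le> y" using d by blast
    qed
    moreover have "exp (real 6 / real 7) \<le> (2.4161::real)"
      by (rule e) (simp_all add: power_numeral_even power_numeral_odd)
    then have "6 / 7 \<le> ln (2.4161::real)" by (subst ln_ge_iff) auto
    then have "h 1.19 \<ge> 0" by (simp add: h_def power2_eq_square)
    ultimately show ?thesis by (simp add: h_def)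
  next
    case False
    have "h 3.57 \<le> h t"
    proof (rule DERIV_nonpos_imp_nonincreasing[OF assms(2)])
      fix x assume "t \<le> x" "x \<le> 3.57"
      then have "2 * x / (1 + x\<^sup>2) - 120 / 169 \<le> 0"
        unfolding key using False by (intro divide_nonpos_nonneg mult_nonpos_nonneg mult_nonneg_nonpos) auto
      then show "\<exists>y. (h has_real_derivative y) (at x) \<and> y \<le> 0" using d by blast
    qed
    moreover have "exp (real 13 / real 5) \<le> (13.7449::real)"
      by (rule e) (simp_all add: power_numeral_even power_numeral_odd)
    then have "13 / 5 \<le> ln (13.7449::real)" by (subst ln_ge_iff) auto
    then have "h 3.57 \<ge> 0" by (simp add: h_def power2_eq_square)
    ultimately show ?thesis by (simp add: h_def)
  qed
qed

text \<open>AM-GM for the logarithms. It replaces the condition that a product of two primes be at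
  most n by a condition on the product of their indices; the quarter is the source of the 2 in m = 2
  * sqrt n / (1.26 * ln n).\<close>

lemma mult_ln_le_quarter_square:
  fixes x y :: real
  assumes "1 \<le> x" "1 \<le> y" "x * y \<le> M" "1 \<le> M"
  shows "x * ln x * (y * ln y) \<le> M * (ln M)\<^sup>2 / 4"
proof -
  have l: "0 \<le> ln x" "0 \<le> ln y" "ln x + ln y \<le> ln M"
    using assms by (auto simp flip: ln_mult_pos intro!: ln_mono)
  have "4 * (ln x * ln y) \<le> (ln x + ln y)\<^sup>2"
    using zero_le_power2[of "ln x - ln y"] by (simp add: power2_eq_square algebra_simps)
  also have "\<dots> \<le> (ln M)\<^sup>2" using l by (intro power_mono) auto
  finally have "ln x * ln y \<le> (ln M)\<^sup>2 / 4" by simp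
  then have "x * y * (ln x * ln y) \<le> M * ((ln M)\<^sup>2 / 4)"
    using assms l by (intro mult_mono) auto
  then show ?thesis by (simp add: mult_ac)
qed

text \<open>By the choice of m, primes whose indices I and J satisfy I * J \<le> m^2 have product at
  most n. Let q = t * sqrt m. The points use about r * q = m indices and the lines the next q^2 =
  t^2 * m. A line with index J keeps about m^2 / (q * J) columns of q points, one point in each.
  Summing over J gives about m^2 / q * ln (1 + t^2) = m^(3/2) * ln (1 + t^2) / t edges. The
  hypothesis \<open>sm\<close> keeps the primes of the lines below n^(2/3).\<close>

lemma S_count_ge_powr:
  fixes n q N0 :: nat and m :: real
  assumes n: "n \<ge> 2" and m_eq: "m = 2 * sqrt n / (1.26 * ln n)" and m: "1 \<le> m" "m\<^sup>2 \<le> n"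
    and N0: "\<And>j. j \<ge> N0 \<Longrightarrow> nth_prime j \<le> 1.26 * j * ln j" "real N0 \<le> 1.19 * sqrt m" "4 \<le> 1.19 * sqrt m"
    and q: "prime q" "1.19 * sqrt m < q" "q \<le> 3.57 * sqrt m"
    and sm: "1.26 * (27 * m) * ln (27 * m) \<le> n powr (2/3)"
  shows "real (T_prod n) * 2 powr (120/169 * m powr (3/2) - 14.8 * m) \<le> S_count n"
proof -
  have q0: "q > 0" using q by (simp add: prime_gt_0_nat)
  have sm0: "sqrt m > 0" "sqrt m * sqrt m = m" using m by auto
  define t where "t = q / sqrt m"
  have t: "1.19 \<le> t" "t \<le> 3.57" "q = t * sqrt m" using q sm0 by (auto simp: t_def field_simps)
  have q2: "real q * q = t\<^sup>2 * m" using t(3) sm0 by (simp add: power2_eq_square mult_ac)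
  have "1.19\<^sup>2 \<le> t\<^sup>2" "t\<^sup>2 \<le> 3.57\<^sup>2" using t by (auto intro: power_mono)
  then have t2: "1.4 \<le> t\<^sup>2" "t\<^sup>2 \<le> 12.75" by (auto simp: power2_eq_square)
  have q2b: "1.4 * m \<le> real q * q" "real q * q \<le> 12.75 * m"
    unfolding q2 using t2 m by (auto intro: mult_right_mono)
  have q4: "4 \<le> real q" using q N0(3) by linarith
  define r where "r = nat \<lceil>m / q\<rceil>"
  have mq: "m / q > 0" using m q0 by simp
  have r: "m / q \<le> r" "r \<le> m / q + 1"
    unfolding r_def using mq by (simp_all add: real_nat_ceiling_ge)
  have r1: "m \<le> r * q" using r q0 by (simp add: field_simps)
  have r2: "r * q \<le> m + q" using r(2) q0 by (simp add: field_simps)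
  have rq: "r \<le> q"
  proof -
    have "4 * real q \<le> real q * real q" using q4 by (intro mult_right_mono) auto
    then have "m + q \<le> real q * real q" using q2b by linarith
    then have "m / q + 1 \<le> q" using q0 by (simp add: field_simps)
    then show ?thesis using r by linarith
  qed
  have r0: "r \<ge> 1" using r mq by (cases r) auto
  define R where "R = (\<lambda>k. nat \<lfloor>m\<^sup>2 / (q * (r * q + k + 1))\<rfloor>)"
  have Rle: "real (R k) \<le> m\<^sup>2 / (q * (r * q + k + 1))" for k
    unfolding R_def by (rule of_nat_floor) simp
  have R: "R k \<le> r" for k
  proof -
    have "m \<le> real (r * q + k + 1)" using r1 by simp
    then have "m\<^sup>2 / (q * (r * q + k + 1)) \<le> m\<^sup>2 / (q * m)"
      unfolding of_nat_mult using m q0 by (intro divide_left_mono mult_left_mono mult_pos_pos) auto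
    also have "\<dots> = m / q" using m by (simp add: power2_eq_square)
    finally have "real (R k) \<le> r" using Rle[of k] r by linarith
    then show ?thesis by simp
  qed
  define G where "G = line_graph q r R"
  have c4: "c4_free G"
    unfolding G_def by (rule line_graph_properties(1)[OF q(1) rq]) (rule R)
  have cG: "card G = (\<Sum>k<q\<^sup>2. R k)"
    unfolding G_def by (rule line_graph_properties(2)[OF q(1) rq]) (rule R)
  have lg3: "prime u \<and> prime v \<and> u \<in> {..<nth_prime (r * q)} \<and> v \<in> {nth_prime (r * q)..}" if "(u, v) \<in> G" for u v
    by (rule line_graph_properties(3)[OF q(1) rq _ that[unfolded G_def]]) (rule R)
  define E where "E = (\<lambda>(u, v). u * v) ` G"
  have sid: "mult_sidon E" and inj: "inj_on (\<lambda>(u, v). u * v) G"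
    unfolding E_def using mult_sidon_prime_products[OF c4 lg3] by (auto simp: disjoint_iff)
  have cE: "card E = (\<Sum>k<q\<^sup>2. R k)" using inj cG by (simp add: E_def card_image)
  have elem: "u * v \<le> n \<and> u \<le> v \<and> real v \<le> n powr (2/3)" if uv: "(u, v) \<in> G" for u v
  proof -
    obtain k x where kx: "k < q\<^sup>2" "x < R k" "u = nth_prime (line_point q k x)" "v = nth_prime (r * q + k)"
      using uv by (auto simp: G_def line_graph_def)
    \<comment> \<open>The index of the point is rounded up to the end of its column. This also makes
      it at least q \<ge> N0, so that the bound on primes applies even to the smallest
      points.\<close>
    define I where "I = (x + 1) * q"
    define J where "J = r * q + k + 1"
    have "1 * q \<le> r * q" using r0 by (rule mult_right_mono) simp
    then have Iq: "q \<le> I" "q \<le> J"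
      unfolding I_def J_def by (simp, linarith)
    have u: "real u \<le> 1.26 * I * ln I"
    proof -
      have "u \<le> nth_prime I"
        using line_point_less[OF q0, of k x] by (auto simp: kx I_def strict_mono_less_eq[OF strict_mono_nth_prime])
      moreover have "real (nth_prime I) \<le> 1.26 * I * ln I"
        using N0(2) q(2) Iq by (intro N0(1)) linarith
      ultimately show ?thesis by linarith
    qed
    have v: "real v \<le> 1.26 * J * ln J"
    proof -
      have "v \<le> nth_prime J"
        by (auto simp: kx J_def strict_mono_less_eq[OF strict_mono_nth_prime])
      moreover have "real (nth_prime J) \<le> 1.26 * J * ln J"
        using N0(2) q(2) Iq by (intro N0(1)) linarith
      ultimately show ?thesis by linarith
    qed
    have "real (x + 1) \<le> m\<^sup>2 / (q * J)"
      using Rle[of k] kx(2) by (simp add: J_def)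
    then have IJ: "real I * J \<le> m\<^sup>2" using q0 Iq by (simp add: I_def field_simps)
    have IJ1: "1 \<le> real I" "1 \<le> real J" using Iq q0 by linarith+
    have "real u * real v \<le> (1.26 * I * ln I) * (1.26 * J * ln J)"
      using u v IJ1 by (intro mult_mono) auto
    also have "\<dots> = 1.26\<^sup>2 * (I * ln I * (J * ln J))" by (simp add: power2_eq_square)
    also have "\<dots> \<le> 1.26\<^sup>2 * (m\<^sup>2 * (ln (m\<^sup>2))\<^sup>2 / 4)"
      using IJ IJ1 m by (intro mult_left_mono mult_ln_le_quarter_square) auto
    also have "\<dots> \<le> 1.26\<^sup>2 * (m\<^sup>2 * (ln n)\<^sup>2 / 4)"
      using m n by (intro mult_left_mono divide_right_mono power_mono ln_mono) auto
    also have "\<dots> = n"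
    proof -
      have "ln (real n) > 0" using n by simp
      then show ?thesis unfolding m_eq by (simp add: power_divide power_mult_distrib power2_eq_square field_simps)
    qed
    finally have "real (u * v) \<le> n" by simp
    then have "u * v \<le> n" by linarith
    moreover have "u \<le> v" using lg3[OF uv] by auto
    moreover have "real v \<le> n powr (2/3)"
    proof -
      have "k + 1 \<le> q * q" using kx(1) by (simp add: power2_eq_square)
      then have "real k + 1 \<le> real q * q" by (simp flip: of_nat_mult of_nat_Suc)
      moreover have "real q \<le> real q * q" using q4 by simp
      \<comment> \<open>J \<le> m + q + q^2, where q \<le> q^2 \<le> 12.75 * m, so J \<le> 26.5 *
        m.\<close>
      ultimately have J27: "real J \<le> 27 * m" using r2 q2b m by (simp add: J_def)
      have "1.26 * real J * ln J \<le> 1.26 * (27 * m) * ln (27 * m)"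
        using J27 IJ1 by (intro mult_mono ln_mono) auto
      then show ?thesis using v sm by linarith
    qed
    ultimately show ?thesis by simp
  qed
  have main: "T_prod n * 2 ^ card E \<le> S_count n"
  proof (rule S_count_ge[OF sid])
    show "E \<subseteq> {1..n}"
      using elem lg3 by (auto simp: E_def Suc_le_eq prime_gt_0_nat)
    show "\<not> p dvd x" if x: "x \<in> E" and p: "p \<in> big_primes n" for x p
    proof
      assume px: "p dvd x"
      obtain u v where uv: "(u, v) \<in> G" "x = u * v" using x by (auto simp: E_def)
      have "p dvd u \<or> p dvd v" using px p uv by (auto simp: big_primes_def prime_dvd_mult_iff)
      then have "p = u \<or> p = v" using lg3[OF uv(1)] p primes_dvd_imp_eq by (auto simp: big_primes_def)
      then show False using elem[OF uv(1)] p by (auto simp: big_primes_def)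
    qed
  qed
  \<comment> \<open>The loss of 14.8 * m has two sources: the rounding in \<open>R\<close> costs at
    most q^2 \<le> 12.75 * m, and having r * q + 1 instead of m as the start of the sum costs at
    most 2 * m.\<close>
  have "real (card E) \<ge> 120/169 * m powr (3/2) - 14.8 * m"
  proof -
    let ?c = "real r * real q + 1"
    have c0: "?c > 0" by (intro add_nonneg_pos mult_nonneg_nonneg) auto
    have "m\<^sup>2 / q * (\<Sum>k<q\<^sup>2. 1 / (?c + real k)) - q\<^sup>2 = (\<Sum>k<q\<^sup>2. m\<^sup>2 / (q * (r * q + k + 1)) - 1)"
      by (simp add: sum_subtractf sum_distrib_left algebra_simps)
    also have "\<dots> \<le> (\<Sum>k<q\<^sup>2. real (R k))"
    proof (rule sum_mono)
      fix k
      show "m\<^sup>2 / (q * (r * q + k + 1)) - 1 \<le> real (R k)"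
        unfolding R_def using real_of_int_floor_gt_diff_one[of "m\<^sup>2 / (q * (r * q + k + 1))"]
        by linarith
    qed
    also have "\<dots> = real (card E)" by (simp add: cE)
    finally have 1: "real (card E) \<ge> m\<^sup>2 / q * (\<Sum>k<q\<^sup>2. 1 / (?c + real k)) - q\<^sup>2" .
    have "ln (1 + t\<^sup>2) - (q + 1) / m \<le> ln ((?c + real (q\<^sup>2)) / ?c)"
    proof -
      have c1: "?c \<le> m + (q + 1)" using r2 by simp
      have "1 + t\<^sup>2 = (m + q\<^sup>2) / m" using q2 m by (simp add: field_simps power2_eq_square)
      then have "ln (1 + t\<^sup>2) = ln ((m + q\<^sup>2) / m)" by (rule arg_cong)
      also have "\<dots> = ln ((m + q\<^sup>2) / (m + (q + 1))) + ln (1 + (q + 1) / m)"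
      proof -
        have p: "m + (q + 1) > 0" "m + q\<^sup>2 > 0" using m by (auto intro: add_pos_nonneg)
        have "1 + (q + 1) / m = (m + (q + 1)) / m" using m by (simp add: field_simps)
        then have "(m + q\<^sup>2) / m = (m + q\<^sup>2) / (m + (q + 1)) * (1 + (q + 1) / m)"
          using p by simp
        moreover have "(m + q\<^sup>2) / (m + (q + 1)) > 0" "1 + (q + 1) / m > 0"
          using p m by (auto intro!: add_pos_nonneg)
        ultimately show ?thesis by (simp only: ln_mult_pos)
      qed
      also have "ln (1 + (q + 1) / m) \<le> (q + 1) / m"
        using m by (intro ln_add_one_self_le_self) auto
      also have "ln ((m + q\<^sup>2) / (m + (q + 1))) \<le> ln ((?c + real (q\<^sup>2)) / ?c)"
      proof (intro ln_mono)
        have "(m + q\<^sup>2) / (m + (q + 1)) \<le> (m + (q + 1) + q\<^sup>2) / (m + (q + 1))"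
          using m by (intro divide_right_mono) auto
        also have "\<dots> = 1 + q\<^sup>2 / (m + (q + 1))" using m by (simp add: field_simps)
        also have "\<dots> \<le> 1 + q\<^sup>2 / ?c" using c1 c0 by (intro add_left_mono divide_left_mono) (auto intro!: mult_pos_pos)
        also have "\<dots> = (?c + real (q\<^sup>2)) / ?c" using c0 by (simp add: field_simps)
        finally show "(m + q\<^sup>2) / (m + (q + 1)) \<le> (?c + real (q\<^sup>2)) / ?c" .
        show "0 < (m + q\<^sup>2) / (m + (q + 1))" using m q0 by (intro divide_pos_pos add_pos_nonneg) auto
      qed
      finally show ?thesis by simp
    qed
    also have "\<dots> \<le> (\<Sum>k<q\<^sup>2. 1 / (?c + real k))" by (rule sum_inverse_ge_ln[OF c0])
    finally have "120 / 169 * t - (q + 1) / m \<le> (\<Sum>k<q\<^sup>2. 1 / (?c + real k))"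
      using ln_one_plus_square_ge[OF t(1,2)] by linarith
    then have "m\<^sup>2 / q * (120 / 169 * t - (q + 1) / m) \<le> m\<^sup>2 / q * (\<Sum>k<q\<^sup>2. 1 / (?c + real k))"
      by (intro mult_left_mono) auto
    then have 2: "m\<^sup>2 / q * (120 / 169 * t - (q + 1) / m) - q\<^sup>2 \<le> real (card E)" using 1 by linarith
    have "m\<^sup>2 / q * (120 / 169 * t - (q + 1) / m) = 120/169 * (m\<^sup>2 * t / q) - m * ((q + 1) / q)"
      using m by (simp add: right_diff_distrib power2_eq_square)
    moreover have "m\<^sup>2 * t / q = m powr (3/2)"
    proof -
      have "m powr (3/2) = m powr (1 + 1/2)" by simp
      also have "\<dots> = m * sqrt m" using m by (simp only: powr_add) (simp add: powr_half_sqrt)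
      finally show ?thesis unfolding t_def using q0 sm0 m
        by (simp add: power2_eq_square field_simps)
    qed
    moreover have "m * ((q + 1) / q) \<le> m * 2"
      using m q4 by (intro mult_left_mono) (auto simp: field_simps)
    moreover have "real (q\<^sup>2) \<le> 12.75 * m" using q2b by (simp add: power2_eq_square)
    moreover have "120/169 * W - 14.8 * m \<le> c"
      if "X = 120/169 * W' - Y" "W' = W" "Y \<le> m * 2" "Z \<le> 12.75 * m" "X - Z \<le> c" for X Y Z W W' c :: real
      using that m by simp
    ultimately show ?thesis using 2 by blast
  qed
  then have "2 powr (120/169 * m powr (3/2) - 14.8 * m) \<le> 2 powr real (card E)"
    by (intro powr_mono) auto
  then have "real (T_prod n) * 2 powr (120/169 * m powr (3/2) - 14.8 * m) \<le> real (T_prod n) * 2 ^ card E"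
    by (intro mult_left_mono) (auto simp: powr_realpow)
  also have "\<dots> = real (T_prod n * 2 ^ card E)" by simp
  also have "\<dots> \<le> real (S_count n)" using main by (simp only: of_nat_le_iff)
  finally show ?thesis .
qed

theorem S_count_lower:
  "\<forall>\<^sub>F n in sequentially. real (T_prod n) * 2 powr (sqrt 2 * sidon_scale n) \<le> S_count n"
proof -
  define m where "m = (\<lambda>n::nat. 2 * sqrt n / (1.26 * ln n))"
  obtain N0 where N0: "\<And>j. j \<ge> N0 \<Longrightarrow> real (nth_prime j) \<le> 1.26 * j * ln j"
    using nth_prime_bound by (auto simp: eventually_sequentially)
  have lim: "filterlim (\<lambda>n. 1.19 * sqrt (m n)) at_top sequentially"
    unfolding m_def by real_asymp
  have e1: "\<forall>\<^sub>F n in sequentially. \<exists>q. prime q \<and> 1.19 * sqrt (m n) < real q \<and> real q \<le> 3 * (1.19 * sqrt (m n))"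
    using prime_in_interval lim by (rule eventually_compose_filterlim)
  have e2: "\<forall>\<^sub>F n in sequentially. real N0 \<le> 1.19 * sqrt (m n)"
    using lim unfolding filterlim_at_top by blast
  have e3: "\<forall>\<^sub>F n in sequentially. 4 \<le> 1.19 * sqrt (m n)"
    using lim unfolding filterlim_at_top by blast
  have e4: "\<forall>\<^sub>F n in sequentially. 1 \<le> m n" unfolding m_def by real_asymp
  have e5: "\<forall>\<^sub>F n in sequentially. (m n)\<^sup>2 \<le> real n" unfolding m_def by real_asymp
  have e6: "\<forall>\<^sub>F n in sequentially. 1.26 * (27 * m n) * ln (27 * m n) \<le> real n powr (2/3)"
    unfolding m_def by real_asymp
  have e7: "\<forall>\<^sub>F n in sequentially. n \<ge> 2" by (rule eventually_ge_at_top)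
  \<comment> \<open>The constants satisfy sqrt 2 < 1.4143, 1.419 < 120/169 * 1.999 with 1.999 < (2 /
    1.26)^(3/2), and 14.8 * 2 / 1.26 < 24.\<close>
  have e8: "\<forall>\<^sub>F n::nat in sequentially. 1.4143 * (sqrt n / ln n) powr (3/2) \<le> 1.419 * (sqrt n / ln n) powr (3/2) - 24 * (sqrt n / ln n)"
    by real_asymp
  show ?thesis using e1 e2 e3 e4 e5 e6 e7 e8
  proof eventually_elim
    case (elim n)
    define s where "s = sqrt n / ln n"
    have ln0: "ln (real n) > 0" using elim by simp
    have s0: "s > 0" using ln0 elim by (simp add: s_def)
    have ms: "m n = 2 / 1.26 * s" by (simp add: m_def s_def)
    have scale: "sidon_scale n = s powr (3/2)"
    proof -
      have "s powr (3/2) = (real n powr (1/2)) powr (3/2) / ln n powr (3/2)"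
        using ln0 unfolding s_def by (subst powr_divide) (auto simp: powr_half_sqrt)
      then show ?thesis by (simp add: sidon_scale_def powr_powr)
    qed
    obtain q where q: "prime q" "1.19 * sqrt (m n) < real q" "real q \<le> 3.57 * sqrt (m n)" using elim by auto
    have "real (T_prod n) * 2 powr (120/169 * m n powr (3/2) - 14.8 * m n) \<le> S_count n"
      by (rule S_count_ge_powr[where q = q and ?N0.0 = N0]) (use elim q N0 m_def in auto)
    moreover have "sqrt 2 * sidon_scale n \<le> 120/169 * m n powr (3/2) - 14.8 * m n"
    proof -
      have "(1.999::real) = sqrt (1.999\<^sup>2)" by simp
      also have "\<dots> \<le> sqrt ((2 / 1.26) ^ 3)" by (intro real_sqrt_le_mono) (simp add: power2_eq_square power3_eq_cube)
      also have "\<dots> = ((2 / 1.26) powr 3) powr (1/2)" by (simp add: powr_half_sqrt)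
      also have "\<dots> = (2 / 1.26) powr (3/2)" by (simp only: powr_powr) simp
      finally have "(1.999::real) * s powr (3/2) \<le> (2 / 1.26) powr (3/2) * s powr (3/2)"
        by (intro mult_right_mono) auto
      also have "\<dots> = m n powr (3/2)" unfolding ms using s0 by (subst powr_mult[symmetric]) auto
      finally have a: "1.999 * s powr (3/2) \<le> m n powr (3/2)" .
      have "sqrt 2 \<le> (1.4143::real)" by (rule real_le_lsqrt) (auto simp: power2_eq_square)
      then have "sqrt 2 * s powr (3/2) \<le> 1.4143 * s powr (3/2)" by (intro mult_right_mono) auto
      moreover have "1.4143 * s powr (3/2) \<le> 1.419 * s powr (3/2) - 24 * s"
        using elim by (simp add: s_def)
      moreover have "0 \<le> s powr (3/2)" by simp
      moreover have lin: "Q \<le> 120/169 * W - 14.8 * (2 / 1.26 * s)"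
        if "Q \<le> 1.4143 * P" "1.4143 * P \<le> 1.419 * P - 24 * s" "0 \<le> P" "1.999 * P \<le> W" "0 < s" for P Q W
        using that by simp
      ultimately show ?thesis
        using lin[of "sqrt 2 * s powr (3/2)" "s powr (3/2)" "m n powr (3/2)"] a s0 unfolding scale ms by blast
    qed
    then have "real (T_prod n) * 2 powr (sqrt 2 * sidon_scale n) \<le> real (T_prod n) * 2 powr (120/169 * m n powr (3/2) - 14.8 * m n)"
      by (intro mult_left_mono powr_mono) auto
    ultimately show ?case by linarith
  qed
qed

section \<open>Counting by covers\<close>

definition sidon_count :: "nat set \<Rightarrow> nat" where
  "sidon_count C = card {A. A \<subseteq> C \<and> mult_sidon A}"

lemma finite_sidon_subsets: "finite C \<Longrightarrow> finite {A. A \<subseteq> C \<and> mult_sidon A}"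
  by (rule finite_subset[of _ "Pow C"]) auto

lemma mult_sidon_subset: "mult_sidon A \<Longrightarrow> B \<subseteq> A \<Longrightarrow> mult_sidon B"
  unfolding mult_sidon_def by (meson subsetD)

lemma mult_sidonD:
  "mult_sidon A \<Longrightarrow> {a, b, c, d} \<subseteq> A \<Longrightarrow> distinct [a, b, c, d] \<Longrightarrow> a * b = c * d \<Longrightarrow> False"
  unfolding mult_sidon_def by (simp, metis)

lemma sidon_count_mono: "finite D \<Longrightarrow> C \<subseteq> D \<Longrightarrow> sidon_count C \<le> sidon_count D"
  unfolding sidon_count_def by (rule card_mono[OF finite_sidon_subsets]) auto

text \<open>A set is determined by its traces on C and D, and these are again Sidon.\<close>

lemma sidon_count_Un:
  assumes "finite C" "finite D"
  shows "sidon_count (C \<union> D) \<le> sidon_count C * sidon_count D"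
proof -
  let ?S = "\<lambda>C. {A. A \<subseteq> C \<and> mult_sidon A}"
  have "inj_on (\<lambda>A. (A \<inter> C, A \<inter> D)) (?S (C \<union> D))"
  proof (rule inj_onI, clarify)
    fix A B assume "A \<subseteq> C \<union> D" "B \<subseteq> C \<union> D" "A \<inter> C = B \<inter> C" "A \<inter> D = B \<inter> D"
    moreover have "X = X \<inter> C \<union> X \<inter> D" if "X \<subseteq> C \<union> D" for X using that by auto
    ultimately show "A = B" by metis
  qed
  then have "card (?S (C \<union> D)) = card ((\<lambda>A. (A \<inter> C, A \<inter> D)) ` ?S (C \<union> D))"
    by (simp add: card_image)
  also have "\<dots> \<le> card (?S C \<times> ?S D)"
    by (rule card_mono)
       (use assms finite_sidon_subsets in \<open>auto intro: mult_sidon_subset\<close>)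
  finally show ?thesis by (simp add: sidon_count_def card_cartesian_product)
qed

lemma sidon_count_UN:
  assumes "finite I" "\<And>i. i \<in> I \<Longrightarrow> finite (C i)"
  shows "sidon_count (\<Union>i\<in>I. C i) \<le> (\<Prod>i\<in>I. sidon_count (C i))"
  using assms
proof (induction I rule: finite_induct)
  case empty
  have "{A. A \<subseteq> {} \<and> mult_sidon A} = {{}}" by (auto simp: mult_sidon_def)
  then show ?case by (simp add: sidon_count_def)
next
  case (insert i I)
  have "sidon_count (\<Union>j\<in>insert i I. C j) \<le> sidon_count (C i) * sidon_count (\<Union>j\<in>I. C j)"
    using insert by (simp add: sidon_count_Un)
  also have "\<dots> \<le> sidon_count (C i) * (\<Prod>j\<in>I. sidon_count (C j))"
    using insert by (intro mult_left_mono) auto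
  finally show ?case using insert by simp
qed

section \<open>Sidon sets of products as C4-free graphs\<close>

text \<open>An element may factor in several ways; \<open>g\<close> fixes one of them, so that
  different edges carry different products. A four-cycle then yields four distinct elements with u *
  v * (u' * v') = u * v' * (u' * v).\<close>

lemma mult_sidon_graph:
  assumes A: "mult_sidon A" "A \<subseteq> {u * v |u v. u \<in> U \<and> v \<in> V}"
  obtains G where "G \<in> c4_graphs U V" "bij_betw (\<lambda>(u, v). u * v) G A"
proof -
  have "\<forall>x\<in>A. \<exists>e. e \<in> U \<times> V \<and> fst e * snd e = x" using A(2) by fastforce
  then obtain g where g: "\<And>x. x \<in> A \<Longrightarrow> g x \<in> U \<times> V \<and> fst (g x) * snd (g x) = x" by metis
  define G where "G = g ` A"
  have g2: "u * v \<in> A \<and> g (u * v) = (u, v)" if "(u, v) \<in> G" for u v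
    using that g unfolding G_def by (metis fst_conv snd_conv imageE)
  have "c4_free G"
    unfolding c4_free_def
  proof (intro allI impI, rule ccontr)
    fix u u' v v' assume e: "(u, v) \<in> G \<and> (u, v') \<in> G \<and> (u', v) \<in> G \<and> (u', v') \<in> G" and n: "\<not> (u = u' \<or> v = v')"
    have h: "u * v \<in> A \<and> g (u * v) = (u, v)" "u * v' \<in> A \<and> g (u * v') = (u, v')"
      "u' * v \<in> A \<and> g (u' * v) = (u', v)" "u' * v' \<in> A \<and> g (u' * v') = (u', v')"
      using e g2 by blast+
    have "u * v \<noteq> u' * v'" "u * v \<noteq> u * v'" "u * v \<noteq> u' * v" "u' * v' \<noteq> u * v'" "u' * v' \<noteq> u' * v" "u * v' \<noteq> u' * v"
      using h n by (metis prod.inject)+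
    then have "distinct [u * v, u' * v', u * v', u' * v]"
      unfolding distinct.simps list.set by blast
    moreover have "u * v * (u' * v') = u * v' * (u' * v)" by simp
    ultimately show False using mult_sidonD[OF A(1)] h by blast
  qed
  moreover have "G \<subseteq> U \<times> V" using g unfolding G_def by blast
  ultimately have "G \<in> c4_graphs U V" by (simp add: c4_graphs_def)
  moreover have "bij_betw (\<lambda>(u, v). u * v) G A"
  proof (rule bij_betwI[where g = g])
    show "g \<in> A \<rightarrow> G" by (auto simp: G_def)
    show "(case g x of (u, v) \<Rightarrow> u * v) = x" if "x \<in> A" for x using g[OF that] by (simp add: case_prod_beta)
  qed (use g2 in auto)
  ultimately show ?thesis using that by blast
qed

lemma sidon_count_products_le:
  assumes "finite U" "finite V"
  shows "sidon_count {u * v |u v. u \<in> U \<and> v \<in> V} \<le> card (c4_graphs U V)"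
proof -
  have "{A. A \<subseteq> {u * v |u v. u \<in> U \<and> v \<in> V} \<and> mult_sidon A} \<subseteq> (\<lambda>G. (\<lambda>(u, v). u * v) ` G) ` c4_graphs U V"
  proof
    fix A assume "A \<in> {A. A \<subseteq> {u * v |u v. u \<in> U \<and> v \<in> V} \<and> mult_sidon A}"
    then obtain G where "G \<in> c4_graphs U V" "bij_betw (\<lambda>(u, v). u * v) G A"
      using mult_sidon_graph[of A U V] by blast
    then show "A \<in> (\<lambda>G. (\<lambda>(u, v). u * v) ` G) ` c4_graphs U V" by (auto simp: bij_betw_def)
  qed
  then show ?thesis
    unfolding sidon_count_def by (rule surj_card_le[OF finite_c4_graphs[OF assms]])
qed

text \<open>The Kovari-Sos-Turan bound: an ordered pair of distinct left vertices has at most one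
  common neighbour, so the sum of d * (d - 1) is at most a^2, and Cauchy-Schwarz gives E^2 \<le> (E
  + a^2) * b.\<close>

lemma c4_free_card_le:
  fixes a b :: real
  assumes G: "c4_free G" "G \<subseteq> U \<times> V" and fin: "finite U" "finite V" and ab: "real (card U) \<le> a" "real (card V) \<le> b"
  shows "real (card G) \<le> a * sqrt b + b"
proof -
  have fG: "finite G" using G fin finite_subset by blast
  have a0: "0 \<le> a" and b0: "0 \<le> b" using ab of_nat_0_le_iff order_trans by blast+
  define d where "d = (\<lambda>v. card {u \<in> U. (u, v) \<in> G})"
  define E where "E = real (card G)"
  have "G = (\<Union>v\<in>V. (\<lambda>u. (u, v)) ` {u \<in> U. (u, v) \<in> G})" using G by auto
  then have "card G = (\<Sum>v\<in>V. card ((\<lambda>u. (u, v)) ` {u \<in> U. (u, v) \<in> G}))"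
    using fin by (subst card_UN_disjoint[symmetric]) auto
  also have "\<dots> = (\<Sum>v\<in>V. d v)"
    unfolding d_def by (intro sum.cong refl card_image) (auto simp: inj_on_def)
  finally have E: "E = (\<Sum>v\<in>V. real (d v))" by (simp add: E_def)
  define T where "T = (\<lambda>v. {(u, u'). u \<in> U \<and> u' \<in> U \<and> u \<noteq> u' \<and> (u, v) \<in> G \<and> (u', v) \<in> G})"
  have fT: "finite (T v)" for v
    by (rule finite_subset[of _ "U \<times> U"]) (use fin in \<open>auto simp: T_def\<close>)
  have sq: "(d v)\<^sup>2 = d v + card (T v)" for v
  proof -
    let ?N = "{u \<in> U. (u, v) \<in> G}"
    have "?N \<times> ?N = (\<lambda>u. (u, u)) ` ?N \<union> T v" by (auto simp: T_def)
    then have "card (?N \<times> ?N) = card ((\<lambda>u. (u, u)) ` ?N) + card (T v)"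
      using fin fT by (simp only:, intro card_Un_disjoint) (auto simp: T_def)
    also have "card ((\<lambda>u. (u, u)) ` ?N) = d v" unfolding d_def by (intro card_image) (auto simp: inj_on_def)
    finally show ?thesis by (simp add: d_def card_cartesian_product power2_eq_square)
  qed
  have "(\<Sum>v\<in>V. card (T v)) = card (\<Union>v\<in>V. T v)"
    using fin fT G(1) by (intro card_UN_disjoint[symmetric]) (auto simp: T_def dest: c4_freeD)
  also have "\<dots> \<le> card (U \<times> U)" using fin by (intro card_mono) (auto simp: T_def)
  finally have "real (\<Sum>v\<in>V. card (T v)) \<le> real (card U * card U)"
    by (simp only: of_nat_le_iff card_cartesian_product)
  also have "\<dots> \<le> a * a" using ab a0 by (simp add: mult_mono)
  finally have T: "(\<Sum>v\<in>V. real (card (T v))) \<le> a * a" by simp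
  have "E\<^sup>2 \<le> (\<Sum>v\<in>V. (real (d v))\<^sup>2) * card V"
    unfolding E by (rule sum_squared_le_sum_of_squares)
  also have "(\<Sum>v\<in>V. (real (d v))\<^sup>2) = (\<Sum>v\<in>V. real (d v) + real (card (T v)))"
    using sq by (intro sum.cong refl) (metis of_nat_add of_nat_power)
  also have "\<dots> \<le> E + a * a" using T by (simp add: sum.distrib E)
  also have "(E + a * a) * real (card V) \<le> (E + a * a) * b"
    using ab a0 by (intro mult_left_mono) (auto simp: E_def)
  finally have *: "E\<^sup>2 \<le> (E + a * a) * b" by (simp add: mult_right_mono)
  show ?thesis
  proof (rule ccontr)
    assume "\<not> ?thesis"
    then have gt: "E > a * sqrt b + b" by (simp add: E_def)
    have s: "sqrt b * sqrt b = b" using b0 by simp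
    \<comment> \<open>Both E - b and E exceed a * sqrt b, against E * (E - b) \<le> a^2 * b.\<close>
    have "(a * sqrt b) * (a * sqrt b) < (E - b) * E"
      using gt a0 b0 by (intro mult_strict_mono') (auto intro: add_increasing2)
    then show False using * s by (simp add: power2_eq_square algebra_simps)
  qed
qed

lemma card_small_subsets_upto_le:
  fixes e :: real and n :: nat
  assumes n: "n \<ge> 1" and C: "C \<subseteq> {1..n}"
  shows "real (card {A. A \<subseteq> C \<and> real (card A) \<le> e}) \<le> exp (e * ln n + 1)"
proof -
  have fC: "finite C" using C finite_subset by blast
  have cC: "card C \<le> n" using card_mono[OF _ C] by simp
  have "real (card {A. A \<subseteq> C \<and> real (card A) \<le> e}) \<le> (1 / real n) powr (- e) * exp (1 / n * n)"
    using n fC cC by (intro card_small_subsets_le) auto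
  also have "\<dots> = exp (e * ln n + 1)"
    using n by (simp add: powr_def ln_div exp_add)
  finally show ?thesis .
qed

text \<open>Each element costs ln n, so this is for classes whose Sidon sets are smaller than the
  target by a sufficient power of ln n.\<close>

lemma sidon_count_le_exp:
  fixes e :: real
  assumes n: "n \<ge> 1" and C: "C \<subseteq> {1..n}" and e: "\<And>A. A \<subseteq> C \<Longrightarrow> mult_sidon A \<Longrightarrow> real (card A) \<le> e"
  shows "real (sidon_count C) \<le> exp (e * ln n + 1)"
proof -
  have "finite C" using C finite_subset by blast
  then have "real (sidon_count C) \<le> real (card {A. A \<subseteq> C \<and> real (card A) \<le> e})"
    unfolding sidon_count_def using e by (intro of_nat_mono card_mono finite_subset[of _ "Pow C", OF _ finite_Pow_iff[THEN iffD2]]) auto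
  also have "\<dots> \<le> exp (e * ln n + 1)" by (rule card_small_subsets_upto_le[OF n C])
  finally show ?thesis .
qed

text \<open>A large prime \<open>p\<close> contributes its smallest multiple in \<open>A\<close>, which \<open>T_prod\<close> accounts for; the
  pairs (smallest cofactor, other cofactor) are different for different primes, so few elements remain.\<close>

lemma sidon_count_big_primes:
  assumes n: "n \<ge> 1"
  shows "real (sidon_count {x \<in> {1..n}. \<exists>p\<in>big_primes n. p dvd x}) \<le> T_prod n * exp (n powr (2/3) * ln n + 1)"
proof -
  let ?P = "big_primes n"
  let ?C = "{x \<in> {1..n}. \<exists>p\<in>?P. p dvd x}"
  let ?D = "PiE ?P (\<lambda>p. {0..n div p})"
  let ?S = "{A. A \<subseteq> {1..n} \<and> real (card A) \<le> n powr (2/3)}"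
  let ?M = "\<lambda>A p. {m. 0 < m \<and> p * m \<in> A}"
  \<comment> \<open>The value 0 codes the absence of multiples of p, and \<open>restrict\<close>
    puts \<open>f A\<close> into the dependent product that \<open>T_prod\<close> counts.\<close>
  define f where "f = (\<lambda>A. restrict (\<lambda>p. if ?M A p = {} then 0 else LEAST m. m \<in> ?M A p) ?P)"
  \<comment> \<open>A prime without multiples in A contributes the product 0 here, which lies in
    none of the sets considered.\<close>
  define X where "X = (\<lambda>A. A - {p * f A p |p. p \<in> ?P})"
  have p0: "p > 0" if "p \<in> ?P" for p using that by (simp add: big_primes_def prime_gt_0_nat)
  have fM: "0 < f A p \<and> p * f A p \<in> A \<and> f A p \<le> m" if "p \<in> ?P" "0 < m" "p * m \<in> A" for A p m
  proof -
    have "m \<in> ?M A p" using that by simp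
    then have ne: "?M A p \<noteq> {}" by blast
    have "f A p = (if ?M A p = {} then 0 else LEAST m. m \<in> ?M A p)"
      unfolding f_def using that(1) by (simp only: restrict_apply')
    then have f: "f A p = (LEAST m. m \<in> ?M A p)" by (rule trans[OF _ if_not_P[OF ne]])
    show ?thesis unfolding f
      using LeastI[of "\<lambda>m. m \<in> ?M A p" m] Least_le[of "\<lambda>m. m \<in> ?M A p" m] \<open>m \<in> ?M A p\<close> by simp
  qed
  have f0: "f A p = 0 \<or> p * f A p \<in> A" if "p \<in> ?P" for A p
  proof (cases "?M A p = {}")
    case True
    then show ?thesis using that by (simp add: f_def)
  next
    case False
    then show ?thesis using fM[OF that] by blast
  qed
  \<comment> \<open>As p > n^(2/3), cofactors are at most n^(1/3), which leaves at most n^(2/3)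
    pairs of cofactors.\<close>
  have cof: "real m \<le> n powr (1/3)" if "p \<in> ?P" "p * m \<le> n" for p m
  proof -
    have "real m * n powr (2/3) \<le> real m * real p"
      using that by (intro mult_left_mono) (auto simp: big_primes_def)
    also have "\<dots> \<le> n" using that(2) by (metis mult.commute of_nat_le_iff of_nat_mult)
    also have "real n = n powr (1/3 + 2/3)" using n by simp
    also have "\<dots> = n powr (1/3) * n powr (2/3)" by (rule powr_add)
    finally show ?thesis using n by simp
  qed
  have XS: "X A \<in> ?S" if A: "A \<subseteq> ?C" "mult_sidon A" for A
  proof -
    have An: "A \<subseteq> {1..n}" using A by auto
    have fA: "finite (X A)" using An finite_subset[of A "{1..n}"] by (auto simp: X_def)
    have "\<forall>x\<in>X A. \<exists>p. p \<in> ?P \<and> p dvd x" using A by (auto simp: X_def)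
    then obtain P where P: "\<And>x. x \<in> X A \<Longrightarrow> P x \<in> ?P \<and> P x dvd x" by metis
    define c where "c = (\<lambda>x. x div P x)"
    have xc: "x = P x * c x" "0 < c x" "x \<in> A" "c x \<noteq> f A (P x)" "0 < f A (P x)" "P x * f A (P x) \<in> A" if x: "x \<in> X A" for x
    proof -
      show 1: "x = P x * c x" using P[OF x] by (simp add: c_def)
      show 2: "x \<in> A" using x by (simp add: X_def)
      then have "0 < x" using An by auto
      then show 3: "0 < c x" using 1 by (metis gr0I mult_0_right)
      show "c x \<noteq> f A (P x)" using x 1 P[OF x] unfolding X_def by auto
      show "0 < f A (P x)" "P x * f A (P x) \<in> A" using fM[of "P x" "c x" A] P[OF x] 1 2 3 by auto
    qed
    have le: "x \<le> n" if "x \<in> A" for x using An that by auto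
    \<comment> \<open>If x = p * m and y = q * m belong to primes with the same smallest cofactor k,
      then p * m * (q * k) = q * m * (p * k) is a forbidden equation in A.\<close>
    have inj: "inj_on (\<lambda>x. (f A (P x), c x)) (X A)"
    proof (rule inj_onI, rule ccontr)
      fix x y assume x: "x \<in> X A" and y: "y \<in> X A" and e: "(f A (P x), c x) = (f A (P y), c y)" and ne: "x \<noteq> y"
      have pq: "P x \<noteq> P y" using xc(1)[OF x] xc(1)[OF y] e ne by (metis prod.inject)
      let ?m = "c x" and ?k = "f A (P x)"
      have xe: "x = P x * ?m" "y = P y * ?m" using xc(1)[OF x] xc(1)[OF y] e by auto
      have A4: "{P x * ?m, P y * ?k, P y * ?m, P x * ?k} \<subseteq> A"
        using xc[OF x] xc[OF y] e by auto
      have cross: "P x * i \<noteq> P y * j" if "P y * j \<in> A" "0 < j" for i j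
      proof
        assume eq: "P x * i = P y * j"
        have "P x dvd P y * j" using eq by (metis dvd_triv_left)
        moreover have "0 < P y * j" using that(1) An by auto
        ultimately have "P x = P y"
          using P[OF x] P[OF y] le[OF that(1)] by (intro big_primes_dvd_unique[of "P x" n "P y" "P y * j"]) auto
        then show False using pq by simp
      qed
      have px: "P x > 0" "P y > 0" using P[OF x] P[OF y] p0 by auto
      have "distinct [P x * ?m, P y * ?k, P y * ?m, P x * ?k]"
        using A4 xc(2,4,5)[OF x] px cross[of ?k ?m] cross[of ?m ?m] cross[of ?m ?k] cross[of ?k ?k] by auto
      moreover have "P x * ?m * (P y * ?k) = P y * ?m * (P x * ?k)" by simp
      ultimately show False using mult_sidonD[OF A(2) A4] by blast
    qed
    define N where "N = nat \<lfloor>n powr (1/3)\<rfloor>"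
    have "(\<lambda>x. (f A (P x), c x)) ` X A \<subseteq> {1..N} \<times> {1..N}"
    proof (rule image_subsetI)
      fix x assume x: "x \<in> X A"
      have "real (c x) \<le> n powr (1/3)" "real (f A (P x)) \<le> n powr (1/3)"
        using cof[of "P x" "c x"] cof[of "P x" "f A (P x)"] P[OF x] xc[OF x] le by auto
      then show "(f A (P x), c x) \<in> {1..N} \<times> {1..N}"
        using xc[OF x] by (simp add: N_def le_nat_floor Suc_le_eq)
    qed
    then have "card (X A) \<le> N * N"
      using card_mono[of "{1..N} \<times> {1..N}" "(\<lambda>x. (f A (P x), c x)) ` X A"] inj
      by (simp add: card_image card_cartesian_product)
    then have "real (card (X A)) \<le> real (N * N)" by (simp only: of_nat_le_iff)
    also have "\<dots> \<le> n powr (1/3) * n powr (1/3)"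
      unfolding of_nat_mult N_def by (intro mult_mono of_nat_floor) auto
    also have "\<dots> = n powr (2/3)" by (simp flip: powr_add)
    finally show ?thesis using An by (auto simp: X_def)
  qed
  have fD: "f A \<in> ?D" if A: "A \<subseteq> ?C" for A
  proof (rule PiE_I)
    fix p assume p: "p \<in> ?P"
    show "f A p \<in> {0..n div p}"
    proof (cases "f A p = 0")
      case False
      then have "p * f A p \<le> n" using f0[OF p, of A] A by auto
      then show ?thesis using p0[OF p] by (simp add: less_eq_div_iff_mult_less_eq mult.commute)
    qed simp
  qed (simp add: f_def)
  have rec: "A = {p * f A p |p. p \<in> ?P \<and> 0 < f A p} \<union> X A" if "A \<subseteq> ?C" for A
  proof
    show "A \<subseteq> {p * f A p |p. p \<in> ?P \<and> 0 < f A p} \<union> X A"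
    proof
      fix x assume x: "x \<in> A"
      then have "0 < x" using that by auto
      then show "x \<in> {p * f A p |p. p \<in> ?P \<and> 0 < f A p} \<union> X A"
        using x unfolding X_def by (cases "\<exists>p. p \<in> ?P \<and> x = p * f A p") auto
    qed
    show "{p * f A p |p. p \<in> ?P \<and> 0 < f A p} \<union> X A \<subseteq> A"
      using f0 by (force simp: X_def)
  qed
  have inj: "inj_on (\<lambda>A. (f A, X A)) {A. A \<subseteq> ?C \<and> mult_sidon A}"
  proof (rule inj_onI)
    fix A B assume A: "A \<in> {A. A \<subseteq> ?C \<and> mult_sidon A}" and B: "B \<in> {A. A \<subseteq> ?C \<and> mult_sidon A}"
      and eq: "(f A, X A) = (f B, X B)"
    have "A = {p * f A p |p. p \<in> ?P \<and> 0 < f A p} \<union> X A" using A by (intro rec) blast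
    also have "\<dots> = {p * f B p |p. p \<in> ?P \<and> 0 < f B p} \<union> X B" using eq by simp
    also have "\<dots> = B" using B by (intro rec[symmetric]) blast
    finally show "A = B" .
  qed
  have fS: "finite ?S" by (rule finite_subset[of _ "Pow {1..n}"]) auto
  have "sidon_count ?C = card ((\<lambda>A. (f A, X A)) ` {A. A \<subseteq> ?C \<and> mult_sidon A})"
    unfolding sidon_count_def using inj by (simp add: card_image)
  also have "\<dots> \<le> card (?D \<times> ?S)"
  proof (rule card_mono)
    show "finite (?D \<times> ?S)" by (intro finite_cartesian_product finite_PiE fS) auto
    show "(\<lambda>A. (f A, X A)) ` {A. A \<subseteq> ?C \<and> mult_sidon A} \<subseteq> ?D \<times> ?S"
    proof (rule image_subsetI)
      fix A assume "A \<in> {A. A \<subseteq> ?C \<and> mult_sidon A}"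
      then have "f A \<in> ?D" "X A \<in> ?S" using fD XS by blast+
      then show "(f A, X A) \<in> ?D \<times> ?S" by blast
    qed
  qed
  also have "\<dots> = T_prod n * card ?S"
    by (simp add: card_cartesian_product card_PiE T_prod_def big_primes_def[symmetric])
  finally have "real (sidon_count ?C) \<le> real (T_prod n * card ?S)" by (simp only: of_nat_le_iff)
  also have "\<dots> = T_prod n * real (card ?S)" by simp
  also have "\<dots> \<le> T_prod n * exp (n powr (2/3) * ln n + 1)"
    using card_small_subsets_upto_le[OF n order_refl] by (intro mult_left_mono) auto
  finally show ?thesis .
qed

section \<open>Rough numbers\<close>

definition rough :: "real \<Rightarrow> nat \<Rightarrow> bool" where
  "rough z w \<longleftrightarrow> 1 < w \<and> (\<forall>p. prime p \<longrightarrow> p dvd w \<longrightarrow> z < real p)"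

fun rough_products :: "real \<Rightarrow> nat \<Rightarrow> nat set" where
  "rough_products z 0 = {1}"
| "rough_products z (Suc k) = {p * w |p w. prime p \<and> z < real p \<and> w \<in> rough_products z k}"

text \<open>Prime factors are split off one by one; z^k \<le> w later limits their number.\<close>

lemma rough_in_products:
  assumes "1 \<le> z" "0 < w" "\<And>p. prime p \<Longrightarrow> p dvd w \<Longrightarrow> z < real p"
  shows "\<exists>k. w \<in> rough_products z k \<and> z ^ k \<le> real w"
  using assms(2,3)
proof (induction w rule: less_induct)
  case (less w)
  show ?case
  proof (cases "w = 1")
    case True
    then show ?thesis by (intro exI[of _ 0]) simp
  next
    case False
    then obtain p where p: "prime p" "p dvd w" using prime_factor_nat by blast
    then obtain v where v: "w = p * v" by (auto elim: dvdE)
    have "v < w" "0 < v" using v p less.prems(1) prime_gt_1_nat[of p] by auto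
    then obtain k where k: "v \<in> rough_products z k" "z ^ k \<le> real v"
      using less.IH[of v] less.prems(2) v by auto
    have zp: "z < real p" using less.prems(2) p by blast
    then have "w \<in> rough_products z (Suc k)" using k p v by auto
    moreover have "z * z ^ k \<le> real p * real v" using zp k assms(1) by (intro mult_mono) auto
    ultimately show ?thesis using v by (intro exI[of _ "Suc k"]) simp
  qed
qed

text \<open>Splitting off a prime p reduces x to x / p, and the sum of 1 / p over n^(1/7) < p \<le>
  n is at most 14. The denominator can be ln n instead of ln x because for k = 0 the set is empty
  unless x > n^(1/7); this uniformity in x carries the induction.\<close>

lemma card_rough_products_le:
  fixes x :: real and n :: nat
  assumes n: "n \<ge> 2" and x: "0 \<le> x" "x \<le> n"
  shows "real (card {w \<in> rough_products (n powr (1/7)) (Suc k). real w \<le> x}) \<le> 14 ^ k * (7 * chebyshev_const) * x / ln n"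
  using x
proof (induction k arbitrary: x)
  case 0
  let ?z = "real n powr (1/7)"
  have ln0: "ln (real n) > 0" using n by simp
  show ?case
  proof (cases "x \<le> ?z")
    case True
    then have e: "{w \<in> rough_products ?z (Suc 0). real w \<le> x} = {}" by auto
    show ?thesis unfolding e using 0 ln0 chebyshev_const_pos by simp
  next
    case False
    have z1: "1 < ?z" using n by simp
    then have x1: "1 < x" using False by linarith
    have "{w \<in> rough_products ?z (Suc 0). real w \<le> x} \<subseteq> primes_le x" by (auto simp: primes_le_def)
    then have "real (card {w \<in> rough_products ?z (Suc 0). real w \<le> x}) \<le> real (prime_pi x)"
      unfolding prime_pi_def by (intro of_nat_mono card_mono) auto
    also have "\<dots> \<le> chebyshev_const * x / ln x" by (rule prime_pi_upper[OF x1])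
    also have "\<dots> \<le> chebyshev_const * x / (ln n / 7)"
    proof (rule divide_left_mono)
      have "ln n / 7 = ln ?z" using n by (simp add: ln_powr)
      also have "\<dots> \<le> ln x" using False z1 by (intro ln_mono) linarith+
      finally show "ln n / 7 \<le> ln x" .
    qed (use chebyshev_const_pos x1 ln0 in auto)
    finally show ?thesis by (simp add: field_simps)
  qed
next
  case (Suc k)
  let ?z = "real n powr (1/7)"
  let ?P = "{p. prime p \<and> ?z < real p \<and> p \<le> n}"
  let ?R = "\<lambda>k x. {w \<in> rough_products ?z k. real w \<le> x}"
  have ln0: "ln (real n) > 0" using n by simp
  have fR: "finite (?R j y)" for j y by (rule finite_subset[OF _ finite_nat_le_real[of y]]) auto
  have pos: "0 < w" if "w \<in> rough_products ?z j" for w j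
    using that by (induction j arbitrary: w) (auto simp: prime_gt_0_nat)
  have "?R (Suc (Suc k)) x \<subseteq> (\<Union>p\<in>?P. (\<lambda>w. p * w) ` ?R (Suc k) (x / p))"
  proof
    fix w assume w: "w \<in> ?R (Suc (Suc k)) x"
    then obtain p v where pv: "w = p * v" "prime p" "?z < real p" "v \<in> rough_products ?z (Suc k)"
      unfolding rough_products.simps(2)[of _ "Suc k"] by blast
    have "v > 0" by (rule pos[OF pv(4)])
    moreover have "p > 0" using pv prime_gt_0_nat by blast
    moreover have wx: "real p * real v \<le> x" using w pv by simp
    ultimately have vx: "real v \<le> x / p" by (simp add: field_simps)
    have "real p * 1 \<le> real p * real v" using \<open>v > 0\<close> by (intro mult_left_mono) auto
    then have "p \<le> n" using wx Suc.prems by linarith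
    then show "w \<in> (\<Union>p\<in>?P. (\<lambda>w. p * w) ` ?R (Suc k) (x / p))" using pv vx by blast
  qed
  then have "card (?R (Suc (Suc k)) x) \<le> card (\<Union>p\<in>?P. (\<lambda>w. p * w) ` ?R (Suc k) (x / p))"
    using fR by (intro card_mono finite_UN_I) auto
  also have "\<dots> \<le> (\<Sum>p\<in>?P. card ((\<lambda>w. p * w) ` ?R (Suc k) (x / p)))"
    by (intro card_UN_le) auto
  also have "\<dots> \<le> (\<Sum>p\<in>?P. card (?R (Suc k) (x / p)))"
    by (intro sum_mono card_image_le fR)
  finally have "real (card (?R (Suc (Suc k)) x)) \<le> (\<Sum>p\<in>?P. real (card (?R (Suc k) (x / p))))"
    by (simp only: of_nat_le_iff of_nat_sum[symmetric])
  also have "\<dots> \<le> (\<Sum>p\<in>?P. 14 ^ k * (7 * chebyshev_const) * x / ln n * (1 / real p))"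
  proof (rule sum_mono)
    fix p assume p: "p \<in> ?P"
    then have p1: "1 \<le> real p" using prime_gt_0_nat[of p] by auto
    have "x / p \<le> x / 1" using Suc.prems p1 by (intro divide_left_mono) auto
    then have "x / p \<le> x" by simp
    then have "real (card (?R (Suc k) (x / p))) \<le> 14 ^ k * (7 * chebyshev_const) * (x / p) / ln n"
      using Suc.prems p1 by (intro Suc.IH) auto
    then show "real (card (?R (Suc k) (x / p))) \<le> 14 ^ k * (7 * chebyshev_const) * x / ln n * (1 / real p)" by (simp add: mult_ac)
  qed
  also have "\<dots> = 14 ^ k * (7 * chebyshev_const) * x / ln n * (\<Sum>p\<in>?P. 1 / real p)"
    by (rule sum_distrib_left[symmetric])
  also have "\<dots> \<le> 14 ^ k * (7 * chebyshev_const) * x / ln n * 14"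
    using sum_inverse_primes_le[OF n] Suc.prems ln0 chebyshev_const_pos by (intro mult_left_mono) auto
  finally show ?case by (simp add: mult_ac)
qed

definition rough_const :: real where "rough_const = (\<Sum>k<7. 14 ^ k * (7 * chebyshev_const))"

lemma rough_const_ge_1: "1 \<le> rough_const"
proof -
  have "14 ^ 0 * (7 * chebyshev_const) \<le> rough_const"
    unfolding rough_const_def using chebyshev_const_pos by (intro member_le_sum) auto
  moreover have "chebyshev_const \<ge> 2" by (simp add: chebyshev_const_def)
  ultimately show ?thesis by simp
qed

text \<open>This plays the role of a sieve bound. A rough number up to n has at most seven prime
  factors, since (n^(1/7))^7 = n.\<close>

lemma card_rough_le:
  fixes x :: real and n :: nat
  assumes n: "n \<ge> 2" and x: "0 \<le> x" "x \<le> n"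
  shows "real (card {w. rough (n powr (1/7)) w \<and> real w \<le> x}) \<le> rough_const * x / ln n"
proof -
  let ?z = "real n powr (1/7)"
  let ?R = "\<lambda>k x. {w \<in> rough_products ?z k. real w \<le> x}"
  have fR: "finite (?R j y)" for j y by (rule finite_subset[OF _ finite_nat_le_real[of y]]) auto
  have z1: "1 < ?z" using n by simp
  have z7: "?z ^ 7 = n" using n by (simp flip: powr_realpow add: powr_powr)
  have "{w. rough ?z w \<and> real w \<le> x} \<subseteq> (\<Union>k<7. ?R (Suc k) x)"
  proof
    fix w assume w: "w \<in> {w. rough ?z w \<and> real w \<le> x}"
    then obtain k where k: "w \<in> rough_products ?z k" "?z ^ k \<le> real w"
      using rough_in_products[of ?z w] z1 by (auto simp: rough_def)
    have "?z ^ k \<le> ?z ^ 7" using k(2) w x z7 by simp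
    then have "k \<le> 7" using z1 by (rule power_le_imp_le_exp[rotated])
    moreover have "k \<noteq> 0"
    proof
      assume "k = 0"
      then have "w = 1" using k(1) by simp
      then show False using w by (simp add: rough_def)
    qed
    ultimately show "w \<in> (\<Union>k<7. ?R (Suc k) x)"
      using k w by (intro UN_I[of "k - 1"]) auto
  qed
  then have "card {w. rough ?z w \<and> real w \<le> x} \<le> card (\<Union>k<7. ?R (Suc k) x)"
    using fR by (intro card_mono finite_UN_I) auto
  also have "\<dots> \<le> (\<Sum>k<7. card (?R (Suc k) x))" by (intro card_UN_le) auto
  finally have "real (card {w. rough ?z w \<and> real w \<le> x}) \<le> (\<Sum>k<7. real (card (?R (Suc k) x)))"
    by (simp only: of_nat_le_iff of_nat_sum[symmetric])
  also have "\<dots> \<le> (\<Sum>k<7. 14 ^ k * (7 * chebyshev_const) * x / ln n)"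
    using card_rough_products_le[OF n x] by (intro sum_mono) auto
  also have "\<dots> = rough_const * x / ln n"
    by (simp add: rough_const_def sum_distrib_right sum_divide_distrib)
  finally show ?thesis .
qed

lemma sum_inverse_le_ln:
  assumes "N \<ge> 1"
  shows "(\<Sum>r=1..N. 1 / real r) \<le> 1 + ln (real N)"
  using assms
proof (induction N rule: dec_induct)
  case (step N)
  have "ln (real N / real (Suc N)) \<le> real N / real (Suc N) - 1"
    using step by (intro ln_le_minus_one) auto
  also have "\<dots> = - (1 / real (Suc N))" by (simp add: field_simps)
  finally have "1 / real (Suc N) \<le> ln (Suc N) - ln N"
    using step by (simp add: ln_div)
  then show ?case using step by simp
qed simp

text \<open>Summing \<open>card_rough_le\<close> over x / r costs only a harmonic sum, hence a
  logarithm of N and not of n.\<close>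

lemma card_rough_multiples_le:
  fixes x :: real and n N :: nat
  assumes n: "n \<ge> 2" and x: "0 \<le> x" "x \<le> n" and N: "N \<ge> 1"
  shows "real (card {w * r |w r. rough (n powr (1/7)) w \<and> r \<in> {1..N} \<and> real (w * r) \<le> x}) \<le> rough_const * x / ln n * (1 + ln N)"
proof -
  let ?R = "\<lambda>x. {w. rough (n powr (1/7)) w \<and> real w \<le> x}"
  have ln0: "ln (real n) > 0" using n by simp
  have fR: "finite (?R y)" for y by (rule finite_subset[OF _ finite_nat_le_real[of y]]) auto
  have "{w * r |w r. rough (n powr (1/7)) w \<and> r \<in> {1..N} \<and> real (w * r) \<le> x} \<subseteq> (\<Union>r\<in>{1..N}. (\<lambda>w. w * r) ` ?R (x / r))"
    by (auto simp: field_simps)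
  then have "card {w * r |w r. rough (n powr (1/7)) w \<and> r \<in> {1..N} \<and> real (w * r) \<le> x} \<le> card (\<Union>r\<in>{1..N}. (\<lambda>w. w * r) ` ?R (x / r))"
    using fR by (intro card_mono finite_UN_I) auto
  also have "\<dots> \<le> (\<Sum>r\<in>{1..N}. card ((\<lambda>w. w * r) ` ?R (x / r)))"
    by (intro card_UN_le) auto
  also have "\<dots> \<le> (\<Sum>r\<in>{1..N}. card (?R (x / r)))"
    by (intro sum_mono card_image_le fR)
  finally have "real (card {w * r |w r. rough (n powr (1/7)) w \<and> r \<in> {1..N} \<and> real (w * r) \<le> x}) \<le> (\<Sum>r\<in>{1..N}. real (card (?R (x / r))))"
    by (simp only: of_nat_le_iff of_nat_sum[symmetric])
  also have "\<dots> \<le> (\<Sum>r\<in>{1..N}. rough_const * x / ln n * (1 / real r))"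
  proof (rule sum_mono)
    fix r assume r: "r \<in> {1..N}"
    then have "x / r \<le> x / 1" using x by (intro divide_left_mono) auto
    then have "x / r \<le> x" by simp
    then have "real (card (?R (x / r))) \<le> rough_const * (x / r) / ln n"
      using x r by (intro card_rough_le n) auto
    then show "real (card (?R (x / r))) \<le> rough_const * x / ln n * (1 / real r)" by (simp add: mult.commute)
  qed
  also have "\<dots> = rough_const * x / ln n * (\<Sum>r\<in>{1..N}. 1 / real r)"
    by (rule sum_distrib_left[symmetric])
  also have "\<dots> \<le> rough_const * x / ln n * (1 + ln N)"
    using sum_inverse_le_ln[OF N] x ln0 rough_const_ge_1 by (intro mult_left_mono) auto
  finally show ?thesis .
qed

text \<open>Least prime factors are stripped from m for as long as the quotient stays above y. The
  last divisor D exceeds y by at most a factor p, its own least prime factor.\<close>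

lemma exists_greedy_divisor:
  fixes y :: real
  assumes "1 \<le> y" "y < real m"
  shows "\<exists>D p. D dvd m \<and> y < real D \<and> prime p \<and> p dvd D \<and> real (D div p) \<le> y \<and> (\<forall>q. prime q \<longrightarrow> q dvd D \<longrightarrow> p \<le> q)"
  using assms(2)
proof (induction m rule: less_induct)
  case (less m)
  have m1: "m > 1" using less.prems assms by linarith
  define p where "p = (LEAST p. prime p \<and> p dvd m)"
  have "\<exists>p. prime p \<and> p dvd m" using m1 prime_factor_nat[of m] by auto
  then have p: "prime p" "p dvd m" and pmin: "\<And>q. prime q \<Longrightarrow> q dvd m \<Longrightarrow> p \<le> q"
    unfolding p_def using LeastI_ex[of "\<lambda>p. prime p \<and> p dvd m"] by (auto intro: Least_le)
  show ?case
  proof (cases "real (m div p) \<le> y")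
    case True
    then show ?thesis using p pmin less.prems by (intro exI[of _ m] exI[of _ p]) auto
  next
    case False
    have "m div p < m" using m1 p prime_gt_1_nat by auto
    moreover have "m div p dvd m" using p by (metis dvd_mult_div_cancel dvd_triv_right)
    ultimately show ?thesis using less.IH[of "m div p"] False by (meson dvd_trans not_le)
  qed
qed

section \<open>The upper bound\<close>

text \<open>In the application y = n^(2/3), c = n^(1/3), and s is slightly below sqrt n; by
  \<open>nb\<close> the cofactor of any divisor up to y exceeds s. Stripping m at level y gives m =
  X * M with X \<le> y, hence M > s. Then p > z, because D = p * X exceeds y while X \<le> n / s.
  Also M \<le> y, so X > s. Stripping M at level c gives a divisor w > s whose least prime factor is
  at least w / c > s / c \<ge> z. The smaller of X and w becomes u.\<close>

lemma rough_decomposition: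
  fixes s y c z :: real and n m :: nat
  assumes n: "n \<ge> 1" and pos: "1 \<le> s" "c \<le> s" "1 \<le> c" "c * c = y" "c * y = n" and z: "z * n \<le> y * s"
    and m: "1 \<le> m" "m \<le> n" "\<And>p. prime p \<Longrightarrow> p dvd m \<Longrightarrow> real p \<le> y"
    and nb: "\<And>u v. m = u * v \<Longrightarrow> real v \<le> y \<Longrightarrow> s < real u"
  shows "\<exists>u w r. m = u * (w * r) \<and> rough z u \<and> rough z w \<and> u \<le> w \<and> s < real u"
proof -
  have y1: "1 \<le> y" using pos mult_mono[of 1 c 1 c] by simp
  have "y < real m"
  proof (rule ccontr)
    assume "\<not> y < real m"
    then have "s < real 1" using nb[of 1 m] by simp
    then show False using pos by simp
  qed
  then obtain D p where D: "D dvd m" "y < real D" "prime p" "p dvd D" "real (D div p) \<le> y" "\<And>q. prime q \<Longrightarrow> q dvd D \<Longrightarrow> p \<le> q"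
    using exists_greedy_divisor[OF y1] by blast
  define X where "X = D div p"
  have DX: "D = p * X" using D by (simp add: X_def)
  obtain k where k: "m = D * k" using D by (auto elim: dvdE)
  define M where "M = p * k"
  have mXM: "m = X * M" "m = M * X" by (simp_all add: k DX M_def)
  have p0: "p > 0" using D by (simp add: prime_gt_0_nat)
  have X0: "X > 0" "k > 0" "M > 0" using m(1) mXM k by (auto intro: gr0I)
  have Xy: "real X \<le> y" using D by (simp add: X_def)
  have Ms: "s < real M" using nb[OF mXM(2) Xy] .
  have mn: "real X * real M \<le> n" using m(2) mXM(1) by (metis of_nat_le_iff of_nat_mult)
  have Xs: "real X * s \<le> n"
    using mult_left_mono[of s "real M" "real X"] Ms mn by simp
  have zp: "z < real p"
  proof -
    have "z * n \<le> y * s" by (rule z)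
    also have "\<dots> < real D * s" using D pos by (intro mult_strict_right_mono) auto
    also have "\<dots> = real p * (real X * s)" by (simp add: DX)
    also have "\<dots> \<le> real p * n" using Xs by (intro mult_left_mono) auto
    finally show ?thesis using n by simp
  qed
  have "p dvd m" using D by (meson dvd_trans)
  then have py: "real p \<le> y" using m(3) D by blast
  have X1: "1 < X"
  proof (rule ccontr)
    assume "\<not> 1 < X"
    then have "X = 1" using X0 by simp
    then show False using DX py D by simp
  qed
  have Xq: "p \<le> q" if "prime q" "q dvd X" for q using that D(6) DX by (metis dvd_mult)
  have roughX: "rough z X" unfolding rough_def using X1 Xq zp by (metis of_nat_mono order_less_le_trans)
  have pX: "p \<le> X"
  proof -
    obtain q where "prime q" "q dvd X" using X1 prime_factor_nat[of X] by auto
    then show ?thesis using Xq X0 dvd_imp_le by (meson order_trans)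
  qed
  have kc: "real k < c"
  proof -
    have "real k * y < real k * real D" using D X0 by (intro mult_strict_left_mono) auto
    also have "\<dots> = real m" by (simp add: k)
    also have "\<dots> \<le> c * y" using m pos by simp
    finally show ?thesis using y1 by simp
  qed
  \<comment> \<open>If p \<le> c, use M = p * k and k < c; otherwise X \<ge> p > c and X * M \<le> n
    = c * y.\<close>
  have My: "real M \<le> y"
  proof (cases "real p \<le> c")
    case True
    have "real M = real p * real k" by (simp add: M_def)
    also have "\<dots> \<le> c * c" using True kc by (intro mult_mono) auto
    finally show ?thesis using pos by simp
  next
    case False
    have "c * real M \<le> real X * real M" using False pX by (intro mult_right_mono) auto
    also have "\<dots> \<le> c * y" using mn pos by simp
    finally show ?thesis by (rule mult_left_le_imp_le) (use pos in linarith)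
  qed
  have sX: "s < real X" using nb[OF mXM(1) My] .
  have "c < real M" using Ms pos by simp
  then obtain w p' where w: "w dvd M" "c < real w" "prime p'" "p' dvd w" "real (w div p') \<le> c" "\<And>q. prime q \<Longrightarrow> q dvd w \<Longrightarrow> p' \<le> q"
    using exists_greedy_divisor[OF pos(3)] by blast
  obtain r where r: "M = w * r" using w by (auto elim: dvdE)
  have sw: "s < real w"
  proof (rule nb)
    show "m = w * (X * r)" by (simp add: mXM r)
    have "real (X * r) * c \<le> real (X * r) * real w" using w by (intro mult_left_mono) auto
    also have "\<dots> = real X * real M" by (simp add: r)
    also have "\<dots> \<le> y * c" using mn pos by (simp add: mult.commute)
    finally show "real (X * r) \<le> y" using pos by simp
  qed
  have zp': "z < real p'"
  proof -
    have "real w = real p' * real (w div p')" using w by (metis dvd_mult_div_cancel of_nat_mult)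
    also have "\<dots> \<le> real p' * c" using w by (intro mult_left_mono) auto
    finally have "s < real p' * c" using sw by simp
    then have "y * s < y * (real p' * c)" using y1 by simp
    also have "\<dots> = real p' * n" using pos by (simp add: mult_ac)
    finally have "z * n < real p' * n" using z by simp
    then show ?thesis using n by simp
  qed
  have roughw: "rough z w"
    unfolding rough_def using sw pos w(6) zp' by (metis less_trans of_nat_1 of_nat_less_iff of_nat_mono order_le_less_trans order_less_le_trans)
  show ?thesis
  proof (cases "X \<le> w")
    case True
    then show ?thesis using roughX roughw sX mXM r by (intro exI[of _ X] exI[of _ w] exI[of _ r]) simp
  next
    case False
    then show ?thesis using roughX roughw sw mXM r by (intro exI[of _ w] exI[of _ X] exI[of _ r]) simp
  qed
qed

section \<open>The cover of the interval by classes of products\<close>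

definition small_cofactor :: "nat \<Rightarrow> nat \<Rightarrow> nat set" where
  "small_cofactor n i = {u * v |u v. u \<in> {2 ^ i..<2 ^ (i + 1)} \<and>
     v \<in> {v. real v \<le> n / 2 ^ i \<and> real v \<le> n powr (2/3)}} \<inter> {1..n}"

definition rough_factors :: "nat \<Rightarrow> nat \<Rightarrow> nat set" where
  "rough_factors n i = {u. rough (n powr (1/7)) u \<and> real u \<le> sqrt n / 2 ^ i}"

text \<open>If 2^i \<le> sqrt n / u < 2^(i + 1), then w * r \<le> n / u < 2^(i + 1) * sqrt n, and u
  \<le> w gives r \<le> n / u^2 < 4^(i + 1). This limit on r keeps the density of the cofactors at
  order (i + 1) / ln n.\<close>

definition rough_cofactors :: "nat \<Rightarrow> nat \<Rightarrow> nat set" where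
  "rough_cofactors n i = {w * r |w r. rough (n powr (1/7)) w \<and> r \<in> {1..4 ^ (i + 1)} \<and> real (w * r) \<le> 2 ^ (i + 1) * sqrt n}"

lemma finite_rough_factors [simp]: "finite (rough_factors n i)"
  unfolding rough_factors_def by (rule finite_subset[OF _ finite_nat_le_real[of "sqrt n / 2 ^ i"]]) auto

lemma finite_rough_cofactors [simp]: "finite (rough_cofactors n i)"
  unfolding rough_cofactors_def by (rule finite_subset[OF _ finite_nat_le_real[of "2 ^ (i + 1) * sqrt n"]]) auto

lemma exists_dyadic:
  fixes t :: real
  assumes "1 \<le> t"
  shows "\<exists>i. 2 ^ i \<le> t \<and> t < 2 ^ (i + 1)"
proof -
  define k where "k = nat \<lfloor>t\<rfloor>"
  have k: "1 \<le> k" "real k \<le> t" "t < real k + 1" using assms unfolding k_def by (auto simp: le_nat_floor)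
  obtain i where i: "2 ^ i \<le> k" "k < 2 ^ (i + 1)" using ex_power_ivl1[of 2 k] k by auto
  have "(2::real) ^ i \<le> real k" using i(1) by (metis of_nat_le_iff of_nat_numeral of_nat_power)
  moreover have "real (k + 1) \<le> 2 ^ (i + 1)"
    using i(2) by (metis Suc_eq_plus1 Suc_leI of_nat_le_iff of_nat_numeral of_nat_power)
  ultimately show ?thesis using k by (intro exI[of _ i] conjI) linarith+
qed

lemma cover_interval:
  fixes \<Lambda> s :: real
  assumes n: "n \<ge> 1" and \<Lambda>: "1 \<le> \<Lambda>" and s_def: "s = sqrt n / \<Lambda>" and s: "1 \<le> s" "n powr (1/3) \<le> s"
    and z: "n powr (1/7) * n \<le> n powr (2/3) * s"
  shows "{1..n} \<subseteq> {x \<in> {1..n}. \<exists>p\<in>big_primes n. p dvd x} \<union> (\<Union>i\<in>{i. 2 ^ i \<le> s}. small_cofactor n i)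
     \<union> (\<Union>i\<in>{i. 2 ^ i < \<Lambda>}. {u * v |u v. u \<in> rough_factors n i \<and> v \<in> rough_cofactors n i})"
proof
  fix m assume m: "m \<in> {1..n}"
  let ?y = "real n powr (2/3)" and ?z = "real n powr (1/7)"
  have n0: "0 < sqrt n" "sqrt n * sqrt n = n" using n by auto
  consider "\<exists>p\<in>big_primes n. p dvd m"
    | u v where "m = u * v" "real v \<le> ?y" "real u \<le> s"
    | "\<not> (\<exists>p\<in>big_primes n. p dvd m)" "\<And>u v. m = u * v \<Longrightarrow> real v \<le> ?y \<Longrightarrow> s < real u"
    by (meson not_le)
  then show "m \<in> {x \<in> {1..n}. \<exists>p\<in>big_primes n. p dvd x} \<union> (\<Union>i\<in>{i. 2 ^ i \<le> s}. small_cofactor n i)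
     \<union> (\<Union>i\<in>{i. 2 ^ i < \<Lambda>}. {u * v |u v. u \<in> rough_factors n i \<and> v \<in> rough_cofactors n i})"
  proof cases
    case 1
    then show ?thesis using m by blast
  next
    case 2
    have u0: "1 \<le> u" using m 2 by (cases u) auto
    obtain i where i: "2 ^ i \<le> u" "u < 2 ^ (i + 1)" using ex_power_ivl1[of 2 u] u0 by auto
    have i': "2 ^ i \<le> real u" using i(1) by (metis of_nat_le_iff of_nat_numeral of_nat_power)
    have "2 ^ i * real v \<le> real u * real v" using i' by (intro mult_right_mono) auto
    also have "\<dots> \<le> n" using m 2(1) by (metis atLeastAtMost_iff of_nat_le_iff of_nat_mult)
    finally have "real v \<le> n / 2 ^ i" by (simp add: field_simps)
    then have "m \<in> small_cofactor n i" unfolding small_cofactor_def using 2 i m by auto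
    moreover have "2 ^ i \<le> s" using i' 2 by linarith
    ultimately show ?thesis by blast
  next
    case 3
    have "\<exists>u w r. m = u * (w * r) \<and> rough ?z u \<and> rough ?z w \<and> u \<le> w \<and> s < real u"
    proof (rule rough_decomposition[where c = "n powr (1/3)" and y = ?y and n = n])
      show "n powr (1/3) * n powr (1/3) = ?y" by (simp flip: powr_add)
      show "n powr (1/3) * ?y = n" using n by (simp flip: powr_add)
      show "1 \<le> n powr (1/3)" using n by (simp add: ge_one_powr_ge_zero)
      show "real p \<le> ?y" if p: "prime p" "p dvd m" for p
      proof (rule ccontr)
        assume "\<not> real p \<le> ?y"
        moreover have "p \<le> n" using p m dvd_imp_le[of p m] by auto
        ultimately have "p \<in> big_primes n" using p by (auto simp: big_primes_def)
        then show False using 3 p by blast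
      qed
    qed (use n s z m 3 in auto)
    then obtain u w r where uwr: "m = u * (w * r)" "rough ?z u" "rough ?z w" "u \<le> w" "s < real u" by blast
    have u0: "real u > 0" "real w > 0" using uwr by (auto simp: rough_def)
    have r1: "1 \<le> r" using m uwr(1) by (cases r) auto
    have mn: "real u * real (w * r) \<le> n" using m uwr(1) by (metis atLeastAtMost_iff of_nat_le_iff of_nat_mult)
    have uu: "real u * real u \<le> sqrt n * sqrt n"
    proof -
      have "real u * real u \<le> real u * (real w * real r)"
        using uwr(4) r1 mult_mono[of "real u" "real w" 1 "real r"] by (intro mult_left_mono) auto
      then show ?thesis using mn n0 by simp
    qed
    have us: "real u \<le> sqrt n"
      by (rule ccontr) (use uu n0 mult_strict_mono'[of "sqrt n" "real u" "sqrt n" "real u"] in linarith)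
    define t where "t = sqrt n / real u"
    have "1 \<le> t" using us u0 by (simp add: t_def)
    then obtain i where i: "2 ^ i \<le> t" "t < 2 ^ (i + 1)" using exists_dyadic by blast
    have iu: "real u \<le> sqrt n / 2 ^ i" "sqrt n < 2 ^ (i + 1) * real u"
      using i u0 by (auto simp: t_def field_simps)
    have "t < \<Lambda>"
    proof -
      have "sqrt n / \<Lambda> < real u" using uwr s_def by simp
      then show ?thesis using \<Lambda> u0 by (simp add: t_def field_simps)
    qed
    then have "2 ^ i < \<Lambda>" using i by linarith
    moreover have "u \<in> rough_factors n i" using uwr iu by (simp add: rough_factors_def)
    moreover have "w * r \<in> rough_cofactors n i"
    proof -
      have "real (w * r) * sqrt n \<le> real (w * r) * (2 ^ (i + 1) * real u)"
        using iu by (intro mult_left_mono) auto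
      also have "\<dots> = 2 ^ (i + 1) * (real u * real (w * r))" by simp
      also have "\<dots> \<le> 2 ^ (i + 1) * (sqrt n * sqrt n)" using mn n0 by (intro mult_left_mono) auto
      finally have v: "real (w * r) \<le> 2 ^ (i + 1) * sqrt n" using n0(1) by (simp only: mult.assoc[symmetric] mult_le_cancel_right_pos)
      have "real u * real r \<le> real w * real r" using uwr by (intro mult_right_mono) auto
      also have "\<dots> \<le> 2 ^ (i + 1) * sqrt n" using v by simp
      also have "\<dots> \<le> 2 ^ (i + 1) * (2 ^ (i + 1) * real u)" using iu by (intro mult_left_mono) auto
      also have "\<dots> = real u * (2 ^ (i + 1) * 2 ^ (i + 1))" by simp
      also have "(2 ^ (i + 1) * 2 ^ (i + 1) :: real) = 4 ^ (i + 1)" by (simp add: power_mult_distrib[symmetric])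
      finally have "real r \<le> 4 ^ (i + 1)" using u0 by (simp only: mult_le_cancel_left_pos)
      then have "r \<le> 4 ^ (i + 1)" by (metis of_nat_le_iff of_nat_numeral of_nat_power)
      then show ?thesis unfolding rough_cofactors_def using uwr r1 v by auto
    qed
    ultimately show ?thesis using uwr(1) by blast
  qed
qed

text \<open>For sides 2^i and n / 2^i the extremal bound has main term sqrt (2^i * n) \<le> sqrt (n
  * s), and the cap n^(2/3) on v controls its second term. With l = ln n and s = sqrt n / l^8 the
  main term is n^(3/4) / l^4; a factor l per element and about l classes still leave order n^(3/4) /
  l^2, below the target.\<close>

lemma sidon_count_small_cofactor:
  fixes s :: real
  assumes n: "n \<ge> 1" and i: "2 ^ i \<le> s"
  shows "real (sidon_count (small_cofactor n i)) \<le> exp ((sqrt (n * s) + n powr (2/3)) * ln n + 1)"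
proof (rule sidon_count_le_exp[OF n])
  show "small_cofactor n i \<subseteq> {1..n}" by (auto simp: small_cofactor_def)
  fix A assume A: "A \<subseteq> small_cofactor n i" "mult_sidon A"
  let ?b = "min (n / 2 ^ i) (n powr (2/3))"
  let ?U = "{2 ^ i..<2 ^ (i + 1) :: nat}"
  let ?V = "{v. real v \<le> n / 2 ^ i \<and> real v \<le> n powr (2/3)} - {0::nat}"
  have fV: "finite ?V" by (rule finite_subset[OF _ finite_nat_le_real[of ?b]]) auto
  have "A \<subseteq> {u * v |u v. u \<in> ?U \<and> v \<in> ?V}"
    using A by (force simp: small_cofactor_def)
  then obtain G where G: "G \<in> c4_graphs ?U ?V" "bij_betw (\<lambda>(u, v). u * v) G A"
    using mult_sidon_graph[OF A(2)] by blast
  have "real (card ?V) \<le> ?b" by (rule card_pos_nat_le_real) auto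
  moreover have "real (card ?U) \<le> 2 ^ i" by simp
  ultimately have cG: "real (card G) \<le> 2 ^ i * sqrt ?b + ?b"
    using G fV by (intro c4_free_card_le[of G ?U ?V]) (auto simp: c4_graphs_def)
  have "2 ^ i * sqrt ?b \<le> sqrt (n * s)"
  proof -
    have "2 ^ i * sqrt ?b \<le> 2 ^ i * sqrt (n / 2 ^ i)" by (intro mult_left_mono real_sqrt_le_mono) auto
    also have "\<dots> = sqrt (2 ^ i) * sqrt (2 ^ i) * sqrt (n / 2 ^ i)" by simp
    also have "\<dots> = sqrt (2 ^ i * n)" by (simp only: mult.assoc real_sqrt_mult[symmetric]) simp
    also have "\<dots> \<le> sqrt (n * s)" using mult_left_mono[OF i, of n] by (intro real_sqrt_le_mono) (simp add: mult.commute)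
    finally show ?thesis .
  qed
  then show "real (card A) \<le> sqrt (n * s) + n powr (2/3)"
    using cG bij_betw_same_card[OF G(2)] by linarith
qed

lemma prod_sidon_count_small_cofactor:
  fixes s :: real
  assumes n: "n \<ge> 1" and s: "1 \<le> s" "s \<le> n"
  shows "finite {i. 2 ^ i \<le> s}" and "(\<Prod>i\<in>{i. 2 ^ i \<le> s}. real (sidon_count (small_cofactor n i)))
    \<le> exp ((2 * ln n + 1) * ((sqrt (n * s) + n powr (2/3)) * ln n + 1))"
proof -
  let ?I = "{i::nat. 2 ^ i \<le> s}"
  let ?e = "(sqrt (n * s) + n powr (2/3)) * ln n + 1"
  have ln0: "0 \<le> ln (real n)" using n by simp
  have sub: "?I \<subseteq> {..nat \<lfloor>2 * ln n\<rfloor>}"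
  proof
    fix i assume i: "i \<in> ?I"
    have "real i * (2/3) \<le> real i * ln 2" using ln2_ge_two_thirds by (intro mult_left_mono) auto
    also have "\<dots> = ln (2 ^ i)" by (simp add: ln_realpow)
    also have "\<dots> \<le> ln n"
    proof (rule ln_mono)
      show "(2::real) ^ i \<le> n" using CollectD[OF i] s by linarith
    qed simp
    finally have "real i \<le> 2 * ln n" using ln0 by simp
    then show "i \<in> {..nat \<lfloor>2 * ln n\<rfloor>}" by (simp add: le_nat_floor)
  qed
  show f: "finite ?I" by (rule finite_subset[OF sub]) simp
  have "card ?I \<le> nat \<lfloor>2 * ln n\<rfloor> + 1"
    using card_mono[OF _ sub] by simp
  moreover have "real (nat \<lfloor>2 * ln n\<rfloor>) \<le> 2 * ln n" using ln0 by (intro of_nat_floor) auto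
  ultimately have c: "real (card ?I) \<le> 2 * ln n + 1" by linarith
  have e0: "0 \<le> ?e" using ln0 s by (intro add_nonneg_nonneg mult_nonneg_nonneg) auto
  have "(\<Prod>i\<in>?I. real (sidon_count (small_cofactor n i))) \<le> (\<Prod>i\<in>?I. exp ?e)"
    using sidon_count_small_cofactor[OF n] by (intro prod_mono) auto
  also have "\<dots> = exp (real (card ?I) * ?e)" by (simp add: exp_of_nat_mult)
  also have "\<dots> \<le> exp ((2 * ln n + 1) * ?e)" using c e0 by (simp only: exp_le_cancel_iff mult_right_mono)
  finally show "(\<Prod>i\<in>?I. real (sidon_count (small_cofactor n i))) \<le> exp ((2 * ln n + 1) * ?e)" .
qed

section \<open>Summing over the dyadic classes\<close>

text \<open>The series bounds the exponents of all rough classes: edge numbers decay like 2^(-i/2),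
  one factor i + 1 absorbs the surplus in sqrt b and the other absorbs ln (b / a). From i = 9 on the
  ratio is at most (11/10)^2 * 71/100 < 9/10.\<close>

lemma summable_quadratic_geometric: "summable (\<lambda>i. (real (i + 1))\<^sup>2 * (1 / sqrt 2) ^ i)"
proof (rule summable_ratio_test[where c = "9/10" and N = 9])
  fix i :: nat assume i: "i \<ge> 9"
  have s2: "1 / sqrt 2 \<le> (71/100::real)"
  proof -
    have "(100/71::real) \<le> sqrt 2" by (rule real_le_rsqrt) (simp add: power2_eq_square)
    then show ?thesis by (simp add: field_simps)
  qed
  have "real (i + 2) \<le> 11/10 * real (i + 1)" using i by simp
  then have "(real (i + 2))\<^sup>2 \<le> (11/10 * real (i + 1))\<^sup>2" by (intro power_mono) auto
  then have "(real (i + 2))\<^sup>2 * (1 / sqrt 2) \<le> (11/10 * real (i + 1))\<^sup>2 * (71/100)"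
    using s2 by (intro mult_mono) auto
  also have "\<dots> \<le> 9/10 * (real (i + 1))\<^sup>2" by (simp add: power2_eq_square field_simps)
  finally have "(real (i + 2))\<^sup>2 * (1 / sqrt 2) * (1 / sqrt 2) ^ i \<le> 9/10 * (real (i + 1))\<^sup>2 * (1 / sqrt 2) ^ i"
    by (intro mult_right_mono) auto
  then show "norm ((real (Suc i + 1))\<^sup>2 * (1 / sqrt 2) ^ Suc i) \<le> 9/10 * norm ((real (i + 1))\<^sup>2 * (1 / sqrt 2) ^ i)"
    by (simp add: mult_ac)
qed simp

text \<open>The sides have sizes of order sqrt n / (2^i * l) and (i + 1) * 2^i * sqrt n / l, so a *
  sqrt b is the target scale times sqrt (i + 1) * 2^(-i/2) up to a constant, while ln (b / a) grows
  linearly in i. The assumptions \<open>h\<close> hold for large n and make \<open>kw_params\<close>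
  and the rough counts applicable.\<close>

lemma sidon_count_rough_products:
  fixes \<Lambda> l K :: real
  assumes n: "n \<ge> 3" and l: "l = ln n" "1 \<le> l" and \<Lambda>: "\<Lambda> = l ^ 8" and K: "K = rough_const" "K \<le> l"
    and h: "l ^ 9 \<le> sqrt n" "6 * l ^ 16 * sqrt n + 1 \<le> n" "2 * l ^ 8 * sqrt n \<le> n" "((8 * l ^ 4 + l)\<^sup>2 * 6 * l ^ 33) \<le> sqrt n"
    and i: "2 ^ i < \<Lambda>"
  shows "real (sidon_count {u * v |u v. u \<in> rough_factors n i \<and> v \<in> rough_cofactors n i})
     \<le> exp (22 * K * sqrt (6 * K) * sidon_scale n * ((real (i + 1))\<^sup>2 * (1 / sqrt 2) ^ i))"
proof -
  define S where "S = sqrt (real n)"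
  have S0: "S > 0" "S * S = n" using n by (auto simp: S_def)
  define a where "a = K * S / (2 ^ i * l)"
  \<comment> \<open>The factor 6 * (i + 1) combines the 2 from 2^(i + 1) with 1 + ln (4^(i + 1))
    \<le> 3 * (i + 1).\<close>
  define b where "b = 6 * K * real (i + 1) * 2 ^ i * S / l"
  have l0: "l > 0" using l by simp
  have K1: "1 \<le> K" using K rough_const_ge_1 by simp
  have i1: "real (i + 1) \<le> 2 ^ i"
    by (metis Suc_eq_plus1 Suc_leI less_exp of_nat_le_iff of_nat_numeral of_nat_power)
  have i\<Lambda>: "2 ^ i \<le> l ^ 8" using i \<Lambda> by simp
  have i18: "real (i + 1) \<le> l ^ 8" using i1 i\<Lambda> by linarith
  have ap: "a > 0" "b > 0" using K1 S0 l0 by (auto simp: a_def b_def intro!: divide_pos_pos mult_pos_pos)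
  have a1: "1 \<le> a"
  proof -
    have "2 ^ i * l \<le> l ^ 8 * l" using i\<Lambda> l0 by (intro mult_right_mono) auto
    also have "\<dots> = l ^ 9" by (simp add: power_numeral_even power_numeral_odd mult_ac)
    also have "\<dots> \<le> 1 * S" using h by (simp add: S_def)
    also have "\<dots> \<le> K * S" using K1 S0 by (intro mult_right_mono) auto
    finally show ?thesis using l0 by (simp add: a_def)
  qed
  have ba: "b / a = 6 * real (i + 1) * 4 ^ i"
  proof -
    have "(2::real) ^ i * 2 ^ i = 4 ^ i" by (simp add: power_mult_distrib[symmetric])
    then show ?thesis using K1 S0 l0 by (simp add: a_def b_def field_simps)
  qed
  have ab: "a \<le> b"
  proof -
    have "1 * 1 * 1 \<le> 6 * real (i + 1) * 4 ^ i" by (intro mult_mono) auto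
    then have "1 \<le> b / a" using ba by simp
    then show ?thesis using ap by (simp add: field_simps)
  qed
  have bn: "b + 1 \<le> n"
  proof -
    have "K * real (i + 1) * 2 ^ i * S \<le> l * l ^ 8 * l ^ 8 * S"
      using K K1 i18 i\<Lambda> l0 S0 by (intro mult_mono) auto
    also have "\<dots> = l * (l ^ 16 * S)" by (simp add: mult_ac flip: power_add)
    finally have "K * real (i + 1) * 2 ^ i * S / l \<le> l ^ 16 * S" using l0 by (simp add: field_simps)
    then have "b \<le> 6 * l ^ 16 * S" by (simp add: b_def)
    then show ?thesis using h by (simp add: S_def)
  qed
  define L where "L = ln (b + 1)"
  have Ll: "L \<le> l" unfolding L_def l using bn ap by (intro ln_mono) auto
  have L1: "1 \<le> L"
  proof -
    have "6 * a \<le> b"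
    proof -
      have "6 * 1 * 1 \<le> 6 * real (i + 1) * 4 ^ i" by (intro mult_mono) auto
      then have "6 \<le> b / a" using ba by simp
      then show ?thesis using ap by (simp add: field_simps)
    qed
    then have "exp 1 \<le> b + 1" using a1 e_less_272 by simp
    then show ?thesis unfolding L_def using ap by (subst ln_ge_iff) auto
  qed
  have gam: "8 * L ^ 4 + L \<le> a / sqrt b"
  proof -
    have "8 * L ^ 4 + L \<le> 8 * l ^ 4 + l"
      using Ll L1 by (intro add_mono mult_left_mono power_mono) auto
    also have "\<dots> \<le> a / sqrt b"
    proof (rule power2_le_imp_le)
      \<comment> \<open>This square is sqrt n up to powers of l: i + 1 and 2^i are at most l^8, 4^i
        is at most l^16, and \<open>a\<close> has one more l in its denominator, which adds up to
        l^33.\<close>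
      have "(a / sqrt b)\<^sup>2 = a / (b / a)" using ap by (simp add: power_divide power2_eq_square)
      also have "\<dots> = K * S / (6 * real (i + 1) * (2 ^ i * 4 ^ i) * l)" unfolding ba by (simp add: a_def mult_ac)
      also have "\<dots> \<ge> 1 * S / (6 * l ^ 8 * (l ^ 8 * l ^ 16) * l)"
      proof (intro frac_le mult_mono)
        have "(4::real) ^ i = 2 ^ i * 2 ^ i" by (simp add: power_mult_distrib[symmetric])
        also have "\<dots> \<le> l ^ 8 * l ^ 8" using i\<Lambda> by (intro mult_mono) auto
        also have "\<dots> = l ^ 16" by (simp flip: power_add)
        finally show "(4::real) ^ i \<le> l ^ 16" .
      qed (use K1 S0 i18 i\<Lambda> l0 in auto)
      finally have "S / (6 * l ^ 33) \<le> (a / sqrt b)\<^sup>2" by (simp add: mult.assoc flip: power_add power_Suc2)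
      moreover have "(8 * l ^ 4 + l)\<^sup>2 \<le> S / (6 * l ^ 33)"
        using h(4) l0 by (simp add: S_def field_simps)
      ultimately show "(8 * l ^ 4 + l)\<^sup>2 \<le> (a / sqrt b)\<^sup>2" by linarith
    qed (use ap in auto)
    finally show ?thesis .
  qed
  interpret kw: kw_params a b L "sqrt b" "a / sqrt b"
    by unfold_locales (use a1 ab L1 gam in \<open>auto simp: L_def\<close>)
  have U: "real (card (rough_factors n i)) \<le> a"
  proof -
    have "sqrt n / 2 ^ i \<le> sqrt n / 1" using n by (intro divide_left_mono) auto
    also have "\<dots> \<le> n" using S0 mult_left_mono[of 1 S S] n by (simp add: S_def)
    finally have "real (card (rough_factors n i)) \<le> rough_const * (sqrt n / 2 ^ i) / ln n"
      unfolding rough_factors_def using n by (intro card_rough_le) auto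
    then show ?thesis by (simp add: a_def K l S_def)
  qed
  have V: "real (card (rough_cofactors n i)) \<le> b"
  proof -
    have "2 ^ (i + 1) * sqrt n \<le> 2 * l ^ 8 * sqrt n" using i\<Lambda> by (intro mult_right_mono) auto
    also have "\<dots> \<le> n" by (rule h)
    finally have "real (card (rough_cofactors n i)) \<le> rough_const * (2 ^ (i + 1) * sqrt n) / ln n * (1 + ln (real (4 ^ (i + 1))))"
      unfolding rough_cofactors_def using n by (intro card_rough_multiples_le) auto
    also have "ln (real (4 ^ (i + 1))) = real (i + 1) * (2 * ln 2)"
      using ln_realpow[of 2 2] by (simp add: ln_realpow ln_mult ring_distribs)
    also have "rough_const * (2 ^ (i + 1) * sqrt n) / ln n * (1 + real (i + 1) * (2 * ln 2)) \<le> rough_const * (2 ^ (i + 1) * sqrt n) / ln n * (real (i + 1) + real (i + 1) * (2 * 1))"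
      using K1 K l l0 ln2_le_25_over_36 by (intro mult_left_mono add_mono) auto
    also have "\<dots> = b" by (simp add: b_def l S_def K)
    finally show ?thesis .
  qed
  have "real (sidon_count {u * v |u v. u \<in> rough_factors n i \<and> v \<in> rough_cofactors n i}) \<le> real (card (c4_graphs (rough_factors n i) (rough_cofactors n i)))"
    by (intro of_nat_mono sidon_count_products_le) auto
  also have "\<dots> \<le> exp (a * sqrt b * (18 + ln (b / a)))"
    by (rule kw.card_c4_graphs_le) (use U V in auto)
  also have "\<dots> \<le> exp (22 * K * sqrt (6 * K) * sidon_scale n * ((real (i + 1))\<^sup>2 * (1 / sqrt 2) ^ i))"
  proof -
    have scale: "S / l * (sqrt S / sqrt l) = sidon_scale n"
    proof -
      have "sidon_scale n = real n powr (1/2 + 1/4) / l powr (1 + 1/2)" by (simp add: sidon_scale_def l)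
      also have "\<dots> = (real n powr (1/2) * real n powr (1/4)) / (l * l powr (1/2))"
        using l0 n by (simp only: powr_add) simp
      also have "real n powr (1/4) = (real n powr (1/2)) powr (1/2)" by (simp add: powr_powr)
      finally show ?thesis using l0 n by (simp add: S_def powr_half_sqrt)
    qed
    have "sqrt b = sqrt (6 * K) * sqrt (real (i + 1)) * sqrt (2 ^ i) * (sqrt S / sqrt l)"
      by (simp only: b_def real_sqrt_mult real_sqrt_divide times_divide_eq_right)
    then have "a * sqrt b = K * sqrt (6 * K) * (S / l * (sqrt S / sqrt l)) * (sqrt (real (i + 1)) * (sqrt (2 ^ i) / 2 ^ i))"
      by (simp add: a_def mult_ac)
    also have "sqrt (2 ^ i) / 2 ^ i = (1 / sqrt 2) ^ i"
    proof -
      have "(2::real) ^ i = sqrt 2 ^ i * sqrt 2 ^ i" by (simp flip: power_mult_distrib)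
      then show ?thesis by (simp add: real_sqrt_power power_one_over field_simps)
    qed
    finally have e: "a * sqrt b = K * sqrt (6 * K) * sidon_scale n * (sqrt (real (i + 1)) * (1 / sqrt 2) ^ i)"
      unfolding scale .
    have sc0: "0 \<le> sidon_scale n" by (simp add: sidon_scale_def)
    have lnba: "18 + ln (b / a) \<le> 22 * real (i + 1)"
    proof -
      have "ln (b / a) = ln 6 + ln (real (i + 1)) + real i * (2 * ln 2)"
      proof -
        have *: "ln (6 * j * 4 ^ i) = ln 6 + ln j + real i * (2 * ln 2)" if "0 < j" for j :: real
          using that ln_realpow[of 2 2] by (simp add: ln_mult ln_realpow)
        show ?thesis unfolding ba by (rule *) simp
      qed
      moreover have "ln (6::real) \<le> 5" using ln_le_minus_one[of 6] by simp
      then have "ln (6::real) \<le> ln 8" by simp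
      moreover have "ln (8::real) = 3 * ln 2" using ln_realpow[of 2 3] by simp
      moreover have "ln (real (i + 1)) \<le> real i" using ln_le_minus_one[of "real (i + 1)"] by simp
      moreover have "real i * (2 * ln 2) \<le> real i * (2 * 1)"
        using ln2_le_25_over_36 by (intro mult_left_mono) auto
      ultimately show ?thesis using ln2_le_25_over_36 by simp
    qed
    have sq: "sqrt (real (i + 1)) \<le> real (i + 1)" by (rule real_le_lsqrt) (auto simp: power2_eq_square)
    have "sqrt (real (i + 1)) * (18 + ln (b / a)) \<le> real (i + 1) * (22 * real (i + 1))"
      using sq lnba ab ap by (intro mult_mono) auto
    also have "\<dots> = 22 * (real (i + 1))\<^sup>2" by (simp only: power2_eq_square mult_ac)
    finally have "(sqrt (real (i + 1)) * (18 + ln (b / a))) * (1 / sqrt 2) ^ i \<le> (22 * (real (i + 1))\<^sup>2) * (1 / sqrt 2) ^ i"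
      by (rule mult_right_mono) simp
    then have "K * sqrt (6 * K) * sidon_scale n * ((sqrt (real (i + 1)) * (18 + ln (b / a))) * (1 / sqrt 2) ^ i)
        \<le> K * sqrt (6 * K) * sidon_scale n * ((22 * (real (i + 1))\<^sup>2) * (1 / sqrt 2) ^ i)"
      using K1 sc0 by (intro mult_left_mono) auto
    then show ?thesis unfolding e exp_le_cancel_iff by (simp only: mult_ac)
  qed
  finally show ?thesis .
qed

theorem S_count_upper: "\<exists>C>0. \<forall>\<^sub>F n in sequentially. S_count n \<le> T_prod n * exp (C * sidon_scale n)"
proof -
  define K where "K = rough_const"
  define \<Sigma> where "\<Sigma> = (\<Sum>i. (real (i + 1))\<^sup>2 * (1 / sqrt 2) ^ i)"
  define C where "C = 22 * K * sqrt (6 * K) * \<Sigma>"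
  have K1: "1 \<le> K" using rough_const_ge_1 by (simp add: K_def)
  have \<Sigma>0: "0 \<le> \<Sigma>" unfolding \<Sigma>_def by (intro suminf_nonneg summable_quadratic_geometric) auto
  have C0: "0 \<le> C" unfolding C_def using K1 \<Sigma>0 by simp
  have "\<forall>\<^sub>F n in sequentially. K \<le> ln (real n)" by real_asymp
  moreover have "\<forall>\<^sub>F n::nat in sequentially. ln n ^ 9 \<le> sqrt n" by real_asymp
  moreover have "\<forall>\<^sub>F n::nat in sequentially. 6 * ln n ^ 16 * sqrt n + 1 \<le> n" by real_asymp
  moreover have "\<forall>\<^sub>F n::nat in sequentially. 2 * ln n ^ 8 * sqrt n \<le> n" by real_asymp
  moreover have "\<forall>\<^sub>F n::nat in sequentially. (8 * ln n ^ 4 + ln n)\<^sup>2 * 6 * ln n ^ 33 \<le> sqrt n" by real_asymp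
  moreover have "\<forall>\<^sub>F n::nat in sequentially. 1 \<le> sqrt n / ln n ^ 8" by real_asymp
  moreover have "\<forall>\<^sub>F n::nat in sequentially. sqrt n / ln n ^ 8 \<le> n" by real_asymp
  moreover have "\<forall>\<^sub>F n::nat in sequentially. n powr (1/3) \<le> sqrt n / ln n ^ 8" by real_asymp
  moreover have "\<forall>\<^sub>F n::nat in sequentially. n powr (1/7) * n \<le> n powr (2/3) * (sqrt n / ln n ^ 8)" by real_asymp
  \<comment> \<open>The rest of the large primes and the small cofactors together cost at most one
    more \<open>sidon_scale n\<close>, which turns C into C + 1.\<close>
  moreover have "\<forall>\<^sub>F n::nat in sequentially. n powr (2/3) * ln n + 1 + (2 * ln n + 1) * ((sqrt (n * (sqrt n / ln n ^ 8)) + n powr (2/3)) * ln n + 1) \<le> sidon_scale n"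
    unfolding sidon_scale_def by real_asymp
  moreover have "\<forall>\<^sub>F n::nat in sequentially. n \<ge> 3" by (rule eventually_ge_at_top)
  ultimately have "\<forall>\<^sub>F n in sequentially. S_count n \<le> T_prod n * exp ((C + 1) * sidon_scale n)"
  proof eventually_elim
    case (elim n)
    define l where "l = ln (real n)"
    define s where "s = sqrt n / l ^ 8"
    note el = elim[folded l_def, folded s_def]
    have l1: "1 \<le> l" using el K1 by linarith
    have n1: "n \<ge> 1" using el by simp
    have s0: "0 \<le> sidon_scale n" by (simp add: sidon_scale_def)
    let ?A = "{x \<in> {1..n}. \<exists>p\<in>big_primes n. p dvd x}"
    let ?I = "{i::nat. 2 ^ i \<le> s}" and ?J = "{i::nat. 2 ^ i < l ^ 8}"
    let ?B = "\<Union>i\<in>?I. small_cofactor n i"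
    let ?R = "\<lambda>i. {u * v |u v. u \<in> rough_factors n i \<and> v \<in> rough_cofactors n i}"
    let ?D = "\<Union>i\<in>?J. ?R i"
    have fB: "finite (small_cofactor n i)" for i by (simp add: small_cofactor_def)
    have fR: "finite (?R i)" for i
      by (rule finite_subset[of _ "(\<lambda>(u, v). u * v) ` (rough_factors n i \<times> rough_cofactors n i)"]) auto
    have fI: "finite ?I" using prod_sidon_count_small_cofactor(1)[OF n1, of s] el by simp
    have fJ: "finite ?J"
    proof (rule finite_subset)
      show "?J \<subseteq> {i. real i \<le> l ^ 8}"
      proof
        fix i assume "i \<in> ?J"
        moreover have "real i < 2 ^ i" using less_exp[of i] by (metis of_nat_less_iff of_nat_numeral of_nat_power)
        ultimately show "i \<in> {i. real i \<le> l ^ 8}" unfolding mem_Collect_eq by linarith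
      qed
    qed simp
    have "{1..n} \<subseteq> ?A \<union> ?B \<union> ?D"
      by (rule cover_interval) (use el l1 n1 s_def in \<open>auto simp: one_le_power\<close>)
    then have "sidon_count {1..n} \<le> sidon_count (?A \<union> ?B \<union> ?D)"
      using fI fJ fB fR by (intro sidon_count_mono) auto
    also have "\<dots> \<le> sidon_count (?A \<union> ?B) * sidon_count ?D"
      using fI fJ fB fR by (intro sidon_count_Un) auto
    also have "\<dots> \<le> (sidon_count ?A * sidon_count ?B) * sidon_count ?D"
      using fI fB by (intro mult_right_mono sidon_count_Un) auto
    also have "\<dots> \<le> (sidon_count ?A * (\<Prod>i\<in>?I. sidon_count (small_cofactor n i))) * (\<Prod>i\<in>?J. sidon_count (?R i))"
      using fI fJ fB fR by (intro mult_mono mult_left_mono sidon_count_UN) auto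
    finally have "real (S_count n) \<le> real ((sidon_count ?A * (\<Prod>i\<in>?I. sidon_count (small_cofactor n i))) * (\<Prod>i\<in>?J. sidon_count (?R i)))"
      by (simp only: of_nat_le_iff S_count_def sidon_count_def[of "{1..n}"])
    also have "\<dots> = real (sidon_count ?A) * (\<Prod>i\<in>?I. real (sidon_count (small_cofactor n i))) * (\<Prod>i\<in>?J. real (sidon_count (?R i)))"
      by (simp only: of_nat_mult of_nat_prod)
    also have "\<dots> \<le> (T_prod n * exp (n powr (2/3) * l + 1)) * exp ((2 * l + 1) * ((sqrt (n * s) + n powr (2/3)) * l + 1)) * exp (C * sidon_scale n)"
    proof (intro mult_mono)
      show "real (sidon_count ?A) \<le> T_prod n * exp (n powr (2/3) * l + 1)"
        using sidon_count_big_primes[OF n1] by (simp add: l_def)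
      show "(\<Prod>i\<in>?I. real (sidon_count (small_cofactor n i))) \<le> exp ((2 * l + 1) * ((sqrt (n * s) + n powr (2/3)) * l + 1))"
        using prod_sidon_count_small_cofactor(2)[OF n1, of s] el by (simp add: l_def)
      have "(\<Prod>i\<in>?J. real (sidon_count (?R i))) \<le> (\<Prod>i\<in>?J. exp (22 * K * sqrt (6 * K) * sidon_scale n * ((real (i + 1))\<^sup>2 * (1 / sqrt 2) ^ i)))"
      proof (rule prod_mono, intro conjI)
        fix i assume i: "i \<in> ?J"
        show "real (sidon_count (?R i)) \<le> exp (22 * K * sqrt (6 * K) * sidon_scale n * ((real (i + 1))\<^sup>2 * (1 / sqrt 2) ^ i))"
          by (rule sidon_count_rough_products[where l = l and \<Lambda> = "l ^ 8"]) (use el l1 i l_def K_def in auto)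
      qed simp
      also have "\<dots> = exp (22 * K * sqrt (6 * K) * sidon_scale n * (\<Sum>i\<in>?J. (real (i + 1))\<^sup>2 * (1 / sqrt 2) ^ i))"
        by (simp only: exp_sum[OF fJ, symmetric] sum_distrib_left)
      \<comment> \<open>The index set grows with n, but the full series bounds the exponent
        uniformly.\<close>
      also have "\<dots> \<le> exp (22 * K * sqrt (6 * K) * sidon_scale n * \<Sigma>)"
        unfolding exp_le_cancel_iff \<Sigma>_def using K1 s0 fJ
        by (intro mult_left_mono sum_le_suminf summable_quadratic_geometric) auto
      also have "\<dots> = exp (C * sidon_scale n)" by (simp add: C_def mult_ac)
      finally show "(\<Prod>i\<in>?J. real (sidon_count (?R i))) \<le> exp (C * sidon_scale n)" .
    qed (auto intro!: prod_nonneg)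
    also have "\<dots> = T_prod n * exp ((n powr (2/3) * l + 1 + (2 * l + 1) * ((sqrt (n * s) + n powr (2/3)) * l + 1)) + C * sidon_scale n)"
      by (simp only: exp_add mult.assoc)
    also have "\<dots> \<le> T_prod n * exp (sidon_scale n + C * sidon_scale n)"
      using el by (intro mult_left_mono) auto
    also have "\<dots> = T_prod n * exp ((C + 1) * sidon_scale n)" by (simp add: ring_distribs add.commute)
    finally show ?case .
  qed
  then show ?thesis using C0 by (intro exI[of _ "C + 1"]) auto
qed

theorem theorem1p1:
  shows "\<exists>C>0. (\<exists>g :: nat \<Rightarrow> real. g \<longlonglongrightarrow> 0 \<and>
           (\<forall>\<^sub>F n in sequentially.
              real (T_prod n) * 2 powr ((sqrt 2 + g n) * sidon_scale n) \<le> real (S_count n)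
            \<and> real (S_count n) \<le> real (T_prod n) * 2 powr (C * sidon_scale n)))"
proof -
  obtain C where C: "C > 0" "\<forall>\<^sub>F n in sequentially. S_count n \<le> T_prod n * exp (C * sidon_scale n)"
    using S_count_upper by blast
  have "exp (C * x) = 2 powr (C / ln 2 * x)" for x by (simp add: powr_def)
  then have "\<forall>\<^sub>F n in sequentially. real (T_prod n) * 2 powr ((sqrt 2 + 0) * sidon_scale n) \<le> real (S_count n)
      \<and> real (S_count n) \<le> real (T_prod n) * 2 powr (C / ln 2 * sidon_scale n)"
    using eventually_conj[OF S_count_lower C(2)] by simp
  then show ?thesis
    using C(1) by (intro exI[of _ "C / ln 2"] conjI exI[of _ "\<lambda>_. 0"]) auto
qed

end
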